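(* Let $n,m\ge1$, $N\ge 1$. Let $T\in\mathrm{End}_{U(N)}(\overset{\circ}{T}_{n,m})$ be given by Koike–Schur–Weyl duality as $T=\rho_N(\kappa_T)$ with $\kappa_T\in\mathbb C[S_{n,m}]$, and put $m_T=\sum_{\sigma\in S_{n,m}}m_T(\sigma)\sigma$ with $$m_T(\sigma)=\mathrm{Tr}_{\overset{\circ}{T}_{n,m}}\big(T\rho_N(\sigma^{-1})\big)\qquad\forall\sigma\in S_{n,m}.$$ For $N\ge n+m$, $\Omega^N_{n,m}$ is central and invertible in $\mathbb C[S_{n,m}]$ with inverse $$\mathrm{Wg}^N_{n,m}=(\Omega^N_{n,m})^{-1}=\sum_{\alpha\times\beta\in S_{n,m}}\mathrm{Wg}^N_{n+m}(\alpha\times\beta)\,\alpha\times\beta,$$ and $$\kappa_T=\mathrm{Wg}^N_{n,m}*m_T .$$ Moreover, $$q_{n,m}=\Omega^N_{n,m}\,\theta^{-1}(\mathrm{Wg}^N_{n+m})=\theta^{-1}(\mathrm{Wg}^N_{n+m})\,\Omega^N_{n,m}.$$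
   Context: **Tensors.** $V=\mathbb C^N$, $T_{n,m}=V^{\otimes n}\otimes(V^* )^{\otimes m}$ with the diagonal action of $U(N)$ and the action $\rho_N$ of $S_{n,m}=S_n\times S_m$ permuting the $V$ factors and the $V^*$ factors: $\alpha\times\beta$ maps $v_1\otimes\cdots\otimes v_n\otimes\omega_1\otimes\cdots\otimes\omega_m$ to $v_{\alpha^{-1}(1)}\otimes\cdots\otimes v_{\alpha^{-1}(n)}\otimes\omega_{\beta^{-1}(1)}\otimes\cdots\otimes\omega_{\beta^{-1}(m)}$. The space of traceless tensors $\overset{\circ}{T}_{n,m}\subset T_{n,m}$ is the intersection of the kernels of all contractions $c_{i,j}:T_{n,m}\to T_{n-1,m-1}$ pairing the $i$-th $V$ factor with the $j$-th $V^*$ factor; it is stable under $U(N)$ and $S_{n,m}$. Koike–Schur–Weyl duality states that $\mathrm{End}_{U(N)}(\overset{\circ}{T}_{n,m})$ is the image of $\mathbb C[S_{n,m}]$. $P^{n,m}_N$ is the $U(N)\times S_{n,m}$-equivariant (orthogonal) projection from $T_{n,m}$ onto $\overset{\circ}{T}_{n,m}$. **Group algebra elements.** $\Omega^N_n=\sum_{\sigma\in S_n}N^{\#\sigma}\sigma\in\mathbb C[S_n]$, $\#\sigma$ the number of cycles; for $N\ge n$ it is invertible and $\mathrm{Wg}^N_n=(\Omega^N_n)^{-1}=\sum_{\sigma}\mathrm{Wg}_n^N(\sigma)\sigma$. $\Omega^N_{n,m}=\sum_{\sigma\in S_{n,m}}\mathrm{Tr}_{\overset{\circ}{T}_{n,m}}(\rho_N(\sigma^{-1}))\,\sigma\in\mathbb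 C[S_{n,m}]$. $S_{n,m}$ is viewed as a subgroup of $S_{n+m}$ in the usual way; $*$ is the product of the group algebra. **Walled Brauer algebra.** $\mathcal D_{n,m}$ is the set of perfect matchings $\pi$ of $\{-m,\dots,-1,1,\dots,n\}\times\{-1,1\}$ (second coordinate $1$: top row, $-1$: bottom row) such that $(v,\eta)$ and $(v',\eta')$ are matched only if $\mathrm{sign}(v')\eta'=-\mathrm{sign}(v)\eta$. $\mathcal B_{n,m}(N)$ is the algebra with basis $\mathcal D_{n,m}$ and product $\pi\cdot\mu=N^{l(\pi,\mu)}c(\pi,\mu)$, where $c(\pi,\mu)$ is the diagram obtained by stacking $\pi$ on top of $\mu$ and $l(\pi,\mu)$ the number of closed loops created. It acts on $T_{n,m}$ by $\rho_N$: the input sits on the bottom row (positions $i>0$ for $V$ factors, $-j<0$ for $V^*$ factors), bottom horizontal strings contract, vertical strings transport factors to the top row, top horizontal strings insert the canonical element $\sum_ie_i\otimes e_i^*$. Diagrams without horizontal strings are identified with $S_{n,m}$ ($\alpha\times\beta$ joins bottom $i$ to top $\alpha(i)$ and bottom $-j$ to top $-\beta(j)$). For $N\ge n+m$, $q_{n,m}$ is the unique element of $\mathcal B_{n,m}(N)$ with $\rho_N(q_{n,m})=P^{n,m}_N$. $\theta:\mathcal D_{n,m}\to S_{n+m}$ is the bijection obtained by exchanging the top and bottom vertices at the $m$ negative positions (giving a matching with only vertical strings, read as a permutation of $n+m$ points, $-j$ being identified with $n+j$), extended linearly to $\mathcal B_{n,m}(N)\to\mathbb C[S_{n+m}]$.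 *)

theory Defs
  imports
    Complex_Main
    "HOL-Library.FuncSet"
    "HOL-Library.Disjoint_Sets"
    "HOL-Library.Function_Algebras"
    "HOL-Combinatorics.Orbits"
    "HOL-Algebra.Ring"
    "HOL-Algebra.Sym_Groups"
begin

section \<open>Group algebras\<close>

definition group_algebra :: "('g, 'r) monoid_scheme \<Rightarrow> ('g \<Rightarrow> complex) ring" where
  "group_algebra G =
    \<lparr> carrier = {a. \<forall>x. x \<notin> carrier G \<longrightarrow> a x = 0},
      mult = (\<lambda>a b x. if x \<in> carrier G
                then \<Sum>y\<in>carrier G. a y * b (inv\<^bsub>G\<^esub> y \<otimes>\<^bsub>G\<^esub> x) else 0),
      one = (\<lambda>x. if x = \<one>\<^bsub>G\<^esub> then 1 else 0),
      zero = (\<lambda>x. 0),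
      add = (\<lambda>a b x. a x + b x) \<rparr>"

definition central_in :: "('a, 'r) monoid_scheme \<Rightarrow> 'a \<Rightarrow> bool" where
  "central_in A a \<longleftrightarrow> a \<in> carrier A \<and> (\<forall>b\<in>carrier A. a \<otimes>\<^bsub>A\<^esub> b = b \<otimes>\<^bsub>A\<^esub> a)"

abbreviation sym_group2 :: "nat \<Rightarrow> nat \<Rightarrow> ((nat \<Rightarrow> nat) \<times> (nat \<Rightarrow> nat)) monoid" where
  "sym_group2 n m \<equiv> sym_group n \<times>\<times> sym_group m"

text \<open>The embedding of \<open>S_n \<times> S_m\<close> into \<open>S_(n+m)\<close>; the second factor acts on \<open>{n+1..n+m}\<close>.\<close>

definition sym_embed :: "nat \<Rightarrow> nat \<Rightarrow> (nat \<Rightarrow> nat) \<times> (nat \<Rightarrow> nat) \<Rightarrow> (nat \<Rightarrow> nat)" where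
  "sym_embed n m = (\<lambda>(\<alpha>, \<beta>) a.
     if a \<in> {1..n} then \<alpha> a else if a \<in> {n+1..n+m} then n + \<beta> (a - n) else a)"

text \<open>The number of cycles on \<open>{1..n}\<close>, fixed points included.\<close>

definition num_cycles :: "nat \<Rightarrow> (nat \<Rightarrow> nat) \<Rightarrow> nat" where
  "num_cycles n \<sigma> = card (orbit \<sigma> ` {1..n})"

definition Omega :: "nat \<Rightarrow> nat \<Rightarrow> (nat \<Rightarrow> nat) \<Rightarrow> complex" where
  "Omega N n = (\<lambda>\<sigma>. if \<sigma> \<in> carrier (sym_group n) then of_nat N ^ num_cycles n \<sigma> else 0)"

definition Wg :: "nat \<Rightarrow> nat \<Rightarrow> (nat \<Rightarrow> nat) \<Rightarrow> complex" where
  "Wg N n = inv\<^bsub>group_algebra (sym_group n)\<^esub> Omega N n"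


section \<open>Mixed tensors\<close>

text \<open>
  Positions \<open>1, \<dots>, n\<close> carry the factors \<open>V = \<complex>^N\<close> and positions \<open>-1, \<dots>, -m\<close> the factors \<open>V*\<close>.
  A tensor is given by its coordinates: \<open>t f\<close> is the coefficient of
  \<open>e_(f 1) \<otimes> \<dots> \<otimes> e_(f n) \<otimes> e*_(f (-1)) \<otimes> \<dots> \<otimes> e*_(f (-m))\<close>, where the standard basis of \<open>V\<close> is
  indexed by \<open>{..<N}\<close>.
\<close>

type_synonym multi_index = "int \<Rightarrow> nat"
type_synonym tensor = "multi_index \<Rightarrow> complex"

definition positions :: "nat \<Rightarrow> nat \<Rightarrow> int set" where
  "positions n m = {- int m .. -1} \<union> {1 .. int n}"

definition multi_indices :: "nat \<Rightarrow> nat \<Rightarrow> nat \<Rightarrow> multi_index set" where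
  "multi_indices N n m = positions n m \<rightarrow>\<^sub>E {..<N}"

definition tensors :: "nat \<Rightarrow> nat \<Rightarrow> nat \<Rightarrow> tensor set" where
  "tensors N n m = {t. \<forall>f. f \<notin> multi_indices N n m \<longrightarrow> t f = 0}"

definition tensor_scale :: "complex \<Rightarrow> tensor \<Rightarrow> tensor" where
  "tensor_scale c t = (\<lambda>f. c * t f)"

interpretation tensor: vector_space tensor_scale
  by unfold_locales (auto simp: tensor_scale_def fun_eq_iff algebra_simps)

definition tensor_inner :: "nat \<Rightarrow> nat \<Rightarrow> nat \<Rightarrow> tensor \<Rightarrow> tensor \<Rightarrow> complex" where
  "tensor_inner N n m s t = (\<Sum>f\<in>multi_indices N n m. s f * cnj (t f))"

text \<open>The trace over a subspace \<open>W\<close> of a linear map that sends \<open>W\<close> to itself.\<close>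

definition trace_on :: "tensor set \<Rightarrow> (tensor \<Rightarrow> tensor) \<Rightarrow> complex" where
  "trace_on W A =
     (let B = (SOME B. tensor.independent B \<and> tensor.span B = W)
      in \<Sum>b\<in>B. tensor.representation B (A b) b)"

definition unitary_matrices :: "nat \<Rightarrow> (nat \<Rightarrow> nat \<Rightarrow> complex) set" where
  "unitary_matrices N =
     {u. \<forall>i<N. \<forall>j<N. (\<Sum>k<N. u i k * cnj (u j k)) = (if i = j then 1 else 0)}"

text \<open>\<open>u\<close> acts on \<open>V*\<close> by \<open>\<omega> \<mapsto> \<omega> \<circ> u\<^sup>-\<^sup>1\<close>, which has the conjugate matrix in the dual basis.\<close>

definition unitary_act ::
  "nat \<Rightarrow> nat \<Rightarrow> nat \<Rightarrow> (nat \<Rightarrow> nat \<Rightarrow> complex) \<Rightarrow> tensor \<Rightarrow> tensor" where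
  "unitary_act N n m u t = (\<lambda>g. if g \<in> multi_indices N n m
     then \<Sum>f\<in>multi_indices N n m.
       (\<Prod>i\<in>{1..int n}. u (g i) (f i)) * (\<Prod>j\<in>{- int m..-1}. cnj (u (g j) (f j))) * t f
     else 0)"

definition signed_perm :: "(nat \<Rightarrow> nat) \<times> (nat \<Rightarrow> nat) \<Rightarrow> int \<Rightarrow> int" where
  "signed_perm = (\<lambda>(\<alpha>, \<beta>) v.
     if v > 0 then int (\<alpha> (nat v)) else if v < 0 then - int (\<beta> (nat (- v))) else 0)"

text \<open>
  The factor of \<open>\<rho>(\<alpha> \<times> \<beta>) (v\<^sub>1 \<otimes> \<dots> \<otimes> v\<^sub>n \<otimes> \<dots>)\<close> at position \<open>\<alpha>(k)\<close> is \<open>v\<^sub>k\<close>, so its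
  coordinate at \<open>f\<close> is the coordinate of the original tensor at \<open>f \<circ> \<alpha>\<close> (and likewise for \<open>\<beta>\<close>).
\<close>

definition perm_act :: "(nat \<Rightarrow> nat) \<times> (nat \<Rightarrow> nat) \<Rightarrow> tensor \<Rightarrow> tensor" where
  "perm_act \<sigma> t = (\<lambda>f. t (f \<circ> signed_perm \<sigma>))"

definition sym_act ::
  "nat \<Rightarrow> nat \<Rightarrow> ((nat \<Rightarrow> nat) \<times> (nat \<Rightarrow> nat) \<Rightarrow> complex) \<Rightarrow> tensor \<Rightarrow> tensor" where
  "sym_act n m \<kappa> t = (\<lambda>f. \<Sum>\<sigma>\<in>carrier (sym_group2 n m). \<kappa> \<sigma> * perm_act \<sigma> t f)"

text \<open>
  \<open>insert_pair n m i j k g\<close> is the multi-index of type \<open>(n,m)\<close> obtained from \<open>g\<close>, of type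
  \<open>(n-1,m-1)\<close>, by inserting the value \<open>k\<close> at the new positions \<open>i\<close> and \<open>-j\<close>.
\<close>

definition insert_pair :: "nat \<Rightarrow> nat \<Rightarrow> nat \<Rightarrow> nat \<Rightarrow> nat \<Rightarrow> multi_index \<Rightarrow> multi_index" where
  "insert_pair n m i j k g = (\<lambda>p\<in>positions n m.
     if p = int i \<or> p = - int j then k
     else if p > int i then g (p - 1)
     else if p < - int j then g (p + 1)
     else g p)"

definition contraction :: "nat \<Rightarrow> nat \<Rightarrow> nat \<Rightarrow> nat \<Rightarrow> nat \<Rightarrow> tensor \<Rightarrow> tensor" where
  "contraction N n m i j t = (\<lambda>g. if g \<in> multi_indices N (n - 1) (m - 1)
     then \<Sum>k<N. t (insert_pair n m i j k g) else 0)"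

definition traceless :: "nat \<Rightarrow> nat \<Rightarrow> nat \<Rightarrow> tensor set" where
  "traceless N n m =
     {t \<in> tensors N n m. \<forall>i\<in>{1..n}. \<forall>j\<in>{1..m}. contraction N n m i j t = 0}"

definition traceless_projection :: "nat \<Rightarrow> nat \<Rightarrow> nat \<Rightarrow> tensor \<Rightarrow> tensor" where
  "traceless_projection N n m t =
     (THE p. p \<in> traceless N n m \<and> (\<forall>s\<in>traceless N n m. tensor_inner N n m (t - p) s = 0))"

text \<open>
  \<open>End_(U(N))\<close> of the traceless tensors. Only the restriction of \<open>T\<close> to the traceless tensors
  matters.
\<close>

definition traceless_End_U :: "nat \<Rightarrow> nat \<Rightarrow> nat \<Rightarrow> (tensor \<Rightarrow> tensor) set" where
  "traceless_End_U N n m = {T.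
     (\<forall>t\<in>traceless N n m. T t \<in> traceless N n m) \<and>
     (\<forall>s\<in>traceless N n m. \<forall>t\<in>traceless N n m. T (s + t) = T s + T t) \<and>
     (\<forall>c. \<forall>t\<in>traceless N n m. T (tensor_scale c t) = tensor_scale c (T t)) \<and>
     (\<forall>u\<in>unitary_matrices N. \<forall>t\<in>traceless N n m.
        T (unitary_act N n m u t) = unitary_act N n m u (T t))}"

definition Omega2 :: "nat \<Rightarrow> nat \<Rightarrow> nat \<Rightarrow> (nat \<Rightarrow> nat) \<times> (nat \<Rightarrow> nat) \<Rightarrow> complex" where
  "Omega2 N n m = (\<lambda>\<sigma>. if \<sigma> \<in> carrier (sym_group2 n m)
     then trace_on (traceless N n m) (perm_act (inv\<^bsub>sym_group2 n m\<^esub> \<sigma>)) else 0)"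

definition moment ::
  "nat \<Rightarrow> nat \<Rightarrow> nat \<Rightarrow> (tensor \<Rightarrow> tensor) \<Rightarrow> (nat \<Rightarrow> nat) \<times> (nat \<Rightarrow> nat) \<Rightarrow> complex" where
  "moment N n m T = (\<lambda>\<sigma>. if \<sigma> \<in> carrier (sym_group2 n m)
     then trace_on (traceless N n m) (T \<circ> perm_act (inv\<^bsub>sym_group2 n m\<^esub> \<sigma>)) else 0)"


section \<open>The walled Brauer algebra\<close>

text \<open>A vertex is a pair (position, row), with row \<open>1\<close> on top and row \<open>-1\<close> at the bottom.\<close>

type_synonym vertex = "int \<times> int"
type_synonym diagram = "vertex set set"

definition diagrams :: "nat \<Rightarrow> nat \<Rightarrow> diagram set" where
  "diagrams n m = {\<pi>. partition_on (positions n m \<times> {-1, 1}) \<pi> \<and> (\<forall>e\<in>\<pi>. card e = 2) \<and>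
     (\<forall>e\<in>\<pi>. \<forall>(v, \<eta>)\<in>e. \<forall>(v', \<eta>')\<in>e. (v, \<eta>) \<noteq> (v', \<eta>') \<longrightarrow> sgn v' * \<eta>' = - (sgn v * \<eta>))}"

text \<open>
  In the stacking of \<open>\<pi>\<close> on top of \<open>\<mu>\<close>, the bottom row of \<open>\<pi>\<close> is glued to the top row of \<open>\<mu>\<close>
  to form the middle row \<open>0\<close>; this is the adjacency relation of the resulting graph.
\<close>

definition stack_rel :: "diagram \<Rightarrow> diagram \<Rightarrow> (vertex \<times> vertex) set" where
  "stack_rel \<pi> \<mu> = {(x, y). {x, y} \<in>
     (\<lambda>e. (\<lambda>(v, \<eta>). (v, if \<eta> = -1 then 0 else \<eta>)) ` e) ` \<pi> \<union>
     (\<lambda>e. (\<lambda>(v, \<eta>). (v, if \<eta> = 1 then 0 else \<eta>)) ` e) ` \<mu>}"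

definition diagram_comp :: "nat \<Rightarrow> nat \<Rightarrow> diagram \<Rightarrow> diagram \<Rightarrow> diagram" where
  "diagram_comp n m \<pi> \<mu> = {{x, y} | x y. x \<in> positions n m \<times> {-1, 1} \<and>
     y \<in> positions n m \<times> {-1, 1} \<and> x \<noteq> y \<and> (x, y) \<in> (stack_rel \<pi> \<mu>)\<^sup>*}"

text \<open>Closed loops are the connected components contained in the middle row.\<close>

definition diagram_loops :: "nat \<Rightarrow> nat \<Rightarrow> diagram \<Rightarrow> diagram \<Rightarrow> nat" where
  "diagram_loops n m \<pi> \<mu> =
     card {C \<in> (positions n m \<times> {-1, 0, 1}) // (stack_rel \<pi> \<mu>)\<^sup>*. C \<subseteq> positions n m \<times> {0}}"

definition perm_diagram :: "nat \<Rightarrow> nat \<Rightarrow> (nat \<Rightarrow> nat) \<times> (nat \<Rightarrow> nat) \<Rightarrow> diagram" where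
  "perm_diagram n m \<sigma> = {{(v, -1), (signed_perm \<sigma> v, 1)} | v. v \<in> positions n m}"

definition walled_brauer :: "nat \<Rightarrow> nat \<Rightarrow> nat \<Rightarrow> (diagram \<Rightarrow> complex) ring" where
  "walled_brauer N n m =
    \<lparr> carrier = {a. \<forall>\<pi>. \<pi> \<notin> diagrams n m \<longrightarrow> a \<pi> = 0},
      mult = (\<lambda>a b \<nu>. \<Sum>\<pi>\<in>diagrams n m. \<Sum>\<mu>\<in>diagrams n m.
                if diagram_comp n m \<pi> \<mu> = \<nu>
                then a \<pi> * b \<mu> * of_nat N ^ diagram_loops n m \<pi> \<mu> else 0),
      one = (\<lambda>\<pi>. if \<pi> = perm_diagram n m (id, id) then 1 else 0),
      zero = (\<lambda>\<pi>. 0),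
      add = (\<lambda>a b \<pi>. a \<pi> + b \<pi>) \<rparr>"

text \<open>
  The matrix entry of a diagram between the input \<open>e_f\<close> (bottom) and the output \<open>e_g\<close> (top) is \<open>1\<close>
  if the labels agree along every string and \<open>0\<close> otherwise. A bottom horizontal string thus
  evaluates \<open>e*_(f (-j)) (e_(f i))\<close>, and a top one produces \<open>\<Sum>\<^sub>k e_k \<otimes> e*_k\<close>.
\<close>

definition strings_agree :: "diagram \<Rightarrow> multi_index \<Rightarrow> multi_index \<Rightarrow> bool" where
  "strings_agree \<pi> g f \<longleftrightarrow> (\<forall>e\<in>\<pi>. \<forall>(v, \<eta>)\<in>e. \<forall>(v', \<eta>')\<in>e.
     (if \<eta> = 1 then g v else f v) = (if \<eta>' = 1 then g v' else f v'))"

definition diagram_act :: "nat \<Rightarrow> nat \<Rightarrow> nat \<Rightarrow> diagram \<Rightarrow> tensor \<Rightarrow> tensor" where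
  "diagram_act N n m \<pi> t = (\<lambda>g. if g \<in> multi_indices N n m
     then \<Sum>f\<in>multi_indices N n m. (if strings_agree \<pi> g f then 1 else 0) * t f else 0)"

definition brauer_act :: "nat \<Rightarrow> nat \<Rightarrow> nat \<Rightarrow> (diagram \<Rightarrow> complex) \<Rightarrow> tensor \<Rightarrow> tensor" where
  "brauer_act N n m a t = (\<lambda>g. \<Sum>\<pi>\<in>diagrams n m. a \<pi> * diagram_act N n m \<pi> t g)"

text \<open>The inclusion of the group algebra of \<open>S_n \<times> S_m\<close> into the walled Brauer algebra.\<close>

definition sym_to_brauer ::
  "nat \<Rightarrow> nat \<Rightarrow> ((nat \<Rightarrow> nat) \<times> (nat \<Rightarrow> nat) \<Rightarrow> complex) \<Rightarrow> diagram \<Rightarrow> complex" where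
  "sym_to_brauer n m \<kappa> = (\<lambda>\<pi>.
     \<Sum>\<sigma>\<in>{\<sigma> \<in> carrier (sym_group2 n m). perm_diagram n m \<sigma> = \<pi>}. \<kappa> \<sigma>)"

definition q_proj :: "nat \<Rightarrow> nat \<Rightarrow> nat \<Rightarrow> diagram \<Rightarrow> complex" where
  "q_proj N n m = (THE q. q \<in> carrier (walled_brauer N n m) \<and>
     (\<forall>t\<in>tensors N n m. brauer_act N n m q t = traceless_projection N n m t))"

text \<open>The points \<open>1, \<dots>, n\<close> and \<open>n+1, \<dots>, n+m\<close> stand for the positions \<open>1, \<dots>, n\<close> and \<open>-1, \<dots>, -m\<close>.\<close>

definition point_position :: "nat \<Rightarrow> nat \<Rightarrow> int" where
  "point_position n a = (if a \<le> n then int a else - int (a - n))"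

definition flip_negative :: "vertex \<Rightarrow> vertex" where
  "flip_negative = (\<lambda>(v, \<eta>). (v, if v < 0 then - \<eta> else \<eta>))"

text \<open>As for \<open>perm_diagram\<close>, permutations are read from the bottom row to the top row.\<close>

definition theta :: "nat \<Rightarrow> nat \<Rightarrow> diagram \<Rightarrow> (nat \<Rightarrow> nat)" where
  "theta n m \<pi> = (\<lambda>a. if a \<in> {1..n+m}
     then THE b. b \<in> {1..n+m} \<and>
       {(point_position n a, -1), (point_position n b, 1)} \<in> (\<lambda>e. flip_negative ` e) ` \<pi>
     else a)"

definition theta_linear :: "nat \<Rightarrow> nat \<Rightarrow> (diagram \<Rightarrow> complex) \<Rightarrow> (nat \<Rightarrow> nat) \<Rightarrow> complex" where
  "theta_linear n m a = (\<lambda>\<sigma>. \<Sum>\<pi>\<in>{\<pi> \<in> diagrams n m. theta n m \<pi> = \<sigma>}. a \<pi>)"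

definition theta_inverse ::
  "nat \<Rightarrow> nat \<Rightarrow> nat \<Rightarrow> ((nat \<Rightarrow> nat) \<Rightarrow> complex) \<Rightarrow> diagram \<Rightarrow> complex" where
  "theta_inverse N n m = inv_into (carrier (walled_brauer N n m)) (theta_linear n m)"

end

theory Submission
  imports Defs
begin

text \<open>
  Write \<open>\<rho>\<close> for the action of the walled Brauer algebra on the mixed tensors and
  \<open>\<langle>A, B\<rangle> = \<Sum> A g f * B g f\<close>, the sum being over all pairs of multi-indices, for the bilinear
  Hilbert-Schmidt pairing of two matrices.

  The matrix of a diagram has entries 0 and 1. Exchanging row and column index at the negative
  positions turns the matrix of \<open>\<pi>\<close> into the matrix by which the permutation \<open>\<theta>(\<pi>)\<close> permutes \<open>n + m\<close>
  copies of \<open>V\<close>. The pairing does not change under this exchange, so the Gram matrix of the diagrams is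
  the Gram matrix of the permutations, with entries \<open>N\<close> to the number of cycles of \<open>\<sigma>\<^sup>-\<^sup>1 \<tau>\<close>
  (\<open>sum_string_kernel_mult\<close>); it is the matrix of convolution by \<open>\<Omega>\<close>. For \<open>N \<ge> n + m\<close> the permutation
  matrices are linearly independent (\<open>string_kernel_independent\<close>), so \<open>\<Omega>\<close> is invertible, and the
  equation \<open>Wg * \<Omega> = 1\<close> says: the matrix \<open>Q = \<rho>(\<theta>\<^sup>-\<^sup>1(Wg))\<close> has pairing 1 with the identity diagram
  and 0 with every other diagram (\<open>sum_weingarten_string_kernel\<close>).

  From this duality, the columns of \<open>Q\<close> are traceless. Let \<open>E\<close> contract a factor \<open>V\<close> with a factor \<open>V*\<close>
  and insert the canonical element at the same place. The product of \<open>E\<close> with a diagram is a multiple of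
  a diagram that has the inserted string in its top row and hence is not the identity. Since \<open>E\<close> is
  self-adjoint, \<open>E Q\<close> is orthogonal to all such diagrams, hence to itself, and vanishes
  (\<open>loop_contract_weingarten_kernel\<close>).

  Let \<open>P\<close> be the projection onto the traceless tensors. Then \<open>Q = P Q\<close>, while \<open>P\<close> annihilates every
  diagram with a horizontal string. Only the diagrams of \<open>S\<^sub>n \<times> S\<^sub>m\<close> survive, and \<open>Q = P \<rho>(w)\<close> with \<open>w\<close> the
  restriction of \<open>Wg\<close> to this subgroup (\<open>weingarten_kernel_eq_proj\<close>). Here \<open>\<theta>\<close> sends \<open>\<alpha> \<times> \<beta>\<close> to
  \<open>\<alpha> \<times> \<beta>\<^sup>-\<^sup>1\<close>, which \<open>Wg\<close> does not distinguish from \<open>\<alpha> \<times> \<beta>\<close>, because it is a class function and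
  every permutation is conjugate to its inverse.

  The pairing of \<open>Q = P \<rho>(w)\<close> with the elements of \<open>S\<^sub>n \<times> S\<^sub>m\<close> produces traces over the traceless tensors
  and gives \<open>w * \<Omega>\<^sub>n\<^sub>,\<^sub>m = 1\<close> (\<open>Wg2_mult_Omega2\<close>). As a character, \<open>\<Omega>\<^sub>n\<^sub>,\<^sub>m\<close> is central, so \<open>w\<close> is its
  inverse. The moments satisfy \<open>m\<^sub>T = \<kappa> * \<Omega>\<^sub>n\<^sub>,\<^sub>m\<close> (\<open>moment_eq_mult\<close>), which is solved for \<open>\<kappa>\<close>. Finally
  \<open>P\<close> commutes with \<open>S\<^sub>n \<times> S\<^sub>m\<close>, so \<open>P = \<rho>(\<Omega>\<^sub>n\<^sub>,\<^sub>m) Q = Q \<rho>(\<Omega>\<^sub>n\<^sub>,\<^sub>m)\<close>. As the matrices of the diagrams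
  are linearly independent, this identifies \<open>q_proj\<close>; the products in the Brauer algebra that occur have
  one factor in the group algebra, and stacking with a permutation diagram merely relabels one row
  (\<open>stack_relabel\<close>).
\<close>

section \<open>Convolution on a finite group\<close>

lemma group_algebra_simps:
  "carrier (group_algebra G) = {a. \<forall>x. x \<notin> carrier G \<longrightarrow> a x = 0}"
  "a \<otimes>\<^bsub>group_algebra G\<^esub> b = (\<lambda>x. if x \<in> carrier G
     then \<Sum>y\<in>carrier G. a y * b (inv\<^bsub>G\<^esub> y \<otimes>\<^bsub>G\<^esub> x) else 0)"
  "\<one>\<^bsub>group_algebra G\<^esub> = (\<lambda>x. if x = \<one>\<^bsub>G\<^esub> then 1 else 0)"
  by (simp_all add: group_algebra_def)

lemma (in group) bij_betw_mult_left:
  assumes "z \<in> carrier G" shows "bij_betw (\<lambda>u. z \<otimes> u) (carrier G) (carrier G)"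
  by (rule bij_betwI[where g = "\<lambda>u. inv z \<otimes> u"]) (use assms in \<open>auto simp: m_assoc[symmetric]\<close>)

lemma (in group) monoid_group_algebra:
  assumes fin: "finite (carrier G)" shows "monoid (group_algebra G)"
proof (rule monoidI)
  fix a b c
  assume abc: "a \<in> carrier (group_algebra G)" "b \<in> carrier (group_algebra G)"
    "c \<in> carrier (group_algebra G)"
  have "(\<Sum>y\<in>carrier G. (\<Sum>z\<in>carrier G. a z * b (inv z \<otimes> y)) * c (inv y \<otimes> x)) =
    (\<Sum>z\<in>carrier G. a z * (\<Sum>u\<in>carrier G. b u * c (inv u \<otimes> (inv z \<otimes> x))))"
    if x: "x \<in> carrier G" for x
  proof -
    have "(\<Sum>y\<in>carrier G. (\<Sum>z\<in>carrier G. a z * b (inv z \<otimes> y)) * c (inv y \<otimes> x)) =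
      (\<Sum>z\<in>carrier G. \<Sum>y\<in>carrier G. a z * b (inv z \<otimes> y) * c (inv y \<otimes> x))"
      by (simp add: sum_distrib_right) (rule sum.swap)
    also have "\<dots> = (\<Sum>z\<in>carrier G. a z * (\<Sum>u\<in>carrier G. b u * c (inv u \<otimes> (inv z \<otimes> x))))"
    proof (rule sum.cong[OF refl])
      fix z assume z: "z \<in> carrier G"
      have "(\<Sum>y\<in>carrier G. a z * b (inv z \<otimes> y) * c (inv y \<otimes> x)) =
        (\<Sum>u\<in>carrier G. a z * b (inv z \<otimes> (z \<otimes> u)) * c (inv (z \<otimes> u) \<otimes> x))"
        by (rule sum.reindex_bij_betw[OF bij_betw_mult_left[OF z], symmetric])
      also have "\<dots> = (\<Sum>u\<in>carrier G. a z * (b u * c (inv u \<otimes> (inv z \<otimes> x))))"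
        by (rule sum.cong) (use z x in \<open>auto simp: m_assoc[symmetric] inv_mult_group\<close>)
      finally show "(\<Sum>y\<in>carrier G. a z * b (inv z \<otimes> y) * c (inv y \<otimes> x)) =
        a z * (\<Sum>u\<in>carrier G. b u * c (inv u \<otimes> (inv z \<otimes> x)))"
        by (simp add: sum_distrib_left)
    qed
    finally show ?thesis .
  qed
  then show "a \<otimes>\<^bsub>group_algebra G\<^esub> b \<otimes>\<^bsub>group_algebra G\<^esub> c =
      a \<otimes>\<^bsub>group_algebra G\<^esub> (b \<otimes>\<^bsub>group_algebra G\<^esub> c)"
    by (auto simp: group_algebra_simps fun_eq_iff)
next
  fix a assume a: "a \<in> carrier (group_algebra G)"
  have "(\<Sum>y\<in>carrier G. (if y = \<one> then 1 else 0) * a (inv y \<otimes> x)) = a x" if "x \<in> carrier G" for x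
    using fin that by (simp add: if_distrib[where f = "\<lambda>u. u * _"] sum.delta cong: if_cong)
  then show "\<one>\<^bsub>group_algebra G\<^esub> \<otimes>\<^bsub>group_algebra G\<^esub> a = a"
    using a by (auto simp: group_algebra_simps fun_eq_iff)
  have "(\<Sum>y\<in>carrier G. a y * (if inv y \<otimes> x = \<one> then 1 else 0)) = a x" if x: "x \<in> carrier G" for x
  proof -
    have "(\<Sum>y\<in>carrier G. a y * (if inv y \<otimes> x = \<one> then 1 else 0)) =
      (\<Sum>y\<in>carrier G. if y = x then a y else 0)"
      by (rule sum.cong) (use x in \<open>auto dest: inv_equality simp: inv_equality\<close>)
    then show ?thesis using fin x by (simp add: sum.delta)
  qed
  then show "a \<otimes>\<^bsub>group_algebra G\<^esub> \<one>\<^bsub>group_algebra G\<^esub> = a"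
    using a by (auto simp: group_algebra_simps fun_eq_iff)
qed (auto simp: group_algebra_simps)

lemma (in group) sum_convolution:
  assumes "finite (carrier G)"
  shows "(\<Sum>x\<in>carrier G. \<Sum>y\<in>carrier G. a x * b y * F (x \<otimes> y)) =
    (\<Sum>z\<in>carrier G. (a \<otimes>\<^bsub>group_algebra G\<^esub> b) z * F z)"
proof -
  have "(\<Sum>x\<in>carrier G. \<Sum>y\<in>carrier G. a x * b y * F (x \<otimes> y)) =
      (\<Sum>x\<in>carrier G. \<Sum>z\<in>carrier G. a x * b (inv x \<otimes> z) * F z)"
  proof (rule sum.cong[OF refl])
    fix x assume x: "x \<in> carrier G"
    have "(\<Sum>z\<in>carrier G. a x * b (inv x \<otimes> z) * F z) =
        (\<Sum>y\<in>carrier G. a x * b (inv x \<otimes> (x \<otimes> y)) * F (x \<otimes> y))"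
      by (rule sum.reindex_bij_betw[OF bij_betw_mult_left[OF x], symmetric])
    also have "\<dots> = (\<Sum>y\<in>carrier G. a x * b y * F (x \<otimes> y))"
      using x by (intro sum.cong refl) (simp add: m_assoc[symmetric])
    finally show "(\<Sum>y\<in>carrier G. a x * b y * F (x \<otimes> y)) = (\<Sum>z\<in>carrier G. a x * b (inv x \<otimes> z) * F z)" ..
  qed
  also have "\<dots> = (\<Sum>z\<in>carrier G. (a \<otimes>\<^bsub>group_algebra G\<^esub> b) z * F z)"
    by (subst sum.swap) (simp add: group_algebra_simps sum_distrib_right)
  finally show ?thesis .
qed

text \<open>
  The central elements of a group algebra are the class functions. The condition is stated as
  invariance under \<open>x y \<mapsto> y x\<close>, the form in which traces satisfy it.
\<close>
lemma (in group) central_in_group_algebra_iff: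
  assumes fin: "finite (carrier G)"
  shows "central_in (group_algebra G) a \<longleftrightarrow> a \<in> carrier (group_algebra G) \<and>
    (\<forall>x\<in>carrier G. \<forall>y\<in>carrier G. a (x \<otimes> y) = a (y \<otimes> x))"
proof (intro iffI conjI ballI)
  assume "central_in (group_algebra G) a"
  then show a: "a \<in> carrier (group_algebra G)" by (simp add: central_in_def)
  fix x y assume xy: "x \<in> carrier G" "y \<in> carrier G"
  \<comment> \<open>multiplication by the group element \<open>y\<^sup>-\<^sup>1\<close> from either side\<close>
  let ?d = "\<lambda>z. if z = inv y then 1 else (0::complex)"
  have "(a \<otimes>\<^bsub>group_algebra G\<^esub> ?d) x = (?d \<otimes>\<^bsub>group_algebra G\<^esub> a) x"
  proof -
    have "?d \<in> carrier (group_algebra G)" using xy by (auto simp: group_algebra_simps)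
    then show ?thesis using \<open>central_in _ _\<close> by (simp add: central_in_def)
  qed
  moreover have "(?d \<otimes>\<^bsub>group_algebra G\<^esub> a) x = a (y \<otimes> x)"
    using xy fin by (simp add: group_algebra_simps if_distrib[where f = "\<lambda>u. u * _"] sum.delta cong: if_cong)
  moreover have "(a \<otimes>\<^bsub>group_algebra G\<^esub> ?d) x = (\<Sum>z\<in>carrier G. if z = x \<otimes> y then a z else 0)"
  proof -
    have "inv z \<otimes> x = inv y \<longleftrightarrow> z = x \<otimes> y" if z: "z \<in> carrier G" for z
    proof
      assume "inv z \<otimes> x = inv y"
      then have "z \<otimes> (inv z \<otimes> x) \<otimes> y = z \<otimes> inv y \<otimes> y" by simp
      then show "z = x \<otimes> y" using xy z by (simp add: m_assoc[symmetric]) (simp add: m_assoc)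
    qed (use xy in \<open>simp add: inv_mult_group m_assoc\<close>)
    then show ?thesis
      using xy by (auto simp: group_algebra_simps intro!: sum.cong)
  qed
  ultimately show "a (x \<otimes> y) = a (y \<otimes> x)" using xy fin by (simp add: sum.delta)
next
  assume a: "a \<in> carrier (group_algebra G) \<and>
    (\<forall>x\<in>carrier G. \<forall>y\<in>carrier G. a (x \<otimes> y) = a (y \<otimes> x))"
  have "(\<Sum>y\<in>carrier G. a y * b (inv y \<otimes> x)) = (\<Sum>y\<in>carrier G. b y * a (inv y \<otimes> x))"
    if x: "x \<in> carrier G" for b x
  proof -
    have bij: "bij_betw (\<lambda>z. x \<otimes> inv z) (carrier G) (carrier G)"
      by (rule bij_betwI[where g = "\<lambda>y. inv y \<otimes> x"])
        (use x in \<open>auto simp: inv_mult_group m_assoc, auto simp: m_assoc[symmetric]\<close>)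
    have "(\<Sum>y\<in>carrier G. a y * b (inv y \<otimes> x)) =
      (\<Sum>z\<in>carrier G. a (x \<otimes> inv z) * b (inv (x \<otimes> inv z) \<otimes> x))"
      by (rule sum.reindex_bij_betw[OF bij, symmetric])
    also have "\<dots> = (\<Sum>y\<in>carrier G. b y * a (inv y \<otimes> x))"
      by (rule sum.cong) (use a x in \<open>auto simp: inv_mult_group m_assoc\<close>)
    finally show ?thesis .
  qed
  then show "central_in (group_algebra G) a"
    using a by (auto simp: central_in_def group_algebra_simps fun_eq_iff)
qed

text \<open>
  Commutativity with a central element turns a left inverse into a two-sided one.
\<close>
lemma (in monoid) central_left_inverse:
  assumes c: "central_in G a" and b: "b \<in> carrier G" and ba: "b \<otimes> a = \<one>"
  shows "a \<in> Units G" "inv a = b" "central_in G b"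
proof -
  have a: "a \<in> carrier G" and comm: "a \<otimes> x = x \<otimes> a" if "x \<in> carrier G" for x
    using c that by (auto simp: central_in_def)
  then have a: "a \<in> carrier G" using b by blast
  have ab: "a \<otimes> b = \<one>" using comm[OF b] ba by simp
  show u: "a \<in> Units G" using a b ab ba by (auto simp: Units_def)
  show "inv a = b" using u a b ba by (metis Units_inv_closed Units_r_inv inv_unique)
  have "b \<otimes> x = x \<otimes> b" if x: "x \<in> carrier G" for x
  proof -
    have "b \<otimes> x = b \<otimes> x \<otimes> (a \<otimes> b)" using x b ab by simp
    also have "\<dots> = b \<otimes> (x \<otimes> a) \<otimes> b" using x a b by (simp add: m_assoc)
    also have "\<dots> = b \<otimes> (a \<otimes> x) \<otimes> b" by (simp only: comm[OF x])
    also have "\<dots> = b \<otimes> a \<otimes> x \<otimes> b" using x a b by (simp add: m_assoc)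
    also have "\<dots> = x \<otimes> b" using x b ba by simp
    finally show ?thesis .
  qed
  then show "central_in G b" using b by (simp add: central_in_def)
qed

section \<open>Permutations and their inverses\<close>

text \<open>
  Choose a base point on every cycle of \<open>\<beta>\<close>. The reflection \<open>\<tau>\<close> of every cycle at its base
  point, \<open>\<beta>\<^sup>k r \<mapsto> \<beta>\<^sup>-\<^sup>k r\<close>, reverses the direction in which \<open>\<beta>\<close> runs through the cycle.
\<close>
lemma permutes_conjugate_to_inverse:
  fixes \<beta> :: "'a \<Rightarrow> 'a"
  assumes \<beta>: "\<beta> permutes A" and fin: "finite A"
  obtains \<tau> :: "'a \<Rightarrow> 'a" where "\<tau> permutes A" "\<tau> \<circ> \<tau> = id" "\<tau> \<circ> \<beta> \<circ> \<tau> = inv' \<beta>"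
proof -
  have perm: "permutation \<beta>" using \<beta> fin by (auto simp: permutation_permutes)
  have bij: "bij \<beta>" using permutation_bijective[OF perm] .
  define r where "r x = (SOME y. y \<in> orbit \<beta> x)" for x
  have r: "r x \<in> orbit \<beta> x" for x
    unfolding r_def by (rule someI[of _ "\<beta> x"]) (rule orbit.base)
  have orb: "orbit \<beta> y = orbit \<beta> x" if "y \<in> orbit \<beta> x" for x y
    by (rule orbit_cyclic_eq3[OF cyclic_on_orbit'[OF perm] that])
  have r_eq: "r y = r x" if "y \<in> orbit \<beta> x" for x y
    unfolding r_def orb[OF that] ..
  have "\<exists>k. (\<beta> ^^ k) (r x) = x" for x
  proof -
    have "x \<in> orbit \<beta> (r x)" using orb[OF r] permutation_self_in_orbit[OF perm, of x] by simp
    then obtain i where "x = (\<beta> ^^ i) (r x)"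
      unfolding orbit_altdef_permutation[OF perm] by auto
    then have "(\<beta> ^^ i) (r x) = x" by (rule sym)
    then show ?thesis ..
  qed
  then obtain k where k: "\<And>x. (\<beta> ^^ k x) (r x) = x" by metis
  \<comment> \<open>\<open>r x\<close> is the base point of the cycle of \<open>x\<close> and \<open>k x\<close> a number of
      steps from it to \<open>x\<close>; by \<open>unique\<close> below, the choice of \<open>k\<close> does not matter\<close>
  define \<tau> where "\<tau> x = (inv' \<beta> ^^ k x) (r x)" for x
  have cancel: "(\<beta> ^^ i) ((inv' \<beta> ^^ i) y) = y" "(inv' \<beta> ^^ i) ((\<beta> ^^ i) y) = y" for i y
    using fn_o_inv_fn_is_id[OF bij, of i] inv_fn_o_fn_is_id[OF bij, of i] by (simp_all add: fun_eq_iff)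
  have commute: "(f ^^ i) ((f ^^ j) y) = (f ^^ j) ((f ^^ i) y)" for f :: "'a \<Rightarrow> 'a" and i j y
    by (metis add.commute comp_apply funpow_add)
  have unique: "(inv' \<beta> ^^ i) y = (inv' \<beta> ^^ j) y" if "(\<beta> ^^ i) y = (\<beta> ^^ j) y" for i j y
  proof -
    have "(inv' \<beta> ^^ i) y = (inv' \<beta> ^^ i) ((inv' \<beta> ^^ j) ((\<beta> ^^ j) y))" by (simp add: cancel)
    also have "\<dots> = (inv' \<beta> ^^ j) ((inv' \<beta> ^^ i) ((\<beta> ^^ i) y))"
      unfolding that by (rule commute)
    finally show ?thesis by (simp add: cancel)
  qed
  have \<tau>I: "\<tau> x = (inv' \<beta> ^^ i) (r x)" if "(\<beta> ^^ i) (r x) = x" for i x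
    unfolding \<tau>_def using unique that k by metis
  have inv_orbit: "inv' \<beta> y \<in> orbit \<beta> x" if "y \<in> orbit \<beta> x" for x y
    using that orbit_inv_eq[OF perm, of x] orbit.step[of y "inv' \<beta>" x] by simp
  have \<tau>_orbit: "\<tau> x \<in> orbit \<beta> x" for x
  proof -
    have "(inv' \<beta> ^^ i) (r x) \<in> orbit \<beta> x" for i
      by (induction i) (auto intro: r inv_orbit)
    then show ?thesis by (simp add: \<tau>_def)
  qed
  have inv: "\<tau> (\<tau> x) = x" for x
  proof -
    let ?l = "k (\<tau> x)"
    have req: "r (\<tau> x) = r x" using r_eq[OF \<tau>_orbit] .
    then have l: "(\<beta> ^^ ?l) (r x) = (inv' \<beta> ^^ k x) (r x)" using k[of "\<tau> x"] by (simp add: \<tau>_def)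
    have "(inv' \<beta> ^^ ?l) (r x) = (inv' \<beta> ^^ ?l) ((\<beta> ^^ k x) ((inv' \<beta> ^^ k x) (r x)))"
      by (simp add: cancel)
    also have "\<dots> = (inv' \<beta> ^^ ?l) ((\<beta> ^^ k x) ((\<beta> ^^ ?l) (r x)))" by (simp add: l)
    also have "\<dots> = (inv' \<beta> ^^ ?l) ((\<beta> ^^ ?l) ((\<beta> ^^ k x) (r x)))"
      by (subst commute) (rule refl)
    also have "\<dots> = x" by (simp add: cancel k)
    finally show ?thesis using req by (simp add: \<tau>_def)
  qed
  have step: "\<tau> (\<beta> x) = inv' \<beta> (\<tau> x)" for x
  proof -
    have "r (\<beta> x) = r x" by (rule r_eq[OF orbit.base])
    moreover have "(\<beta> ^^ Suc (k x)) (r x) = \<beta> x" by (simp add: k)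
    ultimately have "\<tau> (\<beta> x) = (inv' \<beta> ^^ Suc (k x)) (r x)" using \<tau>I[of "Suc (k x)" "\<beta> x"] by simp
    then show ?thesis by (simp add: \<tau>_def)
  qed
  show ?thesis
  proof
    show "\<tau> \<circ> \<tau> = id" using inv by (simp add: fun_eq_iff)
    show "\<tau> \<circ> \<beta> \<circ> \<tau> = inv' \<beta>" using inv step by (simp add: fun_eq_iff)
    have "bij \<tau>" using inv by (metis involuntory_imp_bij)
    moreover have "\<tau> x = x" if "x \<notin> A" for x
    proof -
      have "\<beta> x = x" using \<beta> that by (simp add: permutes_not_in)
      then have "orbit \<beta> x = {x}" by (simp add: orbit_eq_singleton_iff)
      then show ?thesis using \<tau>_orbit[of x] by simp
    qed
    ultimately show "\<tau> permutes A" by (metis permutes_superset bij_imp_permutes Diff_iff UNIV_I)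
  qed
qed

section \<open>Orthogonality and traces\<close>

lemma sum_mult_cnj_eq_0:
  fixes x :: "'i \<Rightarrow> complex"
  assumes "finite I" "(\<Sum>i\<in>I. x i * cnj (x i)) = 0" "i \<in> I"
  shows "x i = 0"
proof -
  have "complex_of_real (\<Sum>i\<in>I. (cmod (x i))\<^sup>2) = 0"
    using assms(2) by (simp only: of_real_sum complex_norm_square)
  then have "(\<Sum>i\<in>I. (cmod (x i))\<^sup>2) = 0" by (simp only: of_real_eq_0_iff)
  then show ?thesis using assms(1,3) by (simp add: sum_nonneg_eq_0_iff)
qed

text \<open>
  Gram-Schmidt: the orthogonal projection onto a span exists. It is stated with coefficients, so that
  it serves both for tensors and for kernels of operators.
\<close>
lemma orthogonal_decomposition:
  fixes t :: "'i \<Rightarrow> complex" and x :: "'s \<Rightarrow> 'i \<Rightarrow> complex"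
  assumes "finite I" "finite S"
  shows "\<exists>c. \<forall>s\<in>S. (\<Sum>i\<in>I. (t i - (\<Sum>r\<in>S. c r * x r i)) * cnj (x s i)) = 0"
  using assms(2)
proof (induction S arbitrary: t)
  case empty
  then show ?case by simp
next
  case (insert a S)
  let ?ip = "\<lambda>u v. \<Sum>i\<in>I. u i * cnj (v i :: complex)"
  obtain d where d: "\<And>s. s \<in> S \<Longrightarrow> ?ip (\<lambda>i. x a i - (\<Sum>r\<in>S. d r * x r i)) (x s) = 0"
    using insert.IH[of "x a"] by blast
  obtain e where e: "\<And>s. s \<in> S \<Longrightarrow> ?ip (\<lambda>i. t i - (\<Sum>r\<in>S. e r * x r i)) (x s) = 0"
    using insert.IH[of t] by blast
  define x0 where "x0 i = x a i - (\<Sum>r\<in>S. d r * x r i)" for i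
  define t0 where "t0 i = t i - (\<Sum>r\<in>S. e r * x r i)" for i
  \<comment> \<open>the coefficient that makes \<open>t0 - l x0\<close> orthogonal to \<open>x0\<close>; if \<open>x0 = 0\<close> its value 0 is harmless\<close>
  define l where "l = ?ip t0 x0 / ?ip x0 x0"
  define c where "c r = (if r = a then l else e r - l * d r)" for r
  have res: "t i - (\<Sum>r\<in>insert a S. c r * x r i) = t0 i - l * x0 i" for i
  proof -
    have "(\<Sum>r\<in>S. c r * x r i) = (\<Sum>r\<in>S. e r * x r i) - l * (\<Sum>r\<in>S. d r * x r i)"
      unfolding sum_distrib_left sum_subtractf[symmetric]
      by (rule sum.cong) (use insert.hyps in \<open>auto simp: c_def algebra_simps\<close>)
    then show ?thesis using insert.hyps by (simp add: c_def x0_def t0_def algebra_simps)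
  qed
  have lin: "?ip (\<lambda>i. t0 i - l * x0 i) v = ?ip t0 v - l * ?ip x0 v" for v
    by (simp add: sum_subtractf sum_distrib_left algebra_simps)
  have S: "?ip (\<lambda>i. t0 i - l * x0 i) (x s) = 0" if "s \<in> S" for s
    unfolding lin using d[OF that] e[OF that] by (simp add: x0_def t0_def)
  have "?ip u (x a) = ?ip u x0 + (\<Sum>r\<in>S. cnj (d r) * ?ip u (x r))" for u
  proof -
    have "?ip u (x a) = (\<Sum>i\<in>I. u i * cnj (x0 i) + (\<Sum>r\<in>S. cnj (d r) * (u i * cnj (x r i))))"
      by (rule sum.cong) (simp_all add: x0_def sum_distrib_left algebra_simps)
    also have "\<dots> = ?ip u x0 + (\<Sum>i\<in>I. \<Sum>r\<in>S. cnj (d r) * (u i * cnj (x r i)))"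
      by (simp add: sum.distrib)
    also have "(\<Sum>i\<in>I. \<Sum>r\<in>S. cnj (d r) * (u i * cnj (x r i))) = (\<Sum>r\<in>S. cnj (d r) * ?ip u (x r))"
      by (subst sum.swap) (simp add: sum_distrib_left)
    finally show ?thesis .
  qed
  then have "?ip (\<lambda>i. t0 i - l * x0 i) (x a) =
      ?ip (\<lambda>i. t0 i - l * x0 i) x0 + (\<Sum>r\<in>S. cnj (d r) * ?ip (\<lambda>i. t0 i - l * x0 i) (x r))" .
  also have "\<dots> = ?ip t0 x0 - l * ?ip x0 x0" using S lin by simp
  also have "\<dots> = 0"
  proof (cases "?ip x0 x0 = 0")
    case True
    then have "\<forall>i\<in>I. x0 i = 0" using sum_mult_cnj_eq_0[OF assms(1)] by blast
    then show ?thesis by simp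
  qed (simp add: l_def)
  finally have "?ip (\<lambda>i. t0 i - l * x0 i) (x a) = 0" .
  with S have "\<forall>s\<in>insert a S. ?ip (\<lambda>i. t i - (\<Sum>r\<in>insert a S. c r * x r i)) (x s) = 0"
    unfolding res by blast
  then show ?case by blast
qed

text \<open>
  For a family in which \<open>x e\<close> is independent of the others, the component of \<open>x e\<close> orthogonal to the
  other members is a nonzero combination of the family; rescaled, it is the vector dual to \<open>x e\<close>. The
  coefficients \<open>w\<close> solve a linear system with the Gram matrix of the family.
\<close>
lemma dual_vector:
  fixes x :: "'s \<Rightarrow> 'i \<Rightarrow> complex"
  assumes finI: "finite I" and finS: "finite S" and e: "e \<in> S"
    and indep: "\<And>c. \<forall>i\<in>I. (\<Sum>s\<in>S. c s * x s i) = 0 \<Longrightarrow> c e = 0"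
  obtains w where "\<And>s. s \<in> S \<Longrightarrow>
    (\<Sum>i\<in>I. (\<Sum>r\<in>S. w r * x r i) * cnj (x s i)) = (if s = e then 1 else 0)"
proof -
  obtain c where c: "\<And>s. s \<in> S - {e} \<Longrightarrow>
      (\<Sum>i\<in>I. (x e i - (\<Sum>r\<in>S - {e}. c r * x r i)) * cnj (x s i)) = 0"
    using orthogonal_decomposition[OF finI finite_Diff[OF finS, of "{e}"], of "x e" x] by blast
  define y where "y i = x e i - (\<Sum>r\<in>S - {e}. c r * x r i)" for i
  define d where "d r = (if r = e then 1 else - c r)" for r
  have y: "y i = (\<Sum>r\<in>S. d r * x r i)" for i
    unfolding sum.remove[OF finS e] by (simp add: y_def d_def sum_negf)
  define z where "z = (\<Sum>i\<in>I. y i * cnj (x e i))"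
  have "(\<Sum>i\<in>I. y i * cnj (y i)) = z - (\<Sum>i\<in>I. \<Sum>r\<in>S - {e}. cnj (c r) * (y i * cnj (x r i)))"
  proof -
    have "u * cnj (y i) = u * cnj (x e i) - (\<Sum>r\<in>S - {e}. cnj (c r) * (u * cnj (x r i)))" for u i
      by (simp add: y_def sum_distrib_left algebra_simps)
    then show ?thesis unfolding z_def by (simp only: sum_subtractf)
  qed
  also have "(\<Sum>i\<in>I. \<Sum>r\<in>S - {e}. cnj (c r) * (y i * cnj (x r i))) =
      (\<Sum>r\<in>S - {e}. cnj (c r) * (\<Sum>i\<in>I. y i * cnj (x r i)))"
    by (subst sum.swap) (simp add: sum_distrib_left)
  also have "\<dots> = 0" using c by (simp add: y_def)
  finally have yy: "(\<Sum>i\<in>I. y i * cnj (y i)) = z" by simp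
  have "z \<noteq> 0"
  proof
    assume "z = 0"
    then have "\<forall>i\<in>I. (\<Sum>r\<in>S. d r * x r i) = 0"
      using yy sum_mult_cnj_eq_0[OF finI, of y] y by auto
    from indep[OF this] show False by (simp add: d_def)
  qed
  show ?thesis
  proof
    fix s assume s: "s \<in> S"
    have "(\<Sum>i\<in>I. (\<Sum>r\<in>S. d r / z * x r i) * cnj (x s i)) = (\<Sum>i\<in>I. y i * cnj (x s i)) / z"
      by (simp add: y sum_divide_distrib sum_distrib_right)
    also have "\<dots> = (if s = e then 1 else 0)"
      using s c[of s] \<open>z \<noteq> 0\<close> by (cases "s = e") (simp_all add: z_def[symmetric] flip: y_def)
    finally show "(\<Sum>i\<in>I. (\<Sum>r\<in>S. d r / z * x r i) * cnj (x s i)) = (if s = e then 1 else 0)" .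
  qed
qed

lemma sum_fun_apply: "(\<Sum>i\<in>I. F i) x = (\<Sum>i\<in>I. F i x)"
  by (induction I rule: infinite_finite_induct) auto

text \<open>
  A kernel \<open>K\<close> whose columns lie in \<open>W\<close> is an operator on all tensors with image in \<open>W\<close>; its trace
  can be computed in the standard basis or in any basis of \<open>W\<close>.
\<close>
lemma trace_on_eq_sum_diagonal:
  assumes fin: "finite I" and W: "tensor.subspace W"
    and supp: "\<And>t f. t \<in> W \<Longrightarrow> f \<notin> I \<Longrightarrow> t f = 0"
    and col: "\<And>f. f \<in> I \<Longrightarrow> (\<lambda>g. K g f) \<in> W"
    and A: "\<And>t g. t \<in> W \<Longrightarrow> A t g = (\<Sum>f\<in>I. K g f * t f)"
  shows "trace_on W A = (\<Sum>f\<in>I. K f f)"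
proof -
  define B where "B = (SOME B. tensor.independent B \<and> tensor.span B = W)"
  have "\<exists>B. tensor.independent B \<and> tensor.span B = W"
    by (meson W subset_antisym tensor.maximal_independent_subset tensor.span_minimal)
  then have B: "tensor.independent B" "tensor.span B = W"
    unfolding B_def by (metis (mono_tags, lifting) someI_ex)+
  define \<delta> :: "multi_index \<Rightarrow> tensor" where "\<delta> f = (\<lambda>g. if g = f then 1 else 0)" for f
  have "B \<subseteq> tensor.span (\<delta> ` I)"
  proof
    fix b assume "b \<in> B"
    then have "b \<in> W" using B tensor.span_base by blast
    have "b = (\<Sum>f\<in>I. tensor_scale (b f) (\<delta> f))"
    proof
      fix g
      have "(\<Sum>f\<in>I. tensor_scale (b f) (\<delta> f)) g = (\<Sum>f\<in>I. if f = g then b f else 0)"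
        unfolding sum_fun_apply by (rule sum.cong) (auto simp: tensor_scale_def \<delta>_def)
      then show "b g = (\<Sum>f\<in>I. tensor_scale (b f) (\<delta> f)) g"
        using supp[OF \<open>b \<in> W\<close>] fin by (simp add: sum.delta)
    qed
    also have "\<dots> \<in> tensor.span (\<delta> ` I)"
      by (intro tensor.span_sum tensor.span_scale tensor.span_base) auto
    finally show "b \<in> tensor.span (\<delta> ` I)" .
  qed
  then have finB: "finite B" using tensor.independent_span_bound[OF _ B(1)] fin by blast
  have AB: "tensor.representation B (A b) b = (\<Sum>f\<in>I. b f * tensor.representation B (\<lambda>g. K g f) b)"
    if b: "b \<in> B" for b
  proof -
    have "b \<in> W" using B b tensor.span_base by blast
    then have "A b = (\<Sum>f\<in>I. tensor_scale (b f) (\<lambda>g. K g f))"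
      by (auto simp: fun_eq_iff sum_fun_apply tensor_scale_def A mult.commute)
    then show ?thesis
      using col B by (simp add: tensor.representation_sum tensor.representation_scale
        tensor.subspace_scale[OF W])
  qed
  have "trace_on W A = (\<Sum>b\<in>B. \<Sum>f\<in>I. b f * tensor.representation B (\<lambda>g. K g f) b)"
    unfolding trace_on_def Let_def B_def[symmetric] by (rule sum.cong) (simp_all add: AB)
  also have "\<dots> = (\<Sum>f\<in>I. \<Sum>b\<in>B. b f * tensor.representation B (\<lambda>g. K g f) b)"
    by (rule sum.swap)
  also have "\<dots> = (\<Sum>f\<in>I. K f f)"
  proof (rule sum.cong[OF refl])
    fix f assume f: "f \<in> I"
    have "(\<Sum>b\<in>B. tensor_scale (tensor.representation B (\<lambda>g. K g f) b) b) = (\<lambda>g. K g f)"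
      by (rule tensor.sum_representation_eq) (use B col f finB in auto)
    from fun_cong[OF this, of f] show "(\<Sum>b\<in>B. b f * tensor.representation B (\<lambda>g. K g f) b) = K f f"
      by (simp add: sum_fun_apply tensor_scale_def mult.commute)
  qed
  finally show ?thesis .
qed

section \<open>Diagrams as partially transposed permutations\<close>

text \<open>
  The labels that a matrix entry \<open>(g, f)\<close> puts on the points \<open>1, \<dots>, n+m\<close> of the top row once the rows
  have been exchanged at the negative positions. With \<open>g\<close> and \<open>f\<close> interchanged it gives the labels of
  the bottom row.
\<close>
definition mixed_labels :: "nat \<Rightarrow> multi_index \<Rightarrow> multi_index \<Rightarrow> nat \<Rightarrow> nat" where
  "mixed_labels n g f a = (if a \<le> n then g else f) (point_position n a)"

text \<open>
  The matrix of the diagram \<open>\<theta>\<^sup>-\<^sup>1(\<sigma>)\<close>: after the exchange of rows, a string runs from the bottom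
  point \<open>a\<close> to the top point \<open>\<sigma> a\<close>.
\<close>
definition string_kernel :: "nat \<Rightarrow> nat \<Rightarrow> (nat \<Rightarrow> nat) \<Rightarrow> multi_index \<Rightarrow> multi_index \<Rightarrow> complex" where
  "string_kernel n m \<sigma> g f =
     of_bool (\<forall>a\<in>{1..n+m}. mixed_labels n f g a = mixed_labels n g f (\<sigma> a))"

lemma point_position_bij: "bij_betw (point_position n) {1..n+m} (positions n m)"
proof (rule bij_betwI[where g = "\<lambda>p. if p > 0 then nat p else n + nat (- p)"])
qed (auto simp: point_position_def positions_def)

lemma finite_multi_indices: "finite (multi_indices N n m)"
  by (auto simp: multi_indices_def positions_def intro!: finite_PiE)

lemma permutes_le: "\<sigma> permutes {1..k} \<Longrightarrow> 1 \<le> a \<Longrightarrow> a \<le> k \<Longrightarrow> 1 \<le> \<sigma> a \<and> \<sigma> a \<le> k" for \<sigma> :: "nat \<Rightarrow> nat"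
  using permutes_in_image[of \<sigma> "{1..k}" a] by auto

lemma string_kernel_inv:
  assumes \<sigma>: "\<sigma> permutes {1..n+m}"
  shows "string_kernel n m (inv' \<sigma>) g f = string_kernel n m \<sigma> f g"
proof -
  have "(\<forall>a\<in>{1..n+m}. mixed_labels n f g a = mixed_labels n g f (inv' \<sigma> a)) \<longleftrightarrow>
    (\<forall>a\<in>\<sigma> ` {1..n+m}. mixed_labels n f g a = mixed_labels n g f (inv' \<sigma> a))"
    using permutes_image[OF \<sigma>] by simp
  also have "\<dots> \<longleftrightarrow> (\<forall>a\<in>{1..n+m}. mixed_labels n g f a = mixed_labels n f g (\<sigma> a))"
    by (simp add: permutes_inverses(2)[OF \<sigma>]) metis
  finally show ?thesis by (simp add: string_kernel_def)
qed

text \<open>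
  The inverse of the exchange of rows: \<open>F\<close> labels the points of the row from which the positive
  positions are read, \<open>G\<close> the other row.
\<close>
definition unmix :: "nat \<Rightarrow> nat \<Rightarrow> (nat \<Rightarrow> nat) \<Rightarrow> (nat \<Rightarrow> nat) \<Rightarrow> multi_index" where
  "unmix n m F G p = (if p \<in> positions n m then if p > 0 then F (nat p) else G (n + nat (- p)) else undefined)"

lemma mixed_labels_unmix:
  assumes "a \<in> {1..n+m}"
  shows "mixed_labels n (unmix n m F G) (unmix n m G F) a = F a"
proof (cases "a \<le> n")
  case False
  then have "n + nat (int a - int n) = a" by linarith
  with False show ?thesis
    using assms by (auto simp: mixed_labels_def unmix_def point_position_def positions_def)
qed (use assms in \<open>auto simp: mixed_labels_def unmix_def point_position_def positions_def\<close>)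

lemma unmix_mixed_labels:
  assumes "g \<in> multi_indices N n m"
  shows "unmix n m (mixed_labels n g f) (mixed_labels n f g) = g"
proof
  fix p
  show "unmix n m (mixed_labels n g f) (mixed_labels n f g) p = g p"
  proof (cases "p \<in> positions n m")
    case True
    then show ?thesis by (auto simp: mixed_labels_def unmix_def point_position_def positions_def)
  next
    case False
    then show ?thesis using assms by (auto simp: unmix_def multi_indices_def PiE_def extensional_def)
  qed
qed

lemma unmix_in_multi_indices:
  assumes "F \<in> {1..n+m} \<rightarrow> {..<N}" "G \<in> {1..n+m} \<rightarrow> {..<N}"
  shows "unmix n m F G \<in> multi_indices N n m"
  unfolding multi_indices_def
proof (rule PiE_I)
  fix p assume p: "p \<in> positions n m"
  then have "p > 0 \<Longrightarrow> nat p \<in> {1..n+m}" "\<not> p > 0 \<Longrightarrow> n + nat (- p) \<in> {1..n+m}"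
    by (auto simp: positions_def)
  then show "unmix n m F G p \<in> {..<N}" using assms p by (auto simp: unmix_def Pi_def)
qed (simp add: unmix_def)

lemma mixed_labels_less:
  assumes "g \<in> multi_indices N n m" "f \<in> multi_indices N n m" "a \<in> {1..n+m}"
  shows "mixed_labels n g f a < N"
proof -
  have "point_position n a \<in> positions n m"
    using assms(3) point_position_bij by (metis bij_betwE)
  then show ?thesis using assms(1,2) by (auto simp: mixed_labels_def multi_indices_def)
qed

lemma string_kernel_unmix:
  assumes "\<sigma> permutes {1..n+m}"
  shows "string_kernel n m \<sigma> (unmix n m G F) (unmix n m F G) =
    of_bool (\<forall>a\<in>{1..n+m}. F a = G (\<sigma> a))"
  using permutes_le[OF assms] by (auto simp: string_kernel_def mixed_labels_unmix)

lemma permutes_orbit_invariant: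
  assumes "\<mu> permutes A" and inv: "\<And>a. a \<in> A \<Longrightarrow> F (\<mu> a) = F a" and "a \<in> A" "b \<in> orbit \<mu> a"
  shows "F b = F a"
proof -
  have "b \<in> A \<and> F b = F a" using assms(4)
  proof induction
    case base
    then show ?case using assms by (simp add: permutes_in_image)
  next
    case (step y)
    then show ?case using assms by (simp add: permutes_in_image)
  qed
  then show ?thesis ..
qed

text \<open>
  An invariant labelling is a free choice of one label for every cycle. This is the trace of a
  permutation of tensor factors.
\<close>
lemma card_invariant_labels:
  assumes \<mu>: "\<mu> permutes A" and fin: "finite A"
  shows "card {F \<in> A \<rightarrow>\<^sub>E {..<N}. \<forall>a\<in>A. F (\<mu> a) = F a} = N ^ card (orbit \<mu> ` A)"
proof -
  have perm: "permutation \<mu>" using \<mu> fin by (auto simp: permutation_permutes)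
  let ?O = "orbit \<mu> ` A"
  define r where "r C = (SOME a. a \<in> A \<and> orbit \<mu> a = C)" for C
  have r: "r C \<in> A \<and> orbit \<mu> (r C) = C" if "C \<in> ?O" for C
    unfolding r_def by (rule someI_ex) (use that in auto)
  have "bij_betw (\<lambda>h. \<lambda>a\<in>A. h (orbit \<mu> a)) (?O \<rightarrow>\<^sub>E {..<N})
      {F \<in> A \<rightarrow>\<^sub>E {..<N}. \<forall>a\<in>A. F (\<mu> a) = F a}"
  proof (rule bij_betwI[where g = "\<lambda>F. \<lambda>C\<in>?O. F (r C)"])
    show "(\<lambda>h. \<lambda>a\<in>A. h (orbit \<mu> a)) \<in> (?O \<rightarrow>\<^sub>E {..<N}) \<rightarrow>
        {F \<in> A \<rightarrow>\<^sub>E {..<N}. \<forall>a\<in>A. F (\<mu> a) = F a}"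
      using permutes_in_image[OF \<mu>] permutation_orbit_step[OF perm] by (auto simp: PiE_iff)
    show "(\<lambda>F. \<lambda>C\<in>?O. F (r C)) \<in> {F \<in> A \<rightarrow>\<^sub>E {..<N}. \<forall>a\<in>A. F (\<mu> a) = F a} \<rightarrow> (?O \<rightarrow>\<^sub>E {..<N})"
      using r by (auto simp: PiE_iff)
    show "(\<lambda>C\<in>?O. (\<lambda>a\<in>A. h (orbit \<mu> a)) (r C)) = h" if "h \<in> ?O \<rightarrow>\<^sub>E {..<N}" for h
      using that r by (auto simp: PiE_iff extensional_def fun_eq_iff)
    fix F assume F: "F \<in> {F \<in> A \<rightarrow>\<^sub>E {..<N}. \<forall>a\<in>A. F (\<mu> a) = F a}"
    have "F (r (orbit \<mu> a)) = F a" if a: "a \<in> A" for a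
    proof -
      have "a \<in> orbit \<mu> (r (orbit \<mu> a))"
        using r[of "orbit \<mu> a"] a permutation_self_in_orbit[OF perm, of a] by auto
      then have "F a = F (r (orbit \<mu> a))"
        using permutes_orbit_invariant[OF \<mu>, of F "r (orbit \<mu> a)" a] r[of "orbit \<mu> a"] a F by blast
      then show ?thesis ..
    qed
    then show "(\<lambda>a\<in>A. (\<lambda>C\<in>?O. F (r C)) (orbit \<mu> a)) = F"
      using F by (auto simp: PiE_iff extensional_def fun_eq_iff)
  qed
  then have "card {F \<in> A \<rightarrow>\<^sub>E {..<N}. \<forall>a\<in>A. F (\<mu> a) = F a} = card (?O \<rightarrow>\<^sub>E {..<N})"
    by (rule bij_betw_same_card[symmetric])
  also have "\<dots> = N ^ card ?O" using fin by (simp add: card_PiE)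
  finally show ?thesis .
qed

text \<open>
  The Hilbert-Schmidt pairing is a sum over all matrix entries, which the exchange of rows only
  rearranges. Both kernels equal 1 exactly if \<open>G \<circ> \<sigma> = F = G \<circ> \<tau>\<close> for the top labels \<open>G\<close> and the
  bottom labels \<open>F\<close>, so the pairing counts the labellings \<open>F\<close> that are invariant under
  \<open>\<sigma>\<^sup>-\<^sup>1 \<circ> \<tau>\<close>. Hence \<open>\<Omega>\<close> is the Gram matrix of the diagrams.
\<close>
lemma sum_string_kernel_mult:
  assumes \<sigma>: "\<sigma> permutes {1..n+m}" and \<tau>: "\<tau> permutes {1..n+m}"
  shows "(\<Sum>(g, f)\<in>multi_indices N n m \<times> multi_indices N n m.
      string_kernel n m \<sigma> g f * string_kernel n m \<tau> g f) = Omega N (n + m) (inv' \<sigma> \<circ> \<tau>)"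
proof -
  let ?I = "multi_indices N n m" and ?K = "{1..n+m}"
  let ?\<mu> = "inv' \<sigma> \<circ> \<tau>"
  have \<mu>: "?\<mu> permutes ?K" using permutes_compose[OF \<tau> permutes_inv[OF \<sigma>]] .
  let ?X = "{(g, f) \<in> ?I \<times> ?I. string_kernel n m \<sigma> g f = 1 \<and> string_kernel n m \<tau> g f = 1}"
  let ?Y = "{F \<in> ?K \<rightarrow>\<^sub>E {..<N}. \<forall>a\<in>?K. F (?\<mu> a) = F a}"
  have "(\<Sum>(g, f)\<in>?I \<times> ?I. string_kernel n m \<sigma> g f * string_kernel n m \<tau> g f) =
      (\<Sum>x\<in>?I \<times> ?I. of_bool (x \<in> ?X))"
    by (rule sum.cong) (auto simp: string_kernel_def)
  also have "\<dots> = of_nat (card ?X)"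
    using finite_multi_indices[of N n m] by (simp add: Int_def sum_of_bool_eq) (auto intro: arg_cong[of _ _ card])
  also have "bij_betw (\<lambda>F. (unmix n m (F \<circ> inv' \<sigma>) F, unmix n m F (F \<circ> inv' \<sigma>))) ?Y ?X"
  proof (rule bij_betwI[where g = "\<lambda>(g, f). \<lambda>a\<in>?K. mixed_labels n f g a"])
    have "(unmix n m (F \<circ> inv' \<sigma>) F, unmix n m F (F \<circ> inv' \<sigma>)) \<in> ?X" if F: "F \<in> ?Y" for F
    proof -
      have FG: "F \<in> ?K \<rightarrow> {..<N}" "F \<circ> inv' \<sigma> \<in> ?K \<rightarrow> {..<N}"
        using F permutes_le[OF permutes_inv[OF \<sigma>]] by (auto simp: PiE_iff Pi_iff)
      have "unmix n m (F \<circ> inv' \<sigma>) F \<in> ?I" "unmix n m F (F \<circ> inv' \<sigma>) \<in> ?I"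
        by (rule unmix_in_multi_indices[OF FG(2,1)], rule unmix_in_multi_indices[OF FG])
      then show ?thesis
        using F \<sigma> \<tau> by (simp add: string_kernel_unmix permutes_inverses)
    qed
    then show "(\<lambda>F. (unmix n m (F \<circ> inv' \<sigma>) F, unmix n m F (F \<circ> inv' \<sigma>))) \<in> ?Y \<rightarrow> ?X" by blast
    have gf: "(\<lambda>a\<in>?K. mixed_labels n f g a) \<in> ?Y \<and>
        unmix n m ((\<lambda>a\<in>?K. mixed_labels n f g a) \<circ> inv' \<sigma>) (\<lambda>a\<in>?K. mixed_labels n f g a) = g \<and>
        unmix n m (\<lambda>a\<in>?K. mixed_labels n f g a) ((\<lambda>a\<in>?K. mixed_labels n f g a) \<circ> inv' \<sigma>) = f"
      if gf: "(g, f) \<in> ?X" for g f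
    proof -
      have I: "g \<in> ?I" "f \<in> ?I" using gf by auto
      have s: "mixed_labels n f g a = mixed_labels n g f (\<sigma> a)"
        and t: "mixed_labels n f g a = mixed_labels n g f (\<tau> a)" if "a \<in> ?K" for a
        using gf that by (auto simp: string_kernel_def)
      have s': "mixed_labels n f g (inv' \<sigma> a) = mixed_labels n g f a" if "a \<in> ?K" for a
        using s[of "inv' \<sigma> a"] permutes_le[OF permutes_inv[OF \<sigma>], of a] that permutes_inverses[OF \<sigma>] by auto
      have "mixed_labels n f g (inv' \<sigma> (\<tau> a)) = mixed_labels n f g a" if "a \<in> ?K" for a
        using s'[of "\<tau> a"] t[OF that] permutes_le[OF \<tau>, of a] that by auto
      then have 1: "(\<lambda>a\<in>?K. mixed_labels n f g a) \<in> ?Y"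
        using mixed_labels_less[OF I(2,1)] permutes_le[OF \<mu>] by (auto simp: PiE_iff)
      have cong: "unmix n m F G = unmix n m F' G'"
        if "\<And>a. a \<in> ?K \<Longrightarrow> F a = F' a" "\<And>a. a \<in> ?K \<Longrightarrow> G a = G' a" for F G F' G' :: "nat \<Rightarrow> nat"
      proof
        fix p
        have "p \<in> positions n m \<Longrightarrow> p > 0 \<Longrightarrow> nat p \<in> ?K"
          "p \<in> positions n m \<Longrightarrow> \<not> p > 0 \<Longrightarrow> n + nat (- p) \<in> ?K"
          by (auto simp: positions_def)
        then show "unmix n m F G p = unmix n m F' G' p" using that by (simp add: unmix_def)
      qed
      have G: "((\<lambda>a\<in>?K. mixed_labels n f g a) \<circ> inv' \<sigma>) a = mixed_labels n g f a" if "a \<in> ?K" for a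
        using s'[OF that] permutes_le[OF permutes_inv[OF \<sigma>], of a] that by auto
      have "unmix n m ((\<lambda>a\<in>?K. mixed_labels n f g a) \<circ> inv' \<sigma>) (\<lambda>a\<in>?K. mixed_labels n f g a) =
          unmix n m (mixed_labels n g f) (mixed_labels n f g)"
        by (rule cong) (simp_all only: G restrict_apply if_True)
      moreover have "unmix n m (\<lambda>a\<in>?K. mixed_labels n f g a) ((\<lambda>a\<in>?K. mixed_labels n f g a) \<circ> inv' \<sigma>) =
          unmix n m (mixed_labels n f g) (mixed_labels n g f)"
        by (rule cong) (simp_all only: G restrict_apply if_True)
      ultimately show ?thesis using 1 unmix_mixed_labels I by simp
    qed
    show "(\<lambda>(g, f). \<lambda>a\<in>?K. mixed_labels n f g a) \<in> ?X \<rightarrow> ?Y"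
    proof (rule funcsetI)
      fix y assume y: "y \<in> ?X"
      obtain g f where gf': "y = (g, f)" by (cases y)
      show "(\<lambda>(g, f). \<lambda>a\<in>?K. mixed_labels n f g a) y \<in> ?Y"
        using gf[OF y[unfolded gf'], THEN conjunct1] by (simp only: gf' prod.case)
    qed
    show "(\<lambda>(g, f). \<lambda>a\<in>?K. mixed_labels n f g a) (unmix n m (F \<circ> inv' \<sigma>) F, unmix n m F (F \<circ> inv' \<sigma>)) = F"
      if "F \<in> ?Y" for F
      using that by (auto simp: mixed_labels_unmix fun_eq_iff PiE_iff extensional_def)
    show "(\<lambda>F. (unmix n m (F \<circ> inv' \<sigma>) F, unmix n m F (F \<circ> inv' \<sigma>)))
        ((\<lambda>(g, f). \<lambda>a\<in>?K. mixed_labels n f g a) y) = y" if "y \<in> ?X" for y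
    proof -
      obtain g f where y: "y = (g, f)" by (cases y)
      note gf = gf[OF that[unfolded y]]
      show ?thesis
        by (simp only: y prod.case gf[THEN conjunct2, THEN conjunct1] gf[THEN conjunct2, THEN conjunct2])
    qed
  qed
  then have "card ?X = N ^ num_cycles (n + m) ?\<mu>"
    using card_invariant_labels[OF \<mu>, of N] by (simp add: bij_betw_same_card num_cycles_def)
  finally show ?thesis using \<mu> by (simp add: Omega_def sym_group_carrier)
qed

text \<open>
  With at least \<open>n + m\<close> labels all points of the bottom row can be labelled differently; the labels
  of the top row then single out one permutation.
\<close>
lemma string_kernel_independent:
  assumes N: "N \<ge> n + m" and \<sigma>: "\<sigma> permutes {1..n+m}"
    and zero: "\<And>g f. g \<in> multi_indices N n m \<Longrightarrow> f \<in> multi_indices N n m \<Longrightarrow>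
      (\<Sum>\<tau> | \<tau> permutes {1..n+m}. c \<tau> * string_kernel n m \<tau> g f) = 0"
  shows "c \<sigma> = 0"
proof -
  \<comment> \<open>points are numbered from 1, labels from 0\<close>
  define F :: "nat \<Rightarrow> nat" where "F a = a - 1" for a
  define G where "G = F \<circ> inv' \<sigma>"
  have inj: "a = b" if "F a = F b" "1 \<le> a" "1 \<le> b" for a b using that by (simp add: F_def)
  have FG: "F \<in> {1..n+m} \<rightarrow> {..<N}" "G \<in> {1..n+m} \<rightarrow> {..<N}"
    using N permutes_le[OF permutes_inv[OF \<sigma>]] by (fastforce simp: F_def G_def)+
  have *: "string_kernel n m \<tau> (unmix n m G F) (unmix n m F G) = of_bool (\<tau> = \<sigma>)"
    if \<tau>: "\<tau> permutes {1..n+m}" for \<tau>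
  proof -
    have "(\<forall>a\<in>{1..n+m}. F a = G (\<tau> a)) \<longleftrightarrow> \<tau> = \<sigma>"
    proof
      assume "\<tau> = \<sigma>" then show "\<forall>a\<in>{1..n+m}. F a = G (\<tau> a)"
        by (simp add: G_def permutes_inverses[OF \<sigma>])
    next
      assume *: "\<forall>a\<in>{1..n+m}. F a = G (\<tau> a)"
      have "\<tau> a = \<sigma> a" for a
      proof (cases "a \<in> {1..n+m}")
        case True
        then have "a = inv' \<sigma> (\<tau> a)"
          using * permutes_le[OF \<tau>, of a] permutes_le[OF permutes_inv[OF \<sigma>], of "\<tau> a"]
          by (auto simp: G_def intro: inj)
        then show ?thesis using permutes_inverses(1)[OF \<sigma>, of "\<tau> a"] by simp
      next
        case False
        then show ?thesis using \<sigma> \<tau> by (simp add: permutes_not_in)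
      qed
      then show "\<tau> = \<sigma>" by blast
    qed
    then show ?thesis by (simp add: string_kernel_unmix[OF \<tau>])
  qed
  have "(\<Sum>\<tau> | \<tau> permutes {1..n+m}. c \<tau> * string_kernel n m \<tau> (unmix n m G F) (unmix n m F G)) =
      (\<Sum>\<tau> | \<tau> permutes {1..n+m}. if \<tau> = \<sigma> then c \<tau> else 0)"
    by (rule sum.cong) (simp_all add: *)
  then show ?thesis
    using zero[OF unmix_in_multi_indices[OF FG(2,1)] unmix_in_multi_indices[OF FG]] \<sigma>
    by (simp add: sum.delta finite_permutations)
qed

text \<open>
  Contracting the top point \<open>i\<close> with the bottom point \<open>c\<close> and re-inserting the pair. If these two
  points are joined, the contraction closes a loop and contributes \<open>N\<close>. Otherwise the strings that
  end there are fused into one, and the re-inserted pair is a new string from \<open>c\<close> to \<open>i\<close>. Both cases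
  result in \<open>\<sigma> \<circ> (c \<sigma>\<^sup>-\<^sup>1(i))\<close>, since the transposition is trivial in the first one.
\<close>
lemma contract_labels:
  fixes T B :: "nat \<Rightarrow> nat" and \<sigma> :: "nat \<Rightarrow> nat"
  assumes \<sigma>: "\<sigma> permutes K" and "i \<in> K" "c \<in> K" and less: "\<And>a. a \<in> K \<Longrightarrow> T a < N"
  shows "(if T i = B c
      then \<Sum>k<N. of_bool (\<forall>a\<in>K. (B(c := k)) a = (T(i := k)) (\<sigma> a)) else 0 :: complex) =
    (if \<sigma> c = i then of_nat N else 1) * of_bool (\<forall>a\<in>K. B a = T ((\<sigma> \<circ> transpose c (inv' \<sigma> i)) a))"
proof (cases "\<sigma> c = i")
  case True
  then have "inv' \<sigma> i = c" using permutes_inverses(2)[OF \<sigma>, of c] by simp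
  have "\<sigma> a = i \<longleftrightarrow> a = c" for a using permutes_inj[OF \<sigma>] True by (auto simp: inj_def)
  then have "(\<forall>a\<in>K. (B(c := k)) a = (T(i := k)) (\<sigma> a)) \<longleftrightarrow> (\<forall>a\<in>K - {c}. B a = T (\<sigma> a))" for k
    by auto
  moreover have "(\<forall>a\<in>K. B a = T (\<sigma> a)) \<longleftrightarrow> T i = B c \<and> (\<forall>a\<in>K - {c}. B a = T (\<sigma> a))"
    using True \<open>c \<in> K\<close> by auto
  ultimately show ?thesis using True \<open>inv' \<sigma> i = c\<close> by simp
next
  case False
  define b where "b = inv' \<sigma> i"
  have b: "\<sigma> b = i" using permutes_inverses(1)[OF \<sigma>] by (simp add: b_def)
  have bK: "b \<in> K" using \<open>i \<in> K\<close> permutes_in_image[OF permutes_inv[OF \<sigma>]] by (simp add: b_def)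
  have "b \<noteq> c" using False b by auto
  have \<sigma>i: "\<sigma> a = i \<longleftrightarrow> a = b" for a using permutes_inj[OF \<sigma>] b by (auto simp: inj_def)
  let ?R = "\<forall>a\<in>K - {b, c}. B a = T (\<sigma> a)"
  have 1: "(\<forall>a\<in>K. (B(c := k)) a = (T(i := k)) (\<sigma> a)) \<longleftrightarrow> k = T (\<sigma> c) \<and> B b = T (\<sigma> c) \<and> ?R" for k
    using \<open>c \<in> K\<close> bK \<open>b \<noteq> c\<close> False by (auto simp: \<sigma>i)
  have 2: "(\<forall>a\<in>K. B a = T ((\<sigma> \<circ> transpose c (inv' \<sigma> i)) a)) \<longleftrightarrow> T i = B c \<and> B b = T (\<sigma> c) \<and> ?R"
    using \<open>c \<in> K\<close> bK \<open>b \<noteq> c\<close> b unfolding b_def[symmetric] by (auto simp: transpose_def)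
  have "T (\<sigma> c) < N" using less \<open>c \<in> K\<close> permutes_in_image[OF \<sigma>] by simp
  then have "(\<Sum>k<N. of_bool (k = T (\<sigma> c) \<and> B b = T (\<sigma> c) \<and> ?R)) = (of_bool (B b = T (\<sigma> c) \<and> ?R) :: complex)"
    by (simp add: of_bool_conj if_distrib sum.delta flip: sum_distrib_right)
  then show ?thesis using False unfolding 1 2 by simp
qed

text \<open>
  After the exchange of rows, the positions \<open>i\<close> and \<open>-j\<close> of the top row are the top point \<open>i\<close> and
  the bottom point \<open>n + j\<close>.
\<close>
lemma string_kernel_contract:
  assumes \<sigma>: "\<sigma> permutes {1..n+m}" and i: "i \<in> {1..n}" and j: "j \<in> {1..m}"
    and g: "g \<in> multi_indices N n m" and f: "f \<in> multi_indices N n m"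
  shows "(if g (int i) = g (- int j)
      then \<Sum>k<N. string_kernel n m \<sigma> (g(int i := k, - int j := k)) f else 0) =
    (if \<sigma> (n + j) = i then of_nat N else 1) *
      string_kernel n m (\<sigma> \<circ> transpose (n + j) (inv' \<sigma> i)) g f"
proof -
  let ?T = "mixed_labels n g f" and ?B = "mixed_labels n f g"
  have T: "mixed_labels n (g(int i := k, - int j := k)) f a = (?T(i := k)) a" if "a \<in> {1..n+m}" for k a
    using that i j by (auto simp: mixed_labels_def point_position_def)
  have B: "mixed_labels n f (g(int i := k, - int j := k)) a = (?B(n + j := k)) a" if "a \<in> {1..n+m}" for k a
    using that i j by (auto simp: mixed_labels_def point_position_def)
  have 1: "string_kernel n m \<sigma> (g(int i := k, - int j := k)) f =
      of_bool (\<forall>a\<in>{1..n+m}. (?B(n + j := k)) a = (?T(i := k)) (\<sigma> a))" for k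
    unfolding string_kernel_def
    by (intro arg_cong[where f = of_bool] ball_cong refl)
      (use T B permutes_in_image[OF \<sigma>] in presburger)
  have 2: "g (int i) = ?T i" "g (- int j) = ?B (n + j)"
    using i j by (simp_all add: mixed_labels_def point_position_def)
  show ?thesis
    unfolding 1 2 string_kernel_def[of n m "\<sigma> \<circ> _"]
    by (rule contract_labels[OF \<sigma>]) (use i j mixed_labels_less[OF g f] in auto)
qed

section \<open>The diagrams without horizontal strings\<close>

lemma sym_embed_simps:
  "a \<in> {1..n} \<Longrightarrow> sym_embed n m (\<alpha>, \<beta>) a = \<alpha> a"
  "j \<in> {1..m} \<Longrightarrow> sym_embed n m (\<alpha>, \<beta>) (n + j) = n + \<beta> j"
  "a \<notin> {1..n+m} \<Longrightarrow> sym_embed n m (\<alpha>, \<beta>) a = a"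
  by (auto simp: sym_embed_def)

lemma interval_cases:
  fixes a n m :: nat
  obtains "a \<in> {1..n}" | j where "j \<in> {1..m}" "a = n + j" | "a \<notin> {1..n+m}"
proof -
  have "a = n + (a - n) \<and> a - n \<in> {1..m}" if "a \<notin> {1..n}" "a \<in> {1..n+m}"
    using that by auto
  then show ?thesis using that by blast
qed

lemma sym_embed_comp:
  assumes "\<alpha> permutes {1..n}" "\<beta> permutes {1..m}"
  shows "sym_embed n m (\<alpha>', \<beta>') \<circ> sym_embed n m (\<alpha>, \<beta>) = sym_embed n m (\<alpha>' \<circ> \<alpha>, \<beta>' \<circ> \<beta>)"
proof
  fix a
  show "(sym_embed n m (\<alpha>', \<beta>') \<circ> sym_embed n m (\<alpha>, \<beta>)) a = sym_embed n m (\<alpha>' \<circ> \<alpha>, \<beta>' \<circ> \<beta>) a"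
    using assms by (rule_tac a = a and n = n and m = m in interval_cases)
      (simp_all only: comp_apply sym_embed_simps permutes_in_image not_False_eq_True)
qed

lemma sym_embed_permutes:
  assumes "\<alpha> permutes {1..n}" "\<beta> permutes {1..m}"
  shows "sym_embed n m (\<alpha>, \<beta>) permutes {1..n+m}"
proof -
  have "sym_embed n m (id, id) = id" by (auto simp: sym_embed_def)
  then have "bij (sym_embed n m (\<alpha>, \<beta>))"
    using sym_embed_comp[OF assms, of "inv' \<alpha>" "inv' \<beta>"]
      sym_embed_comp[OF permutes_inv[OF assms(1)] permutes_inv[OF assms(2)], of \<alpha> \<beta>] assms
    by (intro o_bij[of "sym_embed n m (inv' \<alpha>, inv' \<beta>)"]) (simp_all add: permutes_inv_o)
  then have "sym_embed n m (\<alpha>, \<beta>) permutes UNIV" using bij_imp_permutes[of _ UNIV] by simp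
  then show ?thesis by (rule permutes_superset) (auto simp: sym_embed_def)
qed

text \<open>
  The image of \<open>\<alpha> \<times> \<beta>\<close>, regarded as a diagram, under \<open>\<theta>\<close>: the exchange of rows reverses the strings
  at the negative positions and replaces \<open>\<beta>\<close> by its inverse.
\<close>
definition bent_perm :: "nat \<Rightarrow> nat \<Rightarrow> (nat \<Rightarrow> nat) \<times> (nat \<Rightarrow> nat) \<Rightarrow> nat \<Rightarrow> nat" where
  "bent_perm n m = (\<lambda>(\<alpha>, \<beta>). sym_embed n m (\<alpha>, inv' \<beta>))"

text \<open>
  A permutation with \<open>\<sigma> (n + j) = i \<le> n\<close> belongs to a diagram with a horizontal string on top. The
  remaining ones map \<open>{n+1..n+m}\<close> to itself, and therefore \<open>{1..n}\<close> too.
\<close>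
lemma bij_betw_bent_perm:
  "bij_betw (bent_perm n m) (carrier (sym_group2 n m))
     {\<sigma>. \<sigma> permutes {1..n+m} \<and> (\<forall>j\<in>{1..m}. n < \<sigma> (n + j))}"
  (is "bij_betw _ ?G ?S")
proof (rule bij_betw_imageI)
  show "inj_on (bent_perm n m) ?G"
  proof (rule inj_onI, clarsimp simp: sym_group_carrier)
    fix \<alpha> \<beta> \<alpha>' \<beta>'
    assume p: "\<alpha> permutes {Suc 0..n}" "\<beta> permutes {Suc 0..m}" "\<alpha>' permutes {Suc 0..n}" "\<beta>' permutes {Suc 0..m}"
      and eq: "bent_perm n m (\<alpha>, \<beta>) = bent_perm n m (\<alpha>', \<beta>')"
    have "\<alpha> a = \<alpha>' a" for a
      using fun_cong[OF eq, of a] p by (cases "a \<in> {1..n}") (auto simp: bent_perm_def sym_embed_def permutes_not_in)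
    moreover have "inv' \<beta> a = inv' \<beta>' a" for a
      using fun_cong[OF eq, of "n + a"] p permutes_inv[OF p(2)] permutes_inv[OF p(4)]
      by (cases "a \<in> {1..m}") (auto simp: bent_perm_def sym_embed_def permutes_not_in)
    then have "inv' \<beta> = inv' \<beta>'" by blast
    then have "\<beta> = \<beta>'" by (metis p(2,4) permutes_inv_inv)
    ultimately show "\<alpha> = \<alpha>' \<and> \<beta> = \<beta>'" by blast
  qed
  show "bent_perm n m ` ?G = ?S"
  proof (intro equalityI subsetI)
    fix \<sigma> assume "\<sigma> \<in> bent_perm n m ` ?G"
    then obtain \<alpha> \<beta> where ab: "\<alpha> permutes {1..n}" "\<beta> permutes {1..m}" "\<sigma> = sym_embed n m (\<alpha>, inv' \<beta>)"
      by (auto simp: bent_perm_def sym_group_carrier)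
    then show "\<sigma> \<in> ?S"
      using sym_embed_permutes[OF ab(1) permutes_inv[OF ab(2)]] permutes_le[OF permutes_inv[OF ab(2)]]
      by (fastforce simp: sym_embed_def)
  next
    fix \<sigma> assume "\<sigma> \<in> ?S"
    then have \<sigma>: "\<sigma> permutes {1..n+m}" and up: "\<And>j. j \<in> {1..m} \<Longrightarrow> n < \<sigma> (n + j)" by auto
    have upK: "\<sigma> ` {n+1..n+m} = {n+1..n+m}"
    proof (rule endo_inj_surj)
      show "\<sigma> ` {n+1..n+m} \<subseteq> {n+1..n+m}"
      proof
        fix b assume "b \<in> \<sigma> ` {n+1..n+m}"
        then obtain a where a: "a \<in> {n+1..n+m}" "b = \<sigma> a" by auto
        then have "a - n \<in> {1..m}" by auto
          then show "b \<in> {n+1..n+m}" using a up[of "a - n"] permutes_le[OF \<sigma>, of a] by auto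
      qed
      show "inj_on \<sigma> {n+1..n+m}" using permutes_inj[OF \<sigma>] by (rule inj_on_subset) simp
    qed simp
    have low: "\<sigma> a \<in> {1..n}" if "a \<in> {1..n}" for a
    proof -
      have "\<sigma> a \<notin> \<sigma> ` {n+1..n+m}" using that by (simp add: inj_image_mem_iff[OF permutes_inj[OF \<sigma>]])
      then show ?thesis unfolding upK using permutes_le[OF \<sigma>, of a] that by auto
    qed
    define \<alpha> where "\<alpha> a = (if a \<in> {1..n} then \<sigma> a else a)" for a
    define \<gamma> where "\<gamma> j = (if j \<in> {1..m} then \<sigma> (n + j) - n else j)" for j
    have \<alpha>: "\<alpha> permutes {1..n}"
    proof (rule inj_imp_permutes)
      show "inj_on \<alpha> {1..n}" using permutes_inj[OF \<sigma>] by (auto simp: inj_on_def \<alpha>_def inj_def)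
    qed (use low in \<open>auto simp: \<alpha>_def\<close>)
    have \<gamma>: "\<gamma> permutes {1..m}"
    proof (rule inj_imp_permutes)
      show "inj_on \<gamma> {1..m}"
      proof (rule inj_onI)
        fix x y assume xy: "x \<in> {1..m}" "y \<in> {1..m}" "\<gamma> x = \<gamma> y"
        then have "\<sigma> (n + x) = \<sigma> (n + y)" using up[of x] up[of y] by (auto simp: \<gamma>_def)
        then show "x = y" using injD[OF permutes_inj[OF \<sigma>], of "n + x" "n + y"] by simp
      qed
      show "\<gamma> x \<in> {1..m}" if "x \<in> {1..m}" for x
        using up[OF that] permutes_le[OF \<sigma>, of "n + x"] that by (auto simp: \<gamma>_def)
    qed (auto simp: \<gamma>_def)
    have "\<sigma> a = sym_embed n m (\<alpha>, \<gamma>) a" for a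
    proof -
      show ?thesis
      proof (cases rule: interval_cases[where a = a and n = n and m = m])
        case (2 j)
        then show ?thesis using up[of j] by (simp add: sym_embed_simps \<gamma>_def)
      qed (use permutes_not_in[OF \<sigma>] in \<open>simp_all add: sym_embed_simps \<alpha>_def\<close>)
    qed
    then have "\<sigma> = bent_perm n m (\<alpha>, inv' \<gamma>)"
      by (simp add: bent_perm_def fun_eq_iff permutes_inv_inv[OF \<gamma>])
    then show "\<sigma> \<in> bent_perm n m ` ?G"
      using \<alpha> permutes_inv[OF \<gamma>] by (auto simp: sym_group_carrier)
  qed
qed

lemma comp_signed_perm_in_multi_indices:
  assumes "\<sigma> \<in> carrier (sym_group2 n m)" "g \<in> multi_indices N n m"
  shows "g \<circ> signed_perm \<sigma> \<in> multi_indices N n m"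
proof -
  obtain \<alpha> \<beta> where ab: "\<sigma> = (\<alpha>, \<beta>)" "\<alpha> permutes {1..n}" "\<beta> permutes {1..m}"
    using assms(1) by (cases \<sigma>) (auto simp: sym_group_carrier)
  have "signed_perm \<sigma> p \<in> positions n m" if "p \<in> positions n m" for p
    using that permutes_le[OF ab(2), of "nat p"] permutes_le[OF ab(3), of "nat (- p)"]
    by (auto simp: ab(1) signed_perm_def positions_def)
  moreover have "signed_perm \<sigma> p = p" if "p \<notin> positions n m" for p
  proof -
    have "p > 0 \<Longrightarrow> nat p \<notin> {1..n}" "p < 0 \<Longrightarrow> nat (- p) \<notin> {1..m}" using that by (auto simp: positions_def)
    then show ?thesis
      using permutes_not_in[OF ab(2), of "nat p"] permutes_not_in[OF ab(3), of "nat (- p)"]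
      by (simp add: ab(1) signed_perm_def)
  qed
  ultimately show ?thesis
    using assms(2) by (auto simp: multi_indices_def PiE_iff extensional_def)
qed

lemma string_kernel_bent_perm:
  assumes "\<sigma> \<in> carrier (sym_group2 n m)" and g: "g \<in> multi_indices N n m" and f: "f \<in> multi_indices N n m"
  shows "string_kernel n m (bent_perm n m \<sigma>) g f = of_bool (f = g \<circ> signed_perm \<sigma>)"
proof -
  obtain \<alpha> \<beta> where ab: "\<sigma> = (\<alpha>, \<beta>)" "\<alpha> permutes {1..n}" "\<beta> permutes {1..m}"
    using assms(1) by (cases \<sigma>) (auto simp: sym_group_carrier)
  have K: "(\<forall>a\<in>{1..n+m}. P a) \<longleftrightarrow> (\<forall>a\<in>{1..n}. P a) \<and> (\<forall>j\<in>{1..m}. P (n + j))" for P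
  proof (intro iffI conjI ballI; (elim conjE)?)
    fix a assume "\<forall>a\<in>{1..n}. P a" "\<forall>j\<in>{1..m}. P (n + j)" "a \<in> {1..n+m}"
    then show "P a" by (cases rule: interval_cases[where a = a and n = n and m = m]) auto
  qed auto
  have neg: "(\<forall>j\<in>{1..m}. g (- int j) = f (- int (inv' \<beta> j))) \<longleftrightarrow> (\<forall>j\<in>{1..m}. f (- int j) = g (- int (\<beta> j)))"
  proof -
    have "(\<forall>j\<in>{1..m}. g (- int j) = f (- int (inv' \<beta> j))) \<longleftrightarrow>
        (\<forall>j\<in>\<beta> ` {1..m}. g (- int j) = f (- int (inv' \<beta> j)))"
      using permutes_image[OF ab(3)] by simp
    then show ?thesis by (simp add: permutes_inverses(2)[OF ab(3)]) metis
  qed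
  have "(\<forall>a\<in>{1..n+m}. mixed_labels n f g a = mixed_labels n g f (bent_perm n m \<sigma> a)) \<longleftrightarrow>
      (\<forall>a\<in>{1..n}. f (int a) = g (int (\<alpha> a))) \<and> (\<forall>j\<in>{1..m}. g (- int j) = f (- int (inv' \<beta> j)))"
  proof -
    have "mixed_labels n f g a = f (int a)" "mixed_labels n g f (bent_perm n m \<sigma> a) = g (int (\<alpha> a))"
      if "a \<in> {1..n}" for a
      using that permutes_le[OF ab(2), of a]
      by (simp_all add: ab(1) bent_perm_def sym_embed_simps mixed_labels_def point_position_def)
    moreover have "mixed_labels n f g (n + j) = g (- int j)"
      "mixed_labels n g f (bent_perm n m \<sigma> (n + j)) = f (- int (inv' \<beta> j))" if "j \<in> {1..m}" for j
      using that permutes_le[OF permutes_inv[OF ab(3)], of j]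
      by (simp_all add: ab(1) bent_perm_def sym_embed_simps mixed_labels_def point_position_def)
    ultimately show ?thesis unfolding K by simp
  qed
  also have "\<dots> \<longleftrightarrow> (\<forall>p\<in>positions n m. f p = (g \<circ> signed_perm \<sigma>) p)"
    unfolding neg
  proof (intro iffI conjI ballI; (elim conjE)?)
    fix p assume pos: "\<forall>a\<in>{1..n}. f (int a) = g (int (\<alpha> a))" and neg: "\<forall>j\<in>{1..m}. f (- int j) = g (- int (\<beta> j))"
      and p: "p \<in> positions n m"
    show "f p = (g \<circ> signed_perm \<sigma>) p"
    proof (cases "p > 0")
      case True
      then have "nat p \<in> {1..n}" using p by (auto simp: positions_def)
      then have "f (int (nat p)) = g (int (\<alpha> (nat p)))" using pos by blast
      then show ?thesis using True by (simp add: ab(1) signed_perm_def)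
    next
      case False
      then have p': "p < 0" "nat (- p) \<in> {1..m}" using p by (auto simp: positions_def)
      then have "f (- int (nat (- p))) = g (- int (\<beta> (nat (- p))))" using neg by blast
      then show ?thesis using p' by (simp add: ab(1) signed_perm_def)
    qed
  next
    fix a assume "\<forall>p\<in>positions n m. f p = (g \<circ> signed_perm \<sigma>) p" "a \<in> {1..n}"
    then show "f (int a) = g (int (\<alpha> a))"
      by (auto simp: ab(1) positions_def signed_perm_def dest: bspec[of _ _ "int a"])
  next
    fix j assume "\<forall>p\<in>positions n m. f p = (g \<circ> signed_perm \<sigma>) p" "j \<in> {1..m}"
    then show "f (- int j) = g (- int (\<beta> j))"
      by (auto simp: ab(1) positions_def signed_perm_def dest: bspec[of _ _ "- int j"])
  qed
  also have "\<dots> \<longleftrightarrow> f = g \<circ> signed_perm \<sigma>"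
    using f comp_signed_perm_in_multi_indices[OF assms(1) g]
    by (auto simp: multi_indices_def intro: PiE_ext)
  finally show ?thesis by (simp add: string_kernel_def)
qed

section \<open>The action of the symmetric groups on multi-indices\<close>

lemma group_sym_group2: "group (sym_group2 n m)"
  by (rule DirProd_group[OF sym_group_is_group sym_group_is_group])

lemma finite_sym_group: "finite (carrier (sym_group n))"
  by (simp add: sym_group_def finite_permutations)

lemma finite_sym_group2: "finite (carrier (sym_group2 n m))"
  by (simp add: finite_sym_group)

lemma signed_perm_mult:
  assumes "\<sigma> \<in> carrier (sym_group2 n m)" "\<tau> \<in> carrier (sym_group2 n m)"
  shows "signed_perm (\<sigma> \<otimes>\<^bsub>sym_group2 n m\<^esub> \<tau>) = signed_perm \<sigma> \<circ> signed_perm \<tau>"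
proof -
  obtain \<alpha> \<beta> \<alpha>' \<beta>' where eq: "\<sigma> = (\<alpha>, \<beta>)" "\<tau> = (\<alpha>', \<beta>')"
    and p: "\<alpha>' permutes {1..n}" "\<beta>' permutes {1..m}"
    using assms by (cases \<sigma>; cases \<tau>) (auto simp: sym_group_carrier)
  have pos: "0 < \<gamma> a" if "\<gamma> permutes {1..k}" "0 < a" for \<gamma> :: "nat \<Rightarrow> nat" and a k
    using permutes_le[OF that(1), of a] permutes_not_in[OF that(1), of a] that(2) by (cases "a \<le> k") auto
  have "signed_perm (\<sigma> \<otimes>\<^bsub>sym_group2 n m\<^esub> \<tau>) v = (signed_perm \<sigma> \<circ> signed_perm \<tau>) v" for v
    using pos[OF p(1), of "nat v"] pos[OF p(2), of "nat (- v)"]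
    by (cases "v > 0"; cases "v < 0") (simp_all add: eq signed_perm_def sym_group_mult)
  then show ?thesis by blast
qed

lemma signed_perm_one: "signed_perm \<one>\<^bsub>sym_group2 n m\<^esub> = id"
  by (auto simp: signed_perm_def sym_group_one fun_eq_iff)

lemma signed_perm_inv:
  assumes "\<sigma> \<in> carrier (sym_group2 n m)"
  shows "signed_perm \<sigma> \<circ> signed_perm (inv\<^bsub>sym_group2 n m\<^esub> \<sigma>) = id"
    "signed_perm (inv\<^bsub>sym_group2 n m\<^esub> \<sigma>) \<circ> signed_perm \<sigma> = id"
proof -
  interpret G: group "sym_group2 n m" by (rule group_sym_group2)
  show "signed_perm \<sigma> \<circ> signed_perm (inv\<^bsub>sym_group2 n m\<^esub> \<sigma>) = id"
    "signed_perm (inv\<^bsub>sym_group2 n m\<^esub> \<sigma>) \<circ> signed_perm \<sigma> = id"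
    using signed_perm_mult[OF assms G.inv_closed[OF assms]] signed_perm_mult[OF G.inv_closed[OF assms] assms]
    by (simp_all only: G.r_inv[OF assms] G.l_inv[OF assms] signed_perm_one)
qed

lemma signed_perm_bij:
  assumes "\<sigma> \<in> carrier (sym_group2 n m)"
  shows "bij (signed_perm \<sigma>)"
  using signed_perm_inv[OF assms] by (intro o_bij)

lemma bij_betw_comp_signed_perm:
  assumes "\<sigma> \<in> carrier (sym_group2 n m)"
  shows "bij_betw (\<lambda>g. g \<circ> signed_perm \<sigma>) (multi_indices N n m) (multi_indices N n m)"
proof (rule bij_betwI[where g = "\<lambda>g. g \<circ> signed_perm (inv\<^bsub>sym_group2 n m\<^esub> \<sigma>)"])
  interpret G: group "sym_group2 n m" by (rule group_sym_group2)
  have "inv\<^bsub>sym_group2 n m\<^esub> \<sigma> \<in> carrier (sym_group2 n m)" using assms by (rule G.inv_closed)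
  then show "(\<lambda>g. g \<circ> signed_perm \<sigma>) \<in> multi_indices N n m \<rightarrow> multi_indices N n m"
    "(\<lambda>g. g \<circ> signed_perm (inv\<^bsub>sym_group2 n m\<^esub> \<sigma>)) \<in> multi_indices N n m \<rightarrow> multi_indices N n m"
    using assms by (auto intro: comp_signed_perm_in_multi_indices simp del: carrier_DirProd)
qed (simp_all add: comp_assoc signed_perm_inv[OF assms])

lemma comp_signed_perm_in_multi_indices_iff:
  assumes "\<sigma> \<in> carrier (sym_group2 n m)"
  shows "g \<circ> signed_perm \<sigma> \<in> multi_indices N n m \<longleftrightarrow> g \<in> multi_indices N n m"
proof
  interpret G: group "sym_group2 n m" by (rule group_sym_group2)
  assume "g \<circ> signed_perm \<sigma> \<in> multi_indices N n m"
  then have "g \<circ> signed_perm \<sigma> \<circ> signed_perm (inv\<^bsub>sym_group2 n m\<^esub> \<sigma>) \<in> multi_indices N n m"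
    using assms by (intro comp_signed_perm_in_multi_indices[OF G.inv_closed])
  then show "g \<in> multi_indices N n m" by (simp add: comp_assoc signed_perm_inv[OF assms])
qed (rule comp_signed_perm_in_multi_indices[OF assms])

section \<open>The projection onto the traceless tensors\<close>

lemma insert_pair_upd:
  assumes "i \<in> {1..n}" "j \<in> {1..m}"
  shows "insert_pair n m i j k h = (insert_pair n m i j l h)(int i := k, - int j := k)"
  using assms by (auto simp: insert_pair_def fun_eq_iff positions_def)

text \<open>
  Instead of removing the two contracted positions, one may keep them and let the sum run over their
  common value. In this form no positions have to be renumbered.
\<close>
lemma traceless_iff:
  assumes N: "N \<ge> 1"
  shows "t \<in> traceless N n m \<longleftrightarrow> t \<in> tensors N n m \<and>
    (\<forall>i\<in>{1..n}. \<forall>j\<in>{1..m}. \<forall>g\<in>multi_indices N n m. (\<Sum>k<N. t (g(int i := k, - int j := k))) = 0)"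
proof -
  have "contraction N n m i j t = 0 \<longleftrightarrow> (\<forall>g\<in>multi_indices N n m. (\<Sum>k<N. t (g(int i := k, - int j := k))) = 0)"
    if i: "i \<in> {1..n}" and j: "j \<in> {1..m}" for i j
  proof (intro iffI ballI)
    fix g assume 0: "contraction N n m i j t = 0" and g: "g \<in> multi_indices N n m"
    \<comment> \<open>\<open>g\<close> with the positions \<open>i\<close> and \<open>-j\<close> removed\<close>
    define h where "h = (\<lambda>p\<in>positions (n - 1) (m - 1).
      if p \<ge> int i then g (p + 1) else if p \<le> - int j then g (p - 1) else g p)"
    have "h \<in> multi_indices N (n - 1) (m - 1)"
      using g i j by (auto simp: h_def multi_indices_def positions_def PiE_iff)
    then have "(\<Sum>k<N. t (insert_pair n m i j k h)) = 0"
      using fun_cong[OF 0, of h] by (simp add: contraction_def)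
    moreover have "insert_pair n m i j k h = g(int i := k, - int j := k)" for k
    proof
      fix p
      consider "p \<notin> positions n m" | "p = int i \<or> p = - int j" | "p \<in> positions n m" "p > int i"
        | "p \<in> positions n m" "p < - int j" | "p \<in> positions n m" "- int j < p" "p < int i"
        by force
      then show "insert_pair n m i j k h p = (g(int i := k, - int j := k)) p"
      proof cases
        case 1
        then show ?thesis using g i j
          by (auto simp: insert_pair_def multi_indices_def PiE_iff extensional_def positions_def)
      next
        case 3
        then have "p - 1 \<in> positions (n - 1) (m - 1)" using i by (auto simp: positions_def)
        then show ?thesis using 3 i by (auto simp: insert_pair_def h_def)
      next
        case 4
        then have "p + 1 \<in> positions (n - 1) (m - 1)" using j by (auto simp: positions_def)
        then show ?thesis using 4 i j by (auto simp: insert_pair_def h_def)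
      next
        case 5
        then have "p \<in> positions (n - 1) (m - 1)" using i j by (auto simp: positions_def)
        then show ?thesis using 5 by (auto simp: insert_pair_def h_def)
      qed (use i j in \<open>auto simp: insert_pair_def positions_def\<close>)
    qed
    ultimately show "(\<Sum>k<N. t (g(int i := k, - int j := k))) = 0" by simp
  next
    assume 0: "\<forall>g\<in>multi_indices N n m. (\<Sum>k<N. t (g(int i := k, - int j := k))) = 0"
    have "(\<Sum>k<N. t (insert_pair n m i j k h)) = 0" if h: "h \<in> multi_indices N (n - 1) (m - 1)" for h
    proof -
      have hN: "h p < N" if "p \<in> positions (n - 1) (m - 1)" for p
        using h that by (auto simp: multi_indices_def)
      have "insert_pair n m i j 0 h \<in> multi_indices N n m"
        unfolding multi_indices_def
      proof (rule PiE_I)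
        fix p assume p: "p \<in> positions n m"
        have "p > int i \<Longrightarrow> p - 1 \<in> positions (n - 1) (m - 1)"
          "p < - int j \<Longrightarrow> p + 1 \<in> positions (n - 1) (m - 1)"
          "p < int i \<Longrightarrow> p > - int j \<Longrightarrow> p \<in> positions (n - 1) (m - 1)"
          using p i j by (auto simp: positions_def)
        then show "insert_pair n m i j 0 h p \<in> {..<N}"
          using p N hN by (auto simp: insert_pair_def)
      qed (simp add: insert_pair_def)
      then have "(\<Sum>k<N. t ((insert_pair n m i j 0 h)(int i := k, - int j := k))) = 0" using 0 by blast
      moreover have "(\<Sum>k<N. t (insert_pair n m i j k h)) =
          (\<Sum>k<N. t ((insert_pair n m i j 0 h)(int i := k, - int j := k)))"
        by (intro sum.cong refl arg_cong[where f = t] insert_pair_upd[OF i j])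
      ultimately show ?thesis by simp
    qed
    then show "contraction N n m i j t = 0" by (auto simp: contraction_def fun_eq_iff)
  qed
  then show ?thesis by (simp add: traceless_def)
qed

text \<open>
  A tensor of the form \<open>\<Sum>\<^sub>k \<dots> e\<^sub>k \<otimes> \<dots> \<otimes> e\<^sup>*\<^sub>k \<dots>\<close>, with the entries of \<open>h\<close> at the other positions.
\<close>
definition pair_vector :: "nat \<Rightarrow> nat \<times> nat \<times> multi_index \<Rightarrow> tensor" where
  "pair_vector N = (\<lambda>(i, j, h) f. of_bool (\<exists>k<N. f = h(int i := k, - int j := k)))"

lemma upd_in_multi_indices:
  assumes "g \<in> multi_indices N n m" "i \<in> {1..n}" "j \<in> {1..m}" "k < N"
  shows "g(int i := k, - int j := k) \<in> multi_indices N n m"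
  using assms by (auto simp: multi_indices_def PiE_iff extensional_def positions_def)

text \<open>
  A contraction is the inner product with a vector, so the traceless tensors are the orthogonal
  complement of the finitely many vectors \<open>pair_vector\<close>.
\<close>
lemma sum_pair_vector:
  assumes "h \<in> multi_indices N n m" "i \<in> {1..n}" "j \<in> {1..m}"
  shows "(\<Sum>f\<in>multi_indices N n m. t f * cnj (pair_vector N (i, j, h) f)) =
    (\<Sum>k<N. t (h(int i := k, - int j := k)))"
proof -
  let ?u = "\<lambda>k. h(int i := k, - int j := k)"
  have inj: "inj_on ?u {..<N}" by (rule inj_onI) (metis fun_upd_same)
  have "(\<Sum>f\<in>multi_indices N n m. t f * cnj (pair_vector N (i, j, h) f)) =
      (\<Sum>f\<in>?u ` {..<N}. t f)"
    by (rule sum.mono_neutral_cong_right)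
      (use upd_in_multi_indices[OF assms] in \<open>auto simp: pair_vector_def finite_multi_indices\<close>)
  also have "\<dots> = (\<Sum>k<N. t (?u k))" by (simp add: sum.reindex[OF inj])
  finally show ?thesis .
qed

lemma subspace_traceless:
  assumes "N \<ge> 1" shows "tensor.subspace (traceless N n m)"
  by (auto simp: tensor.subspace_def traceless_iff[OF assms] tensors_def tensor_scale_def sum.distrib
      simp flip: sum_distrib_left)

lemma traceless_supported: "t \<in> traceless N n m \<Longrightarrow> f \<notin> multi_indices N n m \<Longrightarrow> t f = 0"
  by (simp add: traceless_def tensors_def)

text \<open>
  Subtract from \<open>t\<close> its projection onto the span of the vectors \<open>pair_vector\<close>.
\<close>
lemma traceless_projection_exists:
  assumes N: "N \<ge> 1" and t: "t \<in> tensors N n m"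
  shows "\<exists>p\<in>traceless N n m. \<forall>s\<in>traceless N n m. tensor_inner N n m (t - p) s = 0"
proof -
  let ?I = "multi_indices N n m"
  let ?S = "{1..n} \<times> {1..m} \<times> ?I"
  obtain c where c: "\<And>x. x \<in> ?S \<Longrightarrow>
      (\<Sum>f\<in>?I. (t f - (\<Sum>y\<in>?S. c y * pair_vector N y f)) * cnj (pair_vector N x f)) = 0"
    using orthogonal_decomposition[of ?I ?S t "pair_vector N"] finite_multi_indices by blast
  define p where "p f = (if f \<in> ?I then t f - (\<Sum>y\<in>?S. c y * pair_vector N y f) else 0)" for f
  show ?thesis
  proof (intro bexI ballI)
    have "(\<Sum>k<N. p (g(int i := k, - int j := k))) = 0"
      if i: "i \<in> {1..n}" and j: "j \<in> {1..m}" and g: "g \<in> ?I" for i j g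
    proof -
      have "(\<Sum>k<N. p (g(int i := k, - int j := k))) = (\<Sum>f\<in>?I. p f * cnj (pair_vector N (i, j, g) f))"
        by (rule sum_pair_vector[OF g i j, symmetric])
      also have "\<dots> = 0" using c[of "(i, j, g)"] i j g by (simp add: p_def)
      finally show ?thesis .
    qed
    then show "p \<in> traceless N n m"
      by (auto simp: traceless_iff[OF N] tensors_def p_def)
  next
    fix s assume s: "s \<in> traceless N n m"
    have "(\<Sum>f\<in>?I. pair_vector N y f * cnj (s f)) = 0" if "y \<in> ?S" for y
    proof -
      obtain i j h where y: "y = (i, j, h)" "i \<in> {1..n}" "j \<in> {1..m}" "h \<in> ?I" using \<open>y \<in> ?S\<close> by blast
      have "(\<Sum>f\<in>?I. pair_vector N y f * cnj (s f)) = cnj (\<Sum>f\<in>?I. s f * cnj (pair_vector N y f))"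
        by (simp add: mult.commute)
      also have "\<dots> = 0"
        using s y by (simp only: sum_pair_vector[OF y(4,2,3)] traceless_iff[OF N]) simp
      finally show ?thesis .
    qed
    moreover have "tensor_inner N n m (t - p) s = (\<Sum>f\<in>?I. \<Sum>y\<in>?S. c y * (pair_vector N y f * cnj (s f)))"
      unfolding tensor_inner_def
      by (rule sum.cong) (simp_all add: p_def sum_distrib_right mult.assoc)
    ultimately show "tensor_inner N n m (t - p) s = 0"
      by (subst (asm) sum.swap) (simp flip: sum_distrib_left)
  qed
qed

lemma tensor_inner_self_eq_0:
  assumes "tensor_inner N n m t t = 0" "f \<in> multi_indices N n m"
  shows "t f = 0"
  using assms sum_mult_cnj_eq_0[OF finite_multi_indices] unfolding tensor_inner_def by blast

lemma traceless_projection_eqI: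
  assumes N: "N \<ge> 1" and p: "p \<in> traceless N n m"
    and orth: "\<And>s. s \<in> traceless N n m \<Longrightarrow> tensor_inner N n m (t - p) s = 0"
  shows "traceless_projection N n m t = p"
  unfolding traceless_projection_def
proof (rule the_equality)
  fix p' assume p': "p' \<in> traceless N n m \<and> (\<forall>s\<in>traceless N n m. tensor_inner N n m (t - p') s = 0)"
  have d: "p - p' \<in> traceless N n m"
    using tensor.subspace_diff[OF subspace_traceless[OF N]] p p' by blast
  have "tensor_inner N n m (p - p') (p - p') =
      tensor_inner N n m (t - p') (p - p') - tensor_inner N n m (t - p) (p - p')"
    by (simp add: tensor_inner_def algebra_simps flip: sum_subtractf)
  then have "tensor_inner N n m (p - p') (p - p') = 0" using orth[OF d] p' d by simp
  then have "(p - p') f = 0" if "f \<in> multi_indices N n m" for f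
    by (rule tensor_inner_self_eq_0[OF _ that])
  moreover have "(p - p') f = 0" if "f \<notin> multi_indices N n m" for f
    using traceless_supported[OF d that] .
  ultimately have "p f = p' f" for f by (cases "f \<in> multi_indices N n m") auto
  then show "p' = p" by (simp add: fun_eq_iff)
qed (use assms in blast)

lemma traceless_projection:
  assumes "N \<ge> 1" "t \<in> tensors N n m"
  shows "traceless_projection N n m t \<in> traceless N n m"
    and "s \<in> traceless N n m \<Longrightarrow> tensor_inner N n m (t - traceless_projection N n m t) s = 0"
  using traceless_projection_exists[OF assms] traceless_projection_eqI[OF assms(1)] by metis+

text \<open>
  The matrix of the projection onto the traceless tensors.
\<close>
definition proj_kernel :: "nat \<Rightarrow> nat \<Rightarrow> nat \<Rightarrow> multi_index \<Rightarrow> multi_index \<Rightarrow> complex" where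
  "proj_kernel N n m g f = traceless_projection N n m (\<lambda>h. of_bool (h = f)) g"

lemma proj_kernel_column:
  assumes "N \<ge> 1" "f \<in> multi_indices N n m"
  shows "(\<lambda>g. proj_kernel N n m g f) \<in> traceless N n m"
    and "s \<in> traceless N n m \<Longrightarrow>
      tensor_inner N n m ((\<lambda>h. of_bool (h = f)) - (\<lambda>g. proj_kernel N n m g f)) s = 0"
proof -
  have "(\<lambda>h. of_bool (h = f)) \<in> tensors N n m" using assms by (auto simp: tensors_def)
  from traceless_projection[OF assms(1) this]
  show "(\<lambda>g. proj_kernel N n m g f) \<in> traceless N n m"
    "s \<in> traceless N n m \<Longrightarrow>
      tensor_inner N n m ((\<lambda>h. of_bool (h = f)) - (\<lambda>g. proj_kernel N n m g f)) s = 0"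
    by (simp_all add: proj_kernel_def)
qed

lemma traceless_projection_kernel:
  assumes N: "N \<ge> 1" and t: "t \<in> tensors N n m"
  shows "traceless_projection N n m t = (\<lambda>g. \<Sum>f\<in>multi_indices N n m. proj_kernel N n m g f * t f)"
    (is "_ = ?p")
proof (rule traceless_projection_eqI[OF N])
  let ?I = "multi_indices N n m"
  let ?d = "\<lambda>f. (\<lambda>h. of_bool (h = f)) - (\<lambda>g. proj_kernel N n m g f)"
  have "?p = (\<Sum>f\<in>?I. tensor_scale (t f) (\<lambda>g. proj_kernel N n m g f))"
    by (auto simp: fun_eq_iff sum_fun_apply tensor_scale_def mult.commute)
  also have "\<dots> \<in> traceless N n m"
    using subspace_traceless[OF N] proj_kernel_column(1)[OF N]
    by (intro tensor.subspace_sum tensor.subspace_scale) auto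
  finally show "?p \<in> traceless N n m" .
  fix s assume s: "s \<in> traceless N n m"
  have eq: "(t - ?p) g = (\<Sum>f\<in>?I. t f * ?d f g)" if "g \<in> ?I" for g
  proof -
    have "(\<Sum>f\<in>?I. t f * of_bool (g = f)) = (\<Sum>f\<in>?I. if f = g then t f else 0)"
      by (rule sum.cong) auto
    also have "\<dots> = t g" using that by (simp add: sum.delta finite_multi_indices)
    finally show ?thesis by (simp add: algebra_simps sum_subtractf)
  qed
  have "tensor_inner N n m (t - ?p) s = (\<Sum>g\<in>?I. \<Sum>f\<in>?I. t f * (?d f g * cnj (s g)))"
    unfolding tensor_inner_def
  proof (rule sum.cong[OF refl])
    fix g assume "g \<in> ?I"
    show "(t - ?p) g * cnj (s g) = (\<Sum>f\<in>?I. t f * (?d f g * cnj (s g)))"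
      unfolding eq[OF \<open>g \<in> ?I\<close>] sum_distrib_right mult.assoc ..
  qed
  also have "\<dots> = (\<Sum>f\<in>?I. \<Sum>g\<in>?I. t f * (?d f g * cnj (s g)))" by (rule sum.swap)
  also have "\<dots> = (\<Sum>f\<in>?I. t f * tensor_inner N n m (?d f) s)"
    unfolding tensor_inner_def sum_distrib_left ..
  also have "\<dots> = 0"
  proof (rule sum.neutral, rule ballI)
    fix f assume "f \<in> ?I"
    from proj_kernel_column(2)[OF N this s]
    show "t f * tensor_inner N n m (?d f) s = 0" by (simp only: mult_zero_right)
  qed
  finally show "tensor_inner N n m (t - ?p) s = 0" .
qed

lemma proj_kernel_traceless:
  assumes N: "N \<ge> 1" and t: "t \<in> traceless N n m"
  shows "(\<Sum>f\<in>multi_indices N n m. proj_kernel N n m g f * t f) = t g"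
proof -
  have "traceless_projection N n m t = t"
    by (rule traceless_projection_eqI[OF N t]) (simp add: tensor_inner_def)
  moreover have "t \<in> tensors N n m" using t by (simp add: traceless_def)
  ultimately show ?thesis using fun_cong[OF traceless_projection_kernel[OF N, of t n m], of g] by simp
qed

lemma proj_kernel_orthogonal:
  assumes N: "N \<ge> 1" and t: "t \<in> tensors N n m"
    and orth: "\<And>s. s \<in> traceless N n m \<Longrightarrow> tensor_inner N n m t s = 0"
  shows "(\<Sum>f\<in>multi_indices N n m. proj_kernel N n m g f * t f) = 0"
proof -
  have "traceless_projection N n m t = 0"
    by (rule traceless_projection_eqI[OF N tensor.subspace_0[OF subspace_traceless[OF N]]]) (simp add: orth)
  then show ?thesis using fun_cong[OF traceless_projection_kernel[OF N t], of g] by simp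
qed

lemma perm_act_traceless:
  assumes N: "N \<ge> 1" and \<sigma>: "\<sigma> \<in> carrier (sym_group2 n m)" and t: "t \<in> traceless N n m"
  shows "perm_act \<sigma> t \<in> traceless N n m"
proof -
  interpret G: group "sym_group2 n m" by (rule group_sym_group2)
  obtain \<alpha> \<beta> where ab: "\<sigma> = (\<alpha>, \<beta>)" "\<alpha> permutes {1..n}" "\<beta> permutes {1..m}"
    using \<sigma> by (cases \<sigma>) (auto simp: sym_group_carrier)
  have "(\<Sum>k<N. perm_act \<sigma> t (g(int i := k, - int j := k))) = 0"
    if i: "i \<in> {1..n}" and j: "j \<in> {1..m}" and g: "g \<in> multi_indices N n m" for i j g
  proof -
    define i' j' where "i' = inv' \<alpha> i" and "j' = inv' \<beta> j"
    have i': "i' \<in> {1..n}" "\<alpha> i' = i" and j': "j' \<in> {1..m}" "\<beta> j' = j"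
      using i j permutes_in_image[OF permutes_inv[OF ab(2)]] permutes_in_image[OF permutes_inv[OF ab(3)]]
        permutes_inverses[OF ab(2)] permutes_inverses[OF ab(3)] unfolding i'_def j'_def by blast+
    have s: "signed_perm \<sigma> (int i') = int i" "signed_perm \<sigma> (- int j') = - int j"
      using i' j' by (auto simp: ab(1) signed_perm_def)
    have inj: "signed_perm \<sigma> p = signed_perm \<sigma> q \<longleftrightarrow> p = q" for p q
      using bij_is_inj[OF signed_perm_bij[OF \<sigma>]] by (simp add: inj_eq)
    have "(g(int i := k, - int j := k)) \<circ> signed_perm \<sigma> = (g \<circ> signed_perm \<sigma>)(int i' := k, - int j' := k)" for k
      unfolding s[symmetric] by (auto simp: fun_eq_iff inj)
    then show ?thesis
      using t i' j' comp_signed_perm_in_multi_indices[OF \<sigma> g] unfolding perm_act_def traceless_iff[OF N]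
      by simp
  qed
  moreover have "perm_act \<sigma> t \<in> tensors N n m"
    using t comp_signed_perm_in_multi_indices_iff[OF \<sigma>] by (simp add: tensors_def perm_act_def traceless_def)
  ultimately show ?thesis by (simp add: traceless_iff[OF N])
qed

text \<open>
  The projection commutes with the permutations of tensor factors, because these are unitary and
  preserve the traceless tensors.
\<close>
lemma proj_kernel_equivariant:
  assumes N: "N \<ge> 1" and \<sigma>: "\<sigma> \<in> carrier (sym_group2 n m)" and f: "f \<in> multi_indices N n m"
  shows "proj_kernel N n m (g \<circ> signed_perm \<sigma>) (f \<circ> signed_perm \<sigma>) = proj_kernel N n m g f"
proof -
  interpret G: group "sym_group2 n m" by (rule group_sym_group2)
  let ?I = "multi_indices N n m" and ?s = "signed_perm \<sigma>"
  let ?p = "\<lambda>g. proj_kernel N n m g (f \<circ> ?s)"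
  have fs: "f \<circ> ?s \<in> ?I" by (rule comp_signed_perm_in_multi_indices[OF \<sigma> f])
  have surj: "h \<circ> ?s = f \<circ> ?s \<longleftrightarrow> h = f" for h
    using bij_is_surj[OF signed_perm_bij[OF \<sigma>]] by (auto dest: fun.inj_map_strong simp: surj_fun_eq)
  have "traceless_projection N n m (\<lambda>h. of_bool (h = f)) = perm_act \<sigma> ?p"
  proof (rule traceless_projection_eqI[OF N])
    show "perm_act \<sigma> ?p \<in> traceless N n m"
      by (rule perm_act_traceless[OF N \<sigma> proj_kernel_column(1)[OF N fs]])
    fix s assume s: "s \<in> traceless N n m"
    let ?s' = "perm_act (inv\<^bsub>sym_group2 n m\<^esub> \<sigma>) s"
    let ?d = "(\<lambda>h. of_bool (h = f \<circ> ?s)) - ?p"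
    have s': "?s' \<in> traceless N n m" by (rule perm_act_traceless[OF N G.inv_closed[OF \<sigma>] s])
    have "tensor_inner N n m ((\<lambda>h. of_bool (h = f)) - perm_act \<sigma> ?p) s =
        (\<Sum>g\<in>?I. ?d (g \<circ> ?s) * cnj (?s' (g \<circ> ?s)))"
      by (simp add: tensor_inner_def perm_act_def surj comp_assoc signed_perm_inv[OF \<sigma>])
    also have "\<dots> = tensor_inner N n m ?d ?s'"
      unfolding tensor_inner_def by (rule sum.reindex_bij_betw[OF bij_betw_comp_signed_perm[OF \<sigma>]])
    finally show "tensor_inner N n m ((\<lambda>h. of_bool (h = f)) - perm_act \<sigma> ?p) s = 0"
      using proj_kernel_column(2)[OF N fs s'] by simp
  qed
  then show ?thesis by (simp add: proj_kernel_def perm_act_def)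
qed

section \<open>The Weingarten function as a dual vector\<close>

lemma cnj_string_kernel [simp]: "cnj (string_kernel n m \<sigma> g f) = string_kernel n m \<sigma> g f"
  by (simp add: string_kernel_def)

text \<open>
  The pairing of \<open>\<sigma>\<^sup>-\<^sup>1\<close> with \<open>\<tau>\<close> is that of \<open>\<tau>\<^sup>-\<^sup>1\<close> with \<open>\<sigma>\<close>, as inversion transposes the matrices.
\<close>
lemma Omega_comp_commute:
  assumes "\<sigma> permutes {1..n}" "\<tau> permutes {1..n}"
  shows "Omega N n (\<sigma> \<circ> \<tau>) = Omega N n (\<tau> \<circ> \<sigma>)"
proof -
  \<comment> \<open>tensors without dual factors: all points are positive positions\<close>
  let ?I = "multi_indices N n 0"
  have s: "Omega N n (\<sigma> \<circ> \<tau>) =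
      (\<Sum>g\<in>?I. \<Sum>f\<in>?I. string_kernel n 0 (inv' \<sigma>) g f * string_kernel n 0 \<tau> g f)"
    if "\<sigma> permutes {1..n}" "\<tau> permutes {1..n}" for \<sigma> \<tau>
    using sum_string_kernel_mult[where n = n and m = 0 and N = N, of "inv' \<sigma>" \<tau>] that permutes_inv[OF that(1)]
    by (simp add: permutes_inv_inv sum.cartesian_product)
  have "Omega N n (\<sigma> \<circ> \<tau>) =
      (\<Sum>g\<in>?I. \<Sum>f\<in>?I. string_kernel n 0 (inv' \<tau>) f g * string_kernel n 0 \<sigma> f g)"
    unfolding s[OF assms] using assms string_kernel_inv[where n = n and m = 0]
    by (simp add: mult.commute)
  also have "\<dots> = Omega N n (\<tau> \<circ> \<sigma>)"
    unfolding s[OF assms(2,1)] by (rule sum.swap)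
  finally show ?thesis .
qed

lemma central_Omega: "central_in (group_algebra (sym_group n)) (Omega N n)"
proof -
  interpret S: group "sym_group n" by (rule sym_group_is_group)
  show ?thesis
    unfolding S.central_in_group_algebra_iff[OF finite_sym_group]
    using Omega_comp_commute by (auto simp: group_algebra_simps Omega_def sym_group_mult sym_group_carrier)
qed

text \<open>
  The entries of the Gram matrix of the permutation matrices are \<open>\<Omega>(\<sigma>\<^sup>-\<^sup>1 \<tau>)\<close>. The coefficients of the
  vector dual to the identity are therefore a left inverse of \<open>\<Omega>\<close> for the convolution.
\<close>
lemma Wg_inverse:
  assumes N: "N \<ge> k"
  shows "Wg N k \<otimes>\<^bsub>group_algebra (sym_group k)\<^esub> Omega N k = \<one>\<^bsub>group_algebra (sym_group k)\<^esub>"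
    and "central_in (group_algebra (sym_group k)) (Wg N k)"
proof -
  interpret S: group "sym_group k" by (rule sym_group_is_group)
  interpret A: monoid "group_algebra (sym_group k)" by (rule S.monoid_group_algebra[OF finite_sym_group])
  let ?I = "multi_indices N k 0" and ?S = "{\<sigma>. \<sigma> permutes {1..k}}"
  obtain w where w: "\<And>s. s \<in> ?S \<Longrightarrow>
    (\<Sum>i\<in>?I \<times> ?I. (\<Sum>r\<in>?S. w r * (case i of (g, f) \<Rightarrow> string_kernel k 0 r g f)) *
      cnj (case i of (g, f) \<Rightarrow> string_kernel k 0 s g f)) = (if s = id then 1 else 0)"
  proof (rule dual_vector[where I = "?I \<times> ?I" and S = ?S and e = id and
        x = "\<lambda>\<sigma> (g, f). string_kernel k 0 \<sigma> g f"])
    fix c :: "(nat \<Rightarrow> nat) \<Rightarrow> complex"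
    assume "\<forall>i\<in>?I \<times> ?I. (\<Sum>s\<in>?S. c s * (case i of (g, f) \<Rightarrow> string_kernel k 0 s g f)) = 0"
    then show "c id = 0"
      using string_kernel_independent[where n = k and m = 0 and N = N and c = c and \<sigma> = id] N by auto
  qed (auto simp: finite_multi_indices finite_permutations permutes_id)
  define w' where "w' \<sigma> = (if \<sigma> \<in> carrier (sym_group k) then w \<sigma> else 0)" for \<sigma>
  have w'_carrier: "w' \<in> carrier (group_algebra (sym_group k))"
    by (simp add: w'_def group_algebra_simps)
  have "(\<Sum>r\<in>?S. w r * Omega N k (inv' r \<circ> s)) = (if s = id then 1 else 0)" if s: "s \<in> ?S" for s
  proof -
    have "(\<Sum>r\<in>?S. w r * Omega N k (inv' r \<circ> s)) =
        (\<Sum>r\<in>?S. \<Sum>i\<in>?I \<times> ?I. w r * (case i of (g, f) \<Rightarrow> string_kernel k 0 r g f) *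
          cnj (case i of (g, f) \<Rightarrow> string_kernel k 0 s g f))"
    proof (rule sum.cong[OF refl])
      fix r assume "r \<in> ?S"
      then have "Omega N k (inv' r \<circ> s) =
          (\<Sum>(g, f)\<in>?I \<times> ?I. string_kernel k 0 r g f * string_kernel k 0 s g f)"
        using sum_string_kernel_mult[where n = k and m = 0 and N = N, of r s] s by simp
      then show "w r * Omega N k (inv' r \<circ> s) =
        (\<Sum>i\<in>?I \<times> ?I. w r * (case i of (g, f) \<Rightarrow> string_kernel k 0 r g f) *
          cnj (case i of (g, f) \<Rightarrow> string_kernel k 0 s g f))"
        by (simp add: sum_distrib_left case_prod_beta mult.assoc)
    qed
    also have "\<dots> = (\<Sum>i\<in>?I \<times> ?I. (\<Sum>r\<in>?S. w r * (case i of (g, f) \<Rightarrow> string_kernel k 0 r g f)) *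
      cnj (case i of (g, f) \<Rightarrow> string_kernel k 0 s g f))"
      by (subst sum.swap) (simp only: sum_distrib_right)
    finally show ?thesis using w[OF s] by simp
  qed
  moreover have S: "carrier (sym_group k) = ?S" by (auto simp: sym_group_carrier)
  ultimately have sum: "(\<Sum>r\<in>carrier (sym_group k). w' r * Omega N k (inv\<^bsub>sym_group k\<^esub> r \<otimes>\<^bsub>sym_group k\<^esub> s)) =
      (if s = \<one>\<^bsub>sym_group k\<^esub> then 1 else 0)" if "s \<in> carrier (sym_group k)" for s
    using that by (simp add: w'_def sym_group_mult sym_group_one)
  have left: "w' \<otimes>\<^bsub>group_algebra (sym_group k)\<^esub> Omega N k = \<one>\<^bsub>group_algebra (sym_group k)\<^esub>"
    unfolding group_algebra_simps
  proof
    fix s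
    show "(if s \<in> carrier (sym_group k) then \<Sum>y\<in>carrier (sym_group k). w' y *
        Omega N k (inv\<^bsub>sym_group k\<^esub> y \<otimes>\<^bsub>sym_group k\<^esub> s) else 0) =
      (if s = \<one>\<^bsub>sym_group k\<^esub> then 1 else 0)"
    proof (cases "s \<in> carrier (sym_group k)")
      case True
      then show ?thesis by (simp only: sum if_True)
    next
      case False
      then have "s \<noteq> \<one>\<^bsub>sym_group k\<^esub>" using S.one_closed by metis
      with False show ?thesis by (simp only: if_False)
    qed
  qed
  note inverse = A.central_left_inverse[OF central_Omega w'_carrier left]
  then have "Wg N k = w'" by (simp add: Wg_def)
  then show "Wg N k \<otimes>\<^bsub>group_algebra (sym_group k)\<^esub> Omega N k = \<one>\<^bsub>group_algebra (sym_group k)\<^esub>"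
    "central_in (group_algebra (sym_group k)) (Wg N k)"
    using left inverse by simp_all
qed

lemma Wg_comp_commute:
  assumes "N \<ge> k" "\<sigma> permutes {1..k}" "\<tau> permutes {1..k}"
  shows "Wg N k (\<sigma> \<circ> \<tau>) = Wg N k (\<tau> \<circ> \<sigma>)"
proof -
  interpret S: group "sym_group k" by (rule sym_group_is_group)
  show ?thesis
    using Wg_inverse(2)[OF assms(1)] assms(2,3)
    by (simp add: S.central_in_group_algebra_iff[OF finite_sym_group] sym_group_mult sym_group_carrier)
qed

text \<open>
  \<open>\<alpha> \<times> \<beta>\<^sup>-\<^sup>1\<close> and \<open>\<alpha> \<times> \<beta>\<close> are conjugate, and the Weingarten function is a class function.
\<close>
lemma Wg_bent_perm:
  assumes N: "N \<ge> n + m" and "\<sigma> \<in> carrier (sym_group2 n m)"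
  shows "Wg N (n + m) (bent_perm n m \<sigma>) = Wg N (n + m) (sym_embed n m \<sigma>)"
proof -
  obtain \<alpha> \<beta> where ab: "\<sigma> = (\<alpha>, \<beta>)" "\<alpha> permutes {1..n}" "\<beta> permutes {1..m}"
    using assms(2) by (cases \<sigma>) (auto simp: sym_group_carrier)
  obtain \<tau> where \<tau>: "\<tau> permutes {1..m}" "\<tau> \<circ> \<tau> = id" "\<tau> \<circ> \<beta> \<circ> \<tau> = inv' \<beta>"
    using permutes_conjugate_to_inverse[OF ab(3)] by blast
  let ?T = "sym_embed n m (id, \<tau>)" and ?E = "sym_embed n m (\<alpha>, \<beta>)"
  have perm: "?T permutes {1..n+m}" "?E permutes {1..n+m}"
    by (rule sym_embed_permutes[OF permutes_id \<tau>(1)], rule sym_embed_permutes[OF ab(2,3)])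
  have TE: "?T \<circ> ?E = sym_embed n m (\<alpha>, \<tau> \<circ> \<beta>)"
    using sym_embed_comp[OF ab(2,3), of id \<tau>] by simp
  have "bent_perm n m \<sigma> = ?T \<circ> ?E \<circ> ?T"
    unfolding TE using sym_embed_comp[of id n \<tau> m \<alpha> "\<tau> \<circ> \<beta>"] \<tau> by (simp add: ab(1) bent_perm_def permutes_id)
  then have "Wg N (n + m) (bent_perm n m \<sigma>) = Wg N (n + m) (?T \<circ> (?T \<circ> ?E))"
    using Wg_comp_commute[OF N permutes_compose[OF perm(2,1)] perm(1)] by simp
  also have "?T \<circ> (?T \<circ> ?E) = ?E"
    unfolding TE using sym_embed_comp[OF ab(2) permutes_compose[OF ab(3) \<tau>(1)], of id \<tau>] \<tau>(2)
    by (simp flip: comp_assoc)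
  finally show ?thesis by (simp add: ab(1))
qed

text \<open>
  The matrix of the Brauer algebra element \<open>\<theta>\<^sup>-\<^sup>1(Wg)\<close>.
\<close>
definition weingarten_kernel :: "nat \<Rightarrow> nat \<Rightarrow> nat \<Rightarrow> multi_index \<Rightarrow> multi_index \<Rightarrow> complex" where
  "weingarten_kernel N n m g f =
     (\<Sum>\<sigma> | \<sigma> permutes {1..n+m}. Wg N (n + m) \<sigma> * string_kernel n m \<sigma> g f)"

text \<open>
  Among all diagrams, \<open>\<theta>\<^sup>-\<^sup>1(Wg)\<close> pairs nontrivially with the identity only. This is the equation
  \<open>Wg * \<Omega> = 1\<close>, read through the Gram matrix of the diagrams.
\<close>
lemma sum_weingarten_string_kernel:
  assumes N: "N \<ge> n + m" and \<tau>: "\<tau> permutes {1..n+m}"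
  shows "(\<Sum>g\<in>multi_indices N n m. \<Sum>f\<in>multi_indices N n m.
    weingarten_kernel N n m g f * string_kernel n m \<tau> g f) = of_bool (\<tau> = id)"
proof -
  let ?I = "multi_indices N n m" and ?S = "{\<sigma>. \<sigma> permutes {1..n+m}}"
  have "(\<Sum>g\<in>?I. \<Sum>f\<in>?I. weingarten_kernel N n m g f * string_kernel n m \<tau> g f) =
      (\<Sum>x\<in>?I \<times> ?I. \<Sum>\<sigma>\<in>?S. Wg N (n + m) \<sigma> *
        (case x of (g, f) \<Rightarrow> string_kernel n m \<sigma> g f * string_kernel n m \<tau> g f))"
  proof -
    have "(\<Sum>g\<in>?I. \<Sum>f\<in>?I. weingarten_kernel N n m g f * string_kernel n m \<tau> g f) =
        (\<Sum>(g, f)\<in>?I \<times> ?I. weingarten_kernel N n m g f * string_kernel n m \<tau> g f)"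
      by (rule sum.cartesian_product)
    then show ?thesis
      by (simp only:) (rule sum.cong; auto simp: weingarten_kernel_def sum_distrib_right mult.assoc)
  qed
  also have "\<dots> = (\<Sum>\<sigma>\<in>?S. Wg N (n + m) \<sigma> *
      (\<Sum>(g, f)\<in>?I \<times> ?I. string_kernel n m \<sigma> g f * string_kernel n m \<tau> g f))"
    by (subst sum.swap) (simp only: sum_distrib_left)
  also have "\<dots> = (\<Sum>\<sigma>\<in>?S. Wg N (n + m) \<sigma> * Omega N (n + m) (inv' \<sigma> \<circ> \<tau>))"
    using \<tau> by (intro sum.cong refl) (simp add: sum_string_kernel_mult)
  also have "\<dots> = of_bool (\<tau> = id)"
  proof -
    have "carrier (sym_group (n + m)) = ?S" by (auto simp: sym_group_carrier)
    then show ?thesis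
      using fun_cong[OF Wg_inverse(1)[OF N], of \<tau>] \<tau>
      by (simp add: group_algebra_simps sym_group_mult sym_group_one sym_group_carrier)
  qed
  finally show ?thesis .
qed

section \<open>Traceless columns\<close>

text \<open>
  The diagram with one bottom and one top string, both joining the positions \<open>i\<close> and \<open>-j\<close>, as an
  operator: it contracts the pair and inserts \<open>\<Sum>\<^sub>k e\<^sub>k \<otimes> e\<^sup>*\<^sub>k\<close> at the same place.
\<close>
definition loop_contract :: "nat \<Rightarrow> nat \<Rightarrow> nat \<Rightarrow> tensor \<Rightarrow> tensor" where
  "loop_contract N i j t g =
     (if g (int i) = g (- int j) then \<Sum>k<N. t (g(int i := k, - int j := k)) else 0)"

text \<open>
  The diagram is symmetric under reflection. On entries: the pairs of a multi-index with equal values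
  at the two positions and a new value \<open>k\<close> are permuted by exchanging the old value with \<open>k\<close>.
\<close>
lemma loop_contract_self_adjoint:
  assumes i: "i \<in> {1..n}" and j: "j \<in> {1..m}"
  shows "(\<Sum>g\<in>multi_indices N n m. loop_contract N i j u g * v g) =
    (\<Sum>g\<in>multi_indices N n m. u g * loop_contract N i j v g)"
proof -
  let ?I = "multi_indices N n m"
  let ?u = "\<lambda>g k. g(int i := k, - int j := k)"
  define A where "A = {g \<in> ?I. g (int i) = g (- int j)}"
  have fin: "finite A" by (simp add: A_def finite_multi_indices)
  have sumA: "(\<Sum>g\<in>?I. if g (int i) = g (- int j) then F g else 0) = (\<Sum>g\<in>A. F g)" for F :: "multi_index \<Rightarrow> complex"
    unfolding A_def by (simp add: sum.inter_filter finite_multi_indices)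
  have less: "g (int i) < N" if "g \<in> A" for g
  proof -
    have "g \<in> positions n m \<rightarrow>\<^sub>E {..<N}" using that by (simp add: A_def multi_indices_def)
    moreover have "int i \<in> positions n m" using i by (auto simp: positions_def)
    ultimately have "g (int i) \<in> {..<N}" by (rule PiE_mem)
    then show ?thesis by simp
  qed
  have upd: "?u g k \<in> A" if "g \<in> A" "k < N" for g k
    using that upd_in_multi_indices[OF _ i j, of g N k] i by (auto simp: A_def)
  have undo: "?u (?u g k) (g (int i)) = g" if "g \<in> A" for g k
    using that by (auto simp: A_def fun_eq_iff)
  have bij: "bij_betw (\<lambda>(g, k). (?u g k, g (int i))) (A \<times> {..<N}) (A \<times> {..<N})"
    by (rule bij_betwI[where g = "\<lambda>(g, k). (?u g k, g (int i))"])
      (use less upd undo i j in auto)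
  have "(\<Sum>g\<in>?I. loop_contract N i j u g * v g) = (\<Sum>(g, k)\<in>A \<times> {..<N}. u (?u g k) * v g)"
    using sumA[of "\<lambda>g. (\<Sum>k<N. u (?u g k)) * v g"]
    by (simp add: loop_contract_def sum_distrib_right sum.cartesian_product if_distrib[where f = "\<lambda>x. x * _"] cong: if_cong)
  also have "\<dots> = (\<Sum>x\<in>A \<times> {..<N}. (\<lambda>(g, k). u (?u g k) * v g) ((\<lambda>(g, k). (?u g k, g (int i))) x))"
    by (rule sum.reindex_bij_betw[OF bij, symmetric])
  also have "\<dots> = (\<Sum>(g, k)\<in>A \<times> {..<N}. u g * v (?u g k))"
    by (rule sum.cong[OF refl], clarify, simp only: prod.case undo)
  also have "\<dots> = (\<Sum>g\<in>?I. u g * loop_contract N i j v g)"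
    using sumA[of "\<lambda>g. u g * (\<Sum>k<N. v (?u g k))"]
    by (simp add: loop_contract_def sum_distrib_left sum.cartesian_product if_distrib[where f = "\<lambda>x. _ * x"] cong: if_cong)
  finally show ?thesis .
qed

text \<open>
  A diagram whose top row already joins \<open>i\<close> and \<open>-j\<close> only acquires a loop.
\<close>
lemma loop_contract_string_kernel_cup:
  assumes \<sigma>: "\<sigma> permutes {1..n+m}" and i: "i \<in> {1..n}" and j: "j \<in> {1..m}"
    and g: "g \<in> multi_indices N n m" and f: "f \<in> multi_indices N n m" and cup: "\<sigma> (n + j) = i"
  shows "loop_contract N i j (\<lambda>g. string_kernel n m \<sigma> g f) g = of_nat N * string_kernel n m \<sigma> g f"
proof -
  have "inv' \<sigma> i = n + j" using permutes_inverses(2)[OF \<sigma>] cup by metis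
  then show ?thesis
    using string_kernel_contract[OF \<sigma> i j g f] cup by (simp add: loop_contract_def)
qed

text \<open>
  Let \<open>Q\<close> be the matrix of \<open>\<theta>\<^sup>-\<^sup>1(Wg)\<close> and \<open>E\<close> the operator \<open>loop_contract\<close>. By \<open>string_kernel_contract\<close>
  the product \<open>E Q\<close> is a combination of diagrams with a top string from \<open>i\<close> to \<open>-j\<close>. For such a diagram
  \<open>D\<close>, which is not the identity, \<open>\<langle>E Q, D\<rangle> = \<langle>Q, E D\<rangle> = N \<langle>Q, D\<rangle> = 0\<close>. So \<open>E Q\<close> is orthogonal to
  itself.
\<close>
lemma loop_contract_weingarten_kernel:
  assumes N: "N \<ge> n + m" and i: "i \<in> {1..n}" and j: "j \<in> {1..m}"
    and g: "g \<in> multi_indices N n m" and f: "f \<in> multi_indices N n m"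
  shows "loop_contract N i j (\<lambda>g. weingarten_kernel N n m g f) g = 0"
proof -
  let ?I = "multi_indices N n m" and ?S = "{\<sigma>. \<sigma> permutes {1..n+m}}"
  let ?Q = "weingarten_kernel N n m"
  define E where "E g f = loop_contract N i j (\<lambda>g. ?Q g f) g" for g f
  \<comment> \<open>the diagrams in the expansion of \<open>E Q\<close> and their coefficients\<close>
  define r where "r \<sigma> = \<sigma> \<circ> transpose (n + j) (inv' \<sigma> i)" for \<sigma>
  define c where "c \<sigma> = Wg N (n + m) \<sigma> * (if \<sigma> (n + j) = i then of_nat N else 1)" for \<sigma>
  have r: "r \<sigma> permutes {1..n+m}" "r \<sigma> (n + j) = i" "r \<sigma> \<noteq> id" if \<sigma>: "\<sigma> permutes {1..n+m}" for \<sigma>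
  proof -
    have "inv' \<sigma> i \<in> {1..n+m}" using permutes_in_image[OF permutes_inv[OF \<sigma>], of i] i by auto
    then show "r \<sigma> permutes {1..n+m}"
      unfolding r_def using j by (intro permutes_compose[OF permutes_swap_id \<sigma>]) auto
    show ri: "r \<sigma> (n + j) = i" by (simp add: r_def permutes_inverses[OF \<sigma>])
    then show "r \<sigma> \<noteq> id" using i j by auto
  qed
  have E: "E g f = (\<Sum>\<sigma>\<in>?S. c \<sigma> * string_kernel n m (r \<sigma>) g f)" if g: "g \<in> ?I" and f: "f \<in> ?I" for g f
  proof -
    have "E g f = (\<Sum>\<sigma>\<in>?S. Wg N (n + m) \<sigma> * loop_contract N i j (\<lambda>g. string_kernel n m \<sigma> g f) g)"
      unfolding E_def loop_contract_def weingarten_kernel_def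
      by (subst sum.swap) (simp add: sum_distrib_left)
    also have "\<dots> = (\<Sum>\<sigma>\<in>?S. c \<sigma> * string_kernel n m (r \<sigma>) g f)"
      by (rule sum.cong) (simp_all only: mem_Collect_eq loop_contract_def
          string_kernel_contract[OF _ i j g f] c_def r_def mult.assoc)
    finally show ?thesis .
  qed
  have orth: "(\<Sum>f\<in>?I. \<Sum>g\<in>?I. E g f * string_kernel n m (r \<sigma>) g f) = 0" if \<sigma>: "\<sigma> \<in> ?S" for \<sigma>
  proof -
    have p: "r \<sigma> permutes {1..n+m}" "r \<sigma> (n + j) = i" "r \<sigma> \<noteq> id" using r \<sigma> by auto
    have "(\<Sum>f\<in>?I. \<Sum>g\<in>?I. E g f * string_kernel n m (r \<sigma>) g f) =
        (\<Sum>f\<in>?I. \<Sum>g\<in>?I. ?Q g f * (of_nat N * string_kernel n m (r \<sigma>) g f))"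
      unfolding E_def loop_contract_self_adjoint[OF i j]
      by (intro sum.cong refl arg_cong2[where f = "(*)"] loop_contract_string_kernel_cup[OF p(1) i j _ _ p(2)])
    also have "\<dots> = of_nat N * (\<Sum>g\<in>?I. \<Sum>f\<in>?I. ?Q g f * string_kernel n m (r \<sigma>) g f)"
      by (subst sum.swap) (simp add: sum_distrib_left algebra_simps)
    also have "\<dots> = 0" using sum_weingarten_string_kernel[OF N p(1)] p(3) by simp
    finally show ?thesis .
  qed
  have "(\<Sum>(g, f)\<in>?I \<times> ?I. E g f * cnj (E g f)) =
      (\<Sum>f\<in>?I. \<Sum>g\<in>?I. \<Sum>\<sigma>\<in>?S. cnj (c \<sigma>) * (E g f * string_kernel n m (r \<sigma>) g f))"
  proof -
    have "E g f * cnj (E g f) = (\<Sum>\<sigma>\<in>?S. cnj (c \<sigma>) * (E g f * string_kernel n m (r \<sigma>) g f))"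
      if "g \<in> ?I" "f \<in> ?I" for g f
    proof -
      have "cnj (E g f) = (\<Sum>\<sigma>\<in>?S. cnj (c \<sigma>) * string_kernel n m (r \<sigma>) g f)"
        by (simp add: E[OF that])
      then show ?thesis by (simp only: sum_distrib_left mult.left_commute)
    qed
    then have "(\<Sum>g\<in>?I. \<Sum>f\<in>?I. E g f * cnj (E g f)) =
        (\<Sum>g\<in>?I. \<Sum>f\<in>?I. \<Sum>\<sigma>\<in>?S. cnj (c \<sigma>) * (E g f * string_kernel n m (r \<sigma>) g f))"
      by (intro sum.cong refl) blast
    then show ?thesis unfolding sum.cartesian_product[symmetric] by (simp only:) (rule sum.swap)
  qed
  also have "\<dots> = (\<Sum>\<sigma>\<in>?S. cnj (c \<sigma>) * (\<Sum>f\<in>?I. \<Sum>g\<in>?I. E g f * string_kernel n m (r \<sigma>) g f))"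
  proof -
    have "(\<Sum>f\<in>?I. \<Sum>g\<in>?I. \<Sum>\<sigma>\<in>?S. cnj (c \<sigma>) * (E g f * string_kernel n m (r \<sigma>) g f)) =
        (\<Sum>f\<in>?I. \<Sum>\<sigma>\<in>?S. \<Sum>g\<in>?I. cnj (c \<sigma>) * (E g f * string_kernel n m (r \<sigma>) g f))"
      by (rule sum.cong[OF refl], rule sum.swap)
    also have "\<dots> = (\<Sum>\<sigma>\<in>?S. \<Sum>f\<in>?I. \<Sum>g\<in>?I. cnj (c \<sigma>) * (E g f * string_kernel n m (r \<sigma>) g f))"
      by (rule sum.swap)
    finally show ?thesis by (simp only: sum_distrib_left)
  qed
  also have "\<dots> = 0" using orth by simp
  finally have "(\<Sum>x\<in>?I \<times> ?I. (\<lambda>(g, f). E g f) x * cnj ((\<lambda>(g, f). E g f) x)) = 0"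
    by (simp add: case_prod_beta)
  from sum_mult_cnj_eq_0[OF _ this, of "(g, f)"] show ?thesis
    using g f finite_multi_indices by (simp add: E_def)
qed

lemma weingarten_kernel_column:
  assumes N: "N \<ge> n + m" "N \<ge> 1" and f: "f \<in> multi_indices N n m"
  shows "(\<lambda>g. of_bool (g \<in> multi_indices N n m) * weingarten_kernel N n m g f) \<in> traceless N n m"
proof -
  have "(\<Sum>k<N. weingarten_kernel N n m (g(int i := k, - int j := k)) f) = 0"
    if i: "i \<in> {1..n}" and j: "j \<in> {1..m}" and g: "g \<in> multi_indices N n m" for i j g
  proof -
    have "g(int i := 0, - int j := 0) \<in> multi_indices N n m"
      using upd_in_multi_indices[OF g i j] N by simp
    from loop_contract_weingarten_kernel[OF N(1) i j this f] i show ?thesis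
      by (simp add: loop_contract_def fun_upd_twist)
  qed
  then show ?thesis
    using N by (auto simp: traceless_iff tensors_def upd_in_multi_indices)
qed

text \<open>
  If \<open>D\<close> has a top string from \<open>i\<close> to \<open>-j\<close>, then \<open>N \<langle>D t, s\<rangle> = \<langle>E D t, s\<rangle> = \<langle>D t, E s\<rangle> = 0\<close> for every
  traceless \<open>s\<close>, where \<open>E\<close> is \<open>loop_contract\<close>. The projection annihilates the image of \<open>D\<close>.
\<close>
lemma proj_kernel_string_kernel_cup:
  assumes N: "N \<ge> 1" and \<sigma>: "\<sigma> permutes {1..n+m}" and i: "i \<in> {1..n}" and j: "j \<in> {1..m}"
    and f: "f \<in> multi_indices N n m" and cup: "\<sigma> (n + j) = i"
  shows "(\<Sum>h\<in>multi_indices N n m. proj_kernel N n m g h * string_kernel n m \<sigma> h f) = 0"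
proof -
  let ?I = "multi_indices N n m"
  define t where "t h = (if h \<in> ?I then string_kernel n m \<sigma> h f else 0)" for h
  have "(\<Sum>h\<in>?I. proj_kernel N n m g h * t h) = 0"
  proof (rule proj_kernel_orthogonal[OF N])
    show "t \<in> tensors N n m" by (simp add: t_def tensors_def)
    fix s assume s: "s \<in> traceless N n m"
    have "loop_contract N i j (\<lambda>h. cnj (s h)) h = 0" if "h \<in> ?I" for h
      using s i j that by (auto simp: loop_contract_def traceless_iff[OF N] simp flip: cnj_sum)
    then have "0 = (\<Sum>h\<in>?I. string_kernel n m \<sigma> h f * loop_contract N i j (\<lambda>h. cnj (s h)) h)"
      by simp
    also have "\<dots> = (\<Sum>h\<in>?I. of_nat N * string_kernel n m \<sigma> h f * cnj (s h))"
      unfolding loop_contract_self_adjoint[OF i j, symmetric]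
      by (intro sum.cong refl arg_cong2[where f = "(*)"] loop_contract_string_kernel_cup[OF \<sigma> i j _ f cup])
    also have "\<dots> = of_nat N * tensor_inner N n m t s"
      by (simp add: tensor_inner_def t_def sum_distrib_left mult.assoc)
    finally show "tensor_inner N n m t s = 0" using N by simp
  qed
  then show ?thesis by (simp add: t_def)
qed

text \<open>
  The candidate for the inverse of \<open>\<Omega>\<^sub>n\<^sub>,\<^sub>m\<close>.
\<close>
definition Wg2 :: "nat \<Rightarrow> nat \<Rightarrow> nat \<Rightarrow> (nat \<Rightarrow> nat) \<times> (nat \<Rightarrow> nat) \<Rightarrow> complex" where
  "Wg2 N n m \<sigma> = (if \<sigma> \<in> carrier (sym_group2 n m) then Wg N (n + m) (sym_embed n m \<sigma>) else 0)"

text \<open>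
  Write \<open>P\<close> for the projection and \<open>Q\<close> for the matrix of \<open>\<theta>\<^sup>-\<^sup>1(Wg)\<close>. The columns of \<open>Q\<close> are traceless,
  so \<open>Q = P Q\<close>. Expanding the right-hand side into diagrams, \<open>P\<close> annihilates those with a horizontal
  string, and \<open>Q = P \<rho>(w)\<close> remains, with \<open>w\<close> the restriction of \<open>Wg\<close> to \<open>S\<^sub>n \<times> S\<^sub>m\<close>.
\<close>
lemma weingarten_kernel_eq_proj:
  assumes N: "N \<ge> n + m" "N \<ge> 1" and g: "g \<in> multi_indices N n m" and f: "f \<in> multi_indices N n m"
  shows "weingarten_kernel N n m g f = (\<Sum>\<sigma>\<in>carrier (sym_group2 n m).
    Wg2 N n m \<sigma> * proj_kernel N n m g (f \<circ> signed_perm (inv\<^bsub>sym_group2 n m\<^esub> \<sigma>)))"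
proof -
  let ?I = "multi_indices N n m" and ?S = "{\<sigma>. \<sigma> permutes {1..n+m}}" and ?G = "carrier (sym_group2 n m)"
  let ?P = "proj_kernel N n m"
  have "weingarten_kernel N n m g f =
      (\<Sum>h\<in>?I. ?P g h * (of_bool (h \<in> ?I) * weingarten_kernel N n m h f))"
    using proj_kernel_traceless[OF N(2) weingarten_kernel_column[OF N f], of g] g by simp
  also have "\<dots> = (\<Sum>h\<in>?I. \<Sum>\<sigma>\<in>?S. Wg N (n + m) \<sigma> * (?P g h * string_kernel n m \<sigma> h f))"
    by (rule sum.cong) (simp_all add: weingarten_kernel_def sum_distrib_left mult.left_commute)
  also have "\<dots> = (\<Sum>\<sigma>\<in>?S. Wg N (n + m) \<sigma> * (\<Sum>h\<in>?I. ?P g h * string_kernel n m \<sigma> h f))"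
    by (subst sum.swap) (simp only: sum_distrib_left)
  also have "\<dots> = (\<Sum>\<sigma>\<in>{\<sigma>. \<sigma> permutes {1..n+m} \<and> (\<forall>j\<in>{1..m}. n < \<sigma> (n + j))}.
      Wg N (n + m) \<sigma> * (\<Sum>h\<in>?I. ?P g h * string_kernel n m \<sigma> h f))"
  proof (rule sum.mono_neutral_right)
    show "\<forall>\<sigma>\<in>?S - {\<sigma>. \<sigma> permutes {1..n+m} \<and> (\<forall>j\<in>{1..m}. n < \<sigma> (n + j))}.
        Wg N (n + m) \<sigma> * (\<Sum>h\<in>?I. ?P g h * string_kernel n m \<sigma> h f) = 0"
    proof
      fix \<sigma> assume "\<sigma> \<in> ?S - {\<sigma>. \<sigma> permutes {1..n+m} \<and> (\<forall>j\<in>{1..m}. n < \<sigma> (n + j))}"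
      then obtain j where \<sigma>: "\<sigma> permutes {1..n+m}" and j: "j \<in> {1..m}" "\<not> n < \<sigma> (n + j)" by blast
      then have "\<sigma> (n + j) \<in> {1..n}" using permutes_le[OF \<sigma>, of "n + j"] by auto
      from proj_kernel_string_kernel_cup[OF N(2) \<sigma> this j(1) f refl]
      show "Wg N (n + m) \<sigma> * (\<Sum>h\<in>?I. ?P g h * string_kernel n m \<sigma> h f) = 0" by simp
    qed
  qed (auto simp: finite_permutations)
  also have "\<dots> = (\<Sum>\<sigma>\<in>?G. Wg N (n + m) (bent_perm n m \<sigma>) *
      (\<Sum>h\<in>?I. ?P g h * string_kernel n m (bent_perm n m \<sigma>) h f))"
    by (rule sum.reindex_bij_betw[OF bij_betw_bent_perm, symmetric])
  also have "\<dots> = (\<Sum>\<sigma>\<in>?G. Wg2 N n m \<sigma> * ?P g (f \<circ> signed_perm (inv\<^bsub>sym_group2 n m\<^esub> \<sigma>)))"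
  proof (rule sum.cong[OF refl])
    fix \<sigma> assume \<sigma>: "\<sigma> \<in> ?G"
    interpret G: group "sym_group2 n m" by (rule group_sym_group2)
    let ?f = "f \<circ> signed_perm (inv\<^bsub>sym_group2 n m\<^esub> \<sigma>)"
    have iff: "f = h \<circ> signed_perm \<sigma> \<longleftrightarrow> h = ?f" for h
      by (auto simp: comp_assoc signed_perm_inv[OF \<sigma>])
    have "(\<Sum>h\<in>?I. ?P g h * string_kernel n m (bent_perm n m \<sigma>) h f) = (\<Sum>h\<in>?I. if h = ?f then ?P g h else 0)"
      by (rule sum.cong[OF refl]) (simp only: string_kernel_bent_perm[OF \<sigma> _ f] iff, simp)
    also have "\<dots> = ?P g ?f"
      using comp_signed_perm_in_multi_indices[OF G.inv_closed[OF \<sigma>] f] by (simp add: sum.delta finite_multi_indices)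
    finally show "Wg N (n + m) (bent_perm n m \<sigma>) * (\<Sum>h\<in>?I. ?P g h * string_kernel n m (bent_perm n m \<sigma>) h f)
      = Wg2 N n m \<sigma> * ?P g ?f"
      using Wg_bent_perm[OF N(1) \<sigma>] \<sigma> by (simp add: Wg2_def)
  qed
  finally show ?thesis .
qed

section \<open>Characters of the traceless tensors\<close>

text \<open>
  The trace of \<open>\<rho>(\<sigma>) P\<close>, that is, of \<open>\<rho>(\<sigma>)\<close> on the traceless tensors.
\<close>
definition traceless_character :: "nat \<Rightarrow> nat \<Rightarrow> nat \<Rightarrow> (nat \<Rightarrow> nat) \<times> (nat \<Rightarrow> nat) \<Rightarrow> complex" where
  "traceless_character N n m \<sigma> = (\<Sum>f\<in>multi_indices N n m. proj_kernel N n m (f \<circ> signed_perm \<sigma>) f)"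

lemma trace_on_sym_act:
  assumes N: "N \<ge> 1" and fin: "finite S" and S: "S \<subseteq> carrier (sym_group2 n m)"
    and A: "\<And>t f. t \<in> traceless N n m \<Longrightarrow> A t f = (\<Sum>\<tau>\<in>S. c \<tau> * t (f \<circ> signed_perm \<tau>))"
  shows "trace_on (traceless N n m) A = (\<Sum>\<tau>\<in>S. c \<tau> * traceless_character N n m \<tau>)"
proof -
  let ?I = "multi_indices N n m"
  have "trace_on (traceless N n m) A = (\<Sum>f\<in>?I. \<Sum>\<tau>\<in>S. c \<tau> * proj_kernel N n m (f \<circ> signed_perm \<tau>) f)"
  proof (rule trace_on_eq_sum_diagonal[OF finite_multi_indices subspace_traceless[OF N],
        where K = "\<lambda>g f. \<Sum>\<tau>\<in>S. c \<tau> * proj_kernel N n m (g \<circ> signed_perm \<tau>) f"])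
    show "(\<lambda>g. \<Sum>\<tau>\<in>S. c \<tau> * proj_kernel N n m (g \<circ> signed_perm \<tau>) f) \<in> traceless N n m" if "f \<in> ?I" for f
    proof -
      have "(\<lambda>g. \<Sum>\<tau>\<in>S. c \<tau> * proj_kernel N n m (g \<circ> signed_perm \<tau>) f) =
          (\<Sum>\<tau>\<in>S. tensor_scale (c \<tau>) (perm_act \<tau> (\<lambda>g. proj_kernel N n m g f)))"
        by (simp add: fun_eq_iff sum_fun_apply tensor_scale_def perm_act_def)
      also have "\<dots> \<in> traceless N n m"
        using subspace_traceless[OF N] S that
        by (intro tensor.subspace_sum tensor.subspace_scale perm_act_traceless[OF N] proj_kernel_column(1)[OF N]) auto
      finally show ?thesis .
    qed
    show "A t g = (\<Sum>f\<in>?I. (\<Sum>\<tau>\<in>S. c \<tau> * proj_kernel N n m (g \<circ> signed_perm \<tau>) f) * t f)"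
      if t: "t \<in> traceless N n m" for t g
    proof -
      have "A t g = (\<Sum>\<tau>\<in>S. c \<tau> * (\<Sum>f\<in>?I. proj_kernel N n m (g \<circ> signed_perm \<tau>) f * t f))"
        unfolding A[OF t]
        by (intro sum.cong refl arg_cong2[where f = "(*)"] proj_kernel_traceless[OF N t, symmetric])
      then show ?thesis
        by (simp add: sum_distrib_left sum_distrib_right mult.assoc) (rule sum.swap)
    qed
  qed (rule traceless_supported)
  also have "\<dots> = (\<Sum>\<tau>\<in>S. c \<tau> * traceless_character N n m \<tau>)"
    by (subst sum.swap) (simp only: traceless_character_def sum_distrib_left)
  finally show ?thesis .
qed

lemma traceless_character_commute:
  assumes N: "N \<ge> 1" and \<sigma>: "\<sigma> \<in> carrier (sym_group2 n m)" and \<tau>: "\<tau> \<in> carrier (sym_group2 n m)"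
  shows "traceless_character N n m (\<sigma> \<otimes>\<^bsub>sym_group2 n m\<^esub> \<tau>) = traceless_character N n m (\<tau> \<otimes>\<^bsub>sym_group2 n m\<^esub> \<sigma>)"
proof -
  let ?I = "multi_indices N n m" and ?P = "proj_kernel N n m"
  have "traceless_character N n m (\<tau> \<otimes>\<^bsub>sym_group2 n m\<^esub> \<sigma>) =
      (\<Sum>h\<in>?I. ?P ((h \<circ> signed_perm \<sigma>) \<circ> signed_perm \<tau> \<circ> signed_perm \<sigma>) (h \<circ> signed_perm \<sigma>))"
    unfolding traceless_character_def signed_perm_mult[OF \<tau> \<sigma>] comp_assoc[symmetric]
    by (rule sum.reindex_bij_betw[OF bij_betw_comp_signed_perm[OF \<sigma>], symmetric])
  also have "\<dots> = traceless_character N n m (\<sigma> \<otimes>\<^bsub>sym_group2 n m\<^esub> \<tau>)"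
    unfolding traceless_character_def signed_perm_mult[OF \<sigma> \<tau>] comp_assoc[symmetric]
    by (rule sum.cong) (simp_all only: proj_kernel_equivariant[OF N \<sigma>])
  finally show ?thesis by simp
qed

lemma Omega2_eq_character:
  assumes N: "N \<ge> 1" and \<sigma>: "\<sigma> \<in> carrier (sym_group2 n m)"
  shows "Omega2 N n m \<sigma> = traceless_character N n m (inv\<^bsub>sym_group2 n m\<^esub> \<sigma>)"
proof -
  interpret G: group "sym_group2 n m" by (rule group_sym_group2)
  let ?s = "inv\<^bsub>sym_group2 n m\<^esub> \<sigma>"
  have "trace_on (traceless N n m) (perm_act ?s) =
      (\<Sum>\<tau>\<in>{?s}. 1 * traceless_character N n m \<tau>)"
    by (rule trace_on_sym_act[OF N]) (use G.inv_closed[OF \<sigma>] in \<open>simp_all add: perm_act_def del: carrier_DirProd\<close>)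
  then show ?thesis using \<sigma> by (simp add: Omega2_def)
qed

lemma central_Omega2:
  assumes N: "N \<ge> 1"
  shows "central_in (group_algebra (sym_group2 n m)) (Omega2 N n m)"
proof -
  interpret G: group "sym_group2 n m" by (rule group_sym_group2)
  have "Omega2 N n m (x \<otimes>\<^bsub>sym_group2 n m\<^esub> y) = Omega2 N n m (y \<otimes>\<^bsub>sym_group2 n m\<^esub> x)"
    if "x \<in> carrier (sym_group2 n m)" "y \<in> carrier (sym_group2 n m)" for x y
    using that by (simp only: Omega2_eq_character[OF N] G.m_closed G.inv_mult_group
        traceless_character_commute[OF N G.inv_closed G.inv_closed])
  moreover have "Omega2 N n m \<in> carrier (group_algebra (sym_group2 n m))"
    unfolding group_algebra_simps Omega2_def by simp
  ultimately show ?thesis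
    unfolding G.central_in_group_algebra_iff[OF finite_sym_group2] by blast
qed

text \<open>
  Take the pairing of \<open>Q = P \<rho>(w)\<close> with \<open>\<rho>(\<tau>)\<close>. The left-hand side is 1 or 0 according to whether
  \<open>\<tau>\<close> is the identity, and the right-hand side is \<open>\<Sum>\<^sub>\<sigma> w(\<sigma>) Tr(P \<rho>(\<sigma> \<tau>\<^sup>-\<^sup>1))\<close>, the convolution
  of \<open>w\<close> with \<open>\<Omega>\<^sub>n\<^sub>,\<^sub>m\<close>.
\<close>
lemma Wg2_mult_Omega2:
  assumes N: "N \<ge> n + m" "N \<ge> 1"
  shows "Wg2 N n m \<otimes>\<^bsub>group_algebra (sym_group2 n m)\<^esub> Omega2 N n m = \<one>\<^bsub>group_algebra (sym_group2 n m)\<^esub>"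
proof -
  interpret G: group "sym_group2 n m" by (rule group_sym_group2)
  let ?I = "multi_indices N n m" and ?G = "carrier (sym_group2 n m)" and ?P = "proj_kernel N n m"
  let ?m = "\<lambda>x y. x \<otimes>\<^bsub>sym_group2 n m\<^esub> y" and ?i = "\<lambda>x. inv\<^bsub>sym_group2 n m\<^esub> x"
  have "(\<Sum>\<sigma>\<in>?G. Wg2 N n m \<sigma> * Omega2 N n m (?m (?i \<sigma>) \<tau>)) = of_bool (\<tau> = \<one>\<^bsub>sym_group2 n m\<^esub>)"
    if \<tau>: "\<tau> \<in> ?G" for \<tau>
  proof -
    have bent: "bent_perm n m \<tau> permutes {1..n+m}" 
      using bij_betw_bent_perm[of n m, THEN bij_betwE] \<tau> by blast
    have "(\<Sum>g\<in>?I. weingarten_kernel N n m g (g \<circ> signed_perm \<tau>)) =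
        (\<Sum>g\<in>?I. \<Sum>f\<in>?I. weingarten_kernel N n m g f * string_kernel n m (bent_perm n m \<tau>) g f)"
    proof (rule sum.cong[OF refl])
      fix g assume g: "g \<in> ?I"
      have "(\<Sum>f\<in>?I. weingarten_kernel N n m g f * string_kernel n m (bent_perm n m \<tau>) g f) =
          (\<Sum>f\<in>?I. if f = g \<circ> signed_perm \<tau> then weingarten_kernel N n m g f else 0)"
        by (rule sum.cong[OF refl]) (simp only: string_kernel_bent_perm[OF \<tau> g], simp)
      then show "weingarten_kernel N n m g (g \<circ> signed_perm \<tau>) =
          (\<Sum>f\<in>?I. weingarten_kernel N n m g f * string_kernel n m (bent_perm n m \<tau>) g f)"
        using comp_signed_perm_in_multi_indices[OF \<tau> g] by (simp add: sum.delta finite_multi_indices)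
    qed
    also have "\<dots> = of_bool (bent_perm n m \<tau> = id)"
      by (rule sum_weingarten_string_kernel[OF N(1) bent])
    also have "bent_perm n m \<tau> = id \<longleftrightarrow> \<tau> = \<one>\<^bsub>sym_group2 n m\<^esub>"
    proof -
      have "bent_perm n m \<one>\<^bsub>sym_group2 n m\<^esub> = id"
        by (auto simp: bent_perm_def sym_embed_def sym_group_one fun_eq_iff)
      then show ?thesis
        using bij_betw_imp_inj_on[OF bij_betw_bent_perm] \<tau> G.one_closed by (metis inj_onD)
    qed
    finally have 1: "(\<Sum>g\<in>?I. weingarten_kernel N n m g (g \<circ> signed_perm \<tau>)) = of_bool (\<tau> = \<one>\<^bsub>sym_group2 n m\<^esub>)" .
    have "(\<Sum>g\<in>?I. weingarten_kernel N n m g (g \<circ> signed_perm \<tau>)) =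
        (\<Sum>g\<in>?I. \<Sum>\<sigma>\<in>?G. Wg2 N n m \<sigma> * ?P g (g \<circ> signed_perm \<tau> \<circ> signed_perm (?i \<sigma>)))"
      by (intro sum.cong refl weingarten_kernel_eq_proj[OF N] comp_signed_perm_in_multi_indices[OF \<tau>])
    also have "\<dots> = (\<Sum>\<sigma>\<in>?G. Wg2 N n m \<sigma> * (\<Sum>g\<in>?I. ?P g (g \<circ> signed_perm \<tau> \<circ> signed_perm (?i \<sigma>))))"
      by (subst sum.swap) (simp only: sum_distrib_left)
    also have "\<dots> = (\<Sum>\<sigma>\<in>?G. Wg2 N n m \<sigma> * Omega2 N n m (?m (?i \<sigma>) \<tau>))"
    proof (rule sum.cong[OF refl])
      fix \<sigma> assume \<sigma>: "\<sigma> \<in> ?G"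
      let ?\<mu> = "?m \<tau> (?i \<sigma>)"
      have \<mu>: "?\<mu> \<in> ?G" using \<sigma> \<tau> by (intro G.m_closed G.inv_closed)
      have "(\<Sum>g\<in>?I. ?P g (g \<circ> signed_perm \<tau> \<circ> signed_perm (?i \<sigma>))) = (\<Sum>g\<in>?I. ?P g (g \<circ> signed_perm ?\<mu>))"
        using \<sigma> \<tau> by (simp only: signed_perm_mult G.inv_closed comp_assoc)
      also have "\<dots> = (\<Sum>g\<in>?I. ?P (g \<circ> signed_perm (?i ?\<mu>)) (g \<circ> signed_perm (?i ?\<mu>) \<circ> signed_perm ?\<mu>))"
        by (rule sum.reindex_bij_betw[OF bij_betw_comp_signed_perm[OF G.inv_closed[OF \<mu>]], symmetric])
      also have "\<dots> = traceless_character N n m (?i ?\<mu>)"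
        by (simp add: traceless_character_def comp_assoc signed_perm_inv[OF \<mu>])
      also have "\<dots> = Omega2 N n m ?\<mu>" by (rule Omega2_eq_character[OF N(2) \<mu>, symmetric])
      also have "\<dots> = Omega2 N n m (?m (?i \<sigma>) \<tau>)"
        using central_Omega2[OF N(2), of n m] \<tau> G.inv_closed[OF \<sigma>]
        unfolding G.central_in_group_algebra_iff[OF finite_sym_group2] by blast
      finally show "Wg2 N n m \<sigma> * (\<Sum>g\<in>?I. ?P g (g \<circ> signed_perm \<tau> \<circ> signed_perm (?i \<sigma>))) =
        Wg2 N n m \<sigma> * Omega2 N n m (?m (?i \<sigma>) \<tau>)" by simp
    qed
    finally show ?thesis using 1 by simp
  qed
  note sum = this
  show ?thesis
    unfolding group_algebra_simps
  proof
    fix \<tau>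
    show "(if \<tau> \<in> ?G then \<Sum>\<sigma>\<in>?G. Wg2 N n m \<sigma> * Omega2 N n m (?m (?i \<sigma>) \<tau>) else 0) =
      (if \<tau> = \<one>\<^bsub>sym_group2 n m\<^esub> then 1 else 0)"
    proof (cases "\<tau> \<in> ?G")
      case True
      then show ?thesis by (simp only: sum if_True of_bool_def)
    next
      case False
      then have "\<tau> \<noteq> \<one>\<^bsub>sym_group2 n m\<^esub>" using G.one_closed by metis
      with False show ?thesis by (simp only: if_False)
    qed
  qed
qed

text \<open>
  \<open>Tr(T \<rho>(\<sigma>\<^sup>-\<^sup>1)) = \<Sum>\<^sub>\<tau> \<kappa>(\<tau>) Tr(\<rho>(\<tau> \<sigma>\<^sup>-\<^sup>1))\<close>, with traces over the traceless tensors.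
\<close>
lemma moment_eq_mult:
  assumes N: "N \<ge> 1" and \<kappa>: "\<kappa> \<in> carrier (group_algebra (sym_group2 n m))"
    and T: "\<And>t. t \<in> traceless N n m \<Longrightarrow> T t = sym_act n m \<kappa> t"
  shows "moment N n m T = \<kappa> \<otimes>\<^bsub>group_algebra (sym_group2 n m)\<^esub> Omega2 N n m"
proof -
  interpret G: group "sym_group2 n m" by (rule group_sym_group2)
  let ?G = "carrier (sym_group2 n m)"
  let ?m = "\<lambda>x y. x \<otimes>\<^bsub>sym_group2 n m\<^esub> y" and ?i = "\<lambda>x. inv\<^bsub>sym_group2 n m\<^esub> x"
  have "trace_on (traceless N n m) (T \<circ> perm_act (?i \<sigma>)) = (\<Sum>\<tau>\<in>?G. \<kappa> \<tau> * Omega2 N n m (?m (?i \<tau>) \<sigma>))"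
    if \<sigma>: "\<sigma> \<in> ?G" for \<sigma>
  proof -
    have bij: "bij_betw (\<lambda>\<tau>. ?m \<tau> (?i \<sigma>)) ?G ?G"
      by (rule bij_betwI[where g = "\<lambda>\<tau>. ?m \<tau> \<sigma>"]) (use \<sigma> in \<open>auto simp: G.m_assoc simp del: carrier_DirProd one_DirProd mult_DirProd\<close>)
    have "trace_on (traceless N n m) (T \<circ> perm_act (?i \<sigma>)) =
        (\<Sum>\<mu>\<in>?G. \<kappa> (?m \<mu> \<sigma>) * traceless_character N n m \<mu>)"
    proof (rule trace_on_sym_act[OF N finite_sym_group2 subset_refl])
      fix t f assume t: "t \<in> traceless N n m"
      have "(T \<circ> perm_act (?i \<sigma>)) t f = (\<Sum>\<tau>\<in>?G. \<kappa> \<tau> * t (f \<circ> signed_perm \<tau> \<circ> signed_perm (?i \<sigma>)))"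
        using T[OF perm_act_traceless[OF N G.inv_closed[OF \<sigma>] t]] by (simp add: sym_act_def perm_act_def)
      also have "\<dots> = (\<Sum>\<tau>\<in>?G. \<kappa> (?m (?m \<tau> (?i \<sigma>)) \<sigma>) * t (f \<circ> signed_perm (?m \<tau> (?i \<sigma>))))"
        by (rule sum.cong[OF refl])
          (use \<sigma> in \<open>simp only: G.m_assoc G.inv_closed G.l_inv G.r_one signed_perm_mult comp_assoc\<close>)
      also have "\<dots> = (\<Sum>\<mu>\<in>?G. \<kappa> (?m \<mu> \<sigma>) * t (f \<circ> signed_perm \<mu>))"
        by (rule sum.reindex_bij_betw[OF bij])
      finally show "(T \<circ> perm_act (?i \<sigma>)) t f = (\<Sum>\<mu>\<in>?G. \<kappa> (?m \<mu> \<sigma>) * t (f \<circ> signed_perm \<mu>))" .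
    qed
    also have "\<dots> = (\<Sum>\<tau>\<in>?G. \<kappa> (?m (?m \<tau> (?i \<sigma>)) \<sigma>) * traceless_character N n m (?m \<tau> (?i \<sigma>)))"
      by (rule sum.reindex_bij_betw[OF bij, symmetric])
    also have "\<dots> = (\<Sum>\<tau>\<in>?G. \<kappa> \<tau> * Omega2 N n m (?m (?i \<tau>) \<sigma>))"
    proof (rule sum.cong[OF refl])
      fix \<tau> assume \<tau>: "\<tau> \<in> ?G"
      have "Omega2 N n m (?m (?i \<tau>) \<sigma>) = traceless_character N n m (?m (?i \<sigma>) \<tau>)"
        using \<sigma> \<tau> by (simp only: Omega2_eq_character[OF N] G.m_closed G.inv_closed G.inv_mult_group G.inv_inv)
      also have "\<dots> = traceless_character N n m (?m \<tau> (?i \<sigma>))"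
        by (rule traceless_character_commute[OF N G.inv_closed[OF \<sigma>] \<tau>])
      finally show "\<kappa> (?m (?m \<tau> (?i \<sigma>)) \<sigma>) * traceless_character N n m (?m \<tau> (?i \<sigma>)) =
          \<kappa> \<tau> * Omega2 N n m (?m (?i \<tau>) \<sigma>)"
        using \<sigma> \<tau> by (simp only: G.m_assoc G.inv_closed G.l_inv G.r_one)
    qed
    finally show ?thesis .
  qed
  then show ?thesis unfolding moment_def group_algebra_simps by (simp add: fun_eq_iff del: carrier_DirProd)
qed

section \<open>Walled Brauer diagrams and permutations\<close>

text \<open>
  The vertex at point \<open>a\<close> and row \<open>\<eta>\<close> after the exchange of rows, in the coordinates of the original
  diagram.
\<close>
definition slot :: "nat \<Rightarrow> nat \<Rightarrow> int \<Rightarrow> vertex" where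
  "slot n a \<eta> = flip_negative (point_position n a, \<eta>)"

text \<open>
  The row of a vertex after the exchange of rows: strings of a diagram join vertices of opposite
  orientation.
\<close>
definition orientation :: "vertex \<Rightarrow> int" where
  "orientation = (\<lambda>(v, \<eta>). sgn v * \<eta>)"

definition vertex_label :: "multi_index \<Rightarrow> multi_index \<Rightarrow> vertex \<Rightarrow> nat" where
  "vertex_label g f = (\<lambda>(v, \<eta>). if \<eta> = 1 then g v else f v)"

text \<open>
  The diagram \<open>\<theta>\<^sup>-\<^sup>1(\<sigma>)\<close>.
\<close>
definition diagram_of :: "nat \<Rightarrow> nat \<Rightarrow> (nat \<Rightarrow> nat) \<Rightarrow> diagram" where
  "diagram_of n m \<sigma> = (\<lambda>a. {slot n a (- 1), slot n (\<sigma> a) 1}) ` {1..n+m}"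

lemma strings_agree_iff:
  "strings_agree \<pi> g f \<longleftrightarrow> (\<forall>e\<in>\<pi>. \<forall>x\<in>e. \<forall>y\<in>e. vertex_label g f x = vertex_label g f y)"
  by (simp add: strings_agree_def vertex_label_def case_prod_beta)

lemma diagrams_iff:
  "\<pi> \<in> diagrams n m \<longleftrightarrow> partition_on (positions n m \<times> {-1, 1 :: int}) \<pi> \<and> (\<forall>e\<in>\<pi>. card e = 2) \<and>
    (\<forall>e\<in>\<pi>. \<forall>x\<in>e. \<forall>y\<in>e. x \<noteq> y \<longrightarrow> orientation y = - orientation x)"
  by (simp add: diagrams_def orientation_def case_prod_beta prod_eq_iff)

lemma diagrams_edge:
  assumes "\<pi> \<in> diagrams n m" "e \<in> \<pi>" "x \<in> e"
  obtains y where "e = {x, y}" "x \<noteq> y" "y \<in> positions n m \<times> {-1, 1 :: int}" "orientation y = - orientation x"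
proof -
  have "card e = 2" using assms by (simp add: diagrams_iff)
  then obtain y where y: "e = {x, y}" "x \<noteq> y" using assms(3) by (auto simp: card_2_iff)
  moreover have "y \<in> positions n m \<times> {-1, 1 :: int}"
    using assms(1,2) y by (auto simp: diagrams_iff dest!: partition_onD1)
  ultimately show ?thesis using that assms by (auto simp: diagrams_iff)
qed

lemma diagrams_disjoint:
  assumes "\<pi> \<in> diagrams n m" "e \<in> \<pi>" "e' \<in> \<pi>" "x \<in> e" "x \<in> e'"
  shows "e = e'"
  using assms by (auto simp: diagrams_iff dest!: partition_onD2 dest: disjointD)

lemma orientation_slot: "a \<in> {1..n+m} \<Longrightarrow> orientation (slot n a \<eta>) = \<eta>"
  by (auto simp: orientation_def slot_def flip_negative_def point_position_def sgn_if)

lemma slot_eq_iff: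
  assumes "a \<in> {1..n+m}" "b \<in> {1..n+m}"
  shows "slot n a \<eta> = slot n b \<eta>' \<longleftrightarrow> a = b \<and> \<eta> = \<eta>'"
proof
  assume eq: "slot n a \<eta> = slot n b \<eta>'"
  then have "point_position n a = point_position n b"
    by (auto simp: slot_def flip_negative_def split: if_splits)
  then have "a = b" using assms point_position_bij[of n m] by (metis bij_betw_imp_inj_on inj_onD)
  moreover have "\<eta> = \<eta>'" using orientation_slot[OF assms(1), of \<eta>] orientation_slot[OF assms(2), of \<eta>'] eq by simp
  ultimately show "a = b \<and> \<eta> = \<eta>'" ..
qed simp

lemma slot_in: "a \<in> {1..n+m} \<Longrightarrow> \<eta> \<in> {-1, 1 :: int} \<Longrightarrow> slot n a \<eta> \<in> positions n m \<times> {-1, 1 :: int}"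
  using bij_betwE[OF point_position_bij[of n m]] by (auto simp: slot_def flip_negative_def)

lemma slot_surj:
  assumes "x \<in> positions n m \<times> {-1, 1 :: int}"
  obtains a where "a \<in> {1..n+m}" "x = slot n a (orientation x)" "orientation x \<in> {-1, 1 :: int}"
proof -
  obtain v \<eta> where x: "x = (v, \<eta>)" "v \<in> positions n m" "\<eta> \<in> {-1, 1 :: int}" using assms by auto
  obtain a where a: "a \<in> {1..n+m}" "point_position n a = v"
    using x(2) bij_betw_imp_surj_on[OF point_position_bij[of n m]] by (metis imageE)
  have "v \<noteq> 0" using x(2) by (auto simp: positions_def)
  then have "x = slot n a (orientation x)" "orientation x \<in> {-1, 1 :: int}"
    using x a by (auto simp: slot_def flip_negative_def orientation_def sgn_if)
  with a(1) show ?thesis by (rule that)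
qed

lemma vertex_label_slot:
  assumes "a \<in> {1..n+m}"
  shows "vertex_label g f (slot n a (- 1)) = mixed_labels n f g a"
    "vertex_label g f (slot n a 1) = mixed_labels n g f a"
  using assms by (auto simp: vertex_label_def slot_def flip_negative_def mixed_labels_def point_position_def)

lemma diagram_of_in_diagrams:
  assumes \<sigma>: "\<sigma> permutes {1..n+m}" shows "diagram_of n m \<sigma> \<in> diagrams n m"
proof -
  let ?K = "{1..n+m}"
  have \<sigma>K: "\<sigma> a \<in> ?K \<longleftrightarrow> a \<in> ?K" for a by (rule permutes_in_image[OF \<sigma>])
  have "partition_on (positions n m \<times> {-1, 1 :: int}) (diagram_of n m \<sigma>)"
  proof (rule partition_onI)
    show "\<Union> (diagram_of n m \<sigma>) = positions n m \<times> {-1, 1 :: int}"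
    proof (intro equalityI subsetI)
      fix x assume "x \<in> \<Union> (diagram_of n m \<sigma>)"
      then show "x \<in> positions n m \<times> {-1, 1 :: int}"
        using slot_in[of _ n m] \<sigma>K unfolding diagram_of_def by blast
    next
      fix x assume "x \<in> positions n m \<times> {-1, 1 :: int}"
      then obtain a where a: "a \<in> ?K" "x = slot n a (orientation x)" "orientation x \<in> {-1, 1 :: int}"
        by (rule slot_surj)
      have "\<sigma> (inv' \<sigma> a) = a" by (simp add: permutes_inverses[OF \<sigma>])
      moreover have i: "inv' \<sigma> a \<in> ?K" using a(1) permutes_in_image[OF permutes_inv[OF \<sigma>]] by blast
      moreover have "x = slot n a (- 1) \<or> x = slot n a 1" using a(2,3) by auto
      ultimately have "x \<in> {slot n a (- 1), slot n (\<sigma> a) 1} \<or>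
          x \<in> {slot n (inv' \<sigma> a) (- 1), slot n (\<sigma> (inv' \<sigma> a)) 1}" by auto
      with a(1) i have "\<exists>b\<in>?K. x \<in> {slot n b (- 1), slot n (\<sigma> b) 1}" by blast
      then show "x \<in> \<Union> (diagram_of n m \<sigma>)" by (simp only: diagram_of_def UN_iff)
    qed
    fix p q assume pq: "p \<in> diagram_of n m \<sigma>" "q \<in> diagram_of n m \<sigma>" "p \<noteq> q"
    obtain a where a: "a \<in> ?K" "p = {slot n a (- 1), slot n (\<sigma> a) 1}"
      using pq(1) unfolding diagram_of_def by blast
    obtain b where b: "b \<in> ?K" "q = {slot n b (- 1), slot n (\<sigma> b) 1}"
      using pq(2) unfolding diagram_of_def by blast
    have "a \<noteq> b" using a(2) b(2) pq(3) by blast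
    note ab = a(1) b(1) a(2) b(2) this
    have "\<sigma> a \<noteq> \<sigma> b" using \<open>a \<noteq> b\<close> permutes_inj[OF \<sigma>] by (metis injD)
    with ab(5) show "disjnt p q"
      unfolding ab(3,4) using ab(1,2) \<sigma>K by (simp add: disjnt_def slot_eq_iff[of _ n m])
  qed (auto simp: diagram_of_def)
  moreover have "card e = 2 \<and> (\<forall>x\<in>e. \<forall>y\<in>e. x \<noteq> y \<longrightarrow> orientation y = - orientation x)"
    if "e \<in> diagram_of n m \<sigma>" for e
  proof -
    obtain a where a: "a \<in> ?K" "e = {slot n a (- 1), slot n (\<sigma> a) 1}"
      using \<open>e \<in> _\<close> by (auto simp: diagram_of_def)
    then have \<sigma>a: "\<sigma> a \<in> ?K" using \<sigma>K by blast
    have "slot n a (- 1) \<noteq> slot n (\<sigma> a) 1" using slot_eq_iff[OF a(1) \<sigma>a, of "- 1" 1] by simp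
    moreover have "orientation (slot n a (- 1)) = - 1" "orientation (slot n (\<sigma> a) 1) = 1"
      by (rule orientation_slot[OF a(1)], rule orientation_slot[OF \<sigma>a])
    ultimately show ?thesis unfolding a(2) by simp
  qed
  ultimately show ?thesis unfolding diagrams_iff by blast
qed

lemma flip_negative_flip_negative: "flip_negative (flip_negative x) = x"
  by (auto simp: flip_negative_def case_prod_beta prod_eq_iff)

lemma theta_diagram_of:
  assumes \<sigma>: "\<sigma> permutes {1..n+m}" shows "theta n m (diagram_of n m \<sigma>) = \<sigma>"
proof
  fix a
  let ?K = "{1..n+m}"
  have flip: "(\<lambda>e. flip_negative ` e) ` diagram_of n m \<sigma> =
      (\<lambda>a. {(point_position n a, - 1), (point_position n (\<sigma> a), 1)}) ` ?K"
    by (simp add: diagram_of_def image_image slot_def flip_negative_flip_negative)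
  have inj: "x = y" if "x \<in> ?K" "y \<in> ?K" "point_position n x = point_position n y" for x y
    using that point_position_bij[of n m] by (metis bij_betw_imp_inj_on inj_onD)
  show "theta n m (diagram_of n m \<sigma>) a = \<sigma> a"
  proof (cases "a \<in> ?K")
    case True
    have "(THE b. b \<in> ?K \<and> {(point_position n a, - 1), (point_position n b, 1)} \<in>
        (\<lambda>a. {(point_position n a, - 1), (point_position n (\<sigma> a), 1 :: int)}) ` ?K) = \<sigma> a"
    proof (rule the_equality)
      show "\<sigma> a \<in> ?K \<and> {(point_position n a, - 1), (point_position n (\<sigma> a), 1)} \<in>
        (\<lambda>a. {(point_position n a, - 1), (point_position n (\<sigma> a), 1 :: int)}) ` ?K"
        using True permutes_in_image[OF \<sigma>] by blast
      fix b assume b: "b \<in> ?K \<and> {(point_position n a, - 1), (point_position n b, 1)} \<in>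
        (\<lambda>a. {(point_position n a, - 1), (point_position n (\<sigma> a), 1 :: int)}) ` ?K"
      then obtain c where c: "c \<in> ?K" "{(point_position n a, - 1), (point_position n b, 1 :: int)} =
        {(point_position n c, - 1), (point_position n (\<sigma> c), 1)}" by auto
      then have "point_position n a = point_position n c" "point_position n b = point_position n (\<sigma> c)"
        by (auto simp: doubleton_eq_iff)
      then show "b = \<sigma> a" using inj c(1) b True permutes_in_image[OF \<sigma>] by metis
    qed
    then show ?thesis unfolding theta_def flip using True by simp
  next
    case False
    then show ?thesis using permutes_not_in[OF \<sigma> False] by (simp only: theta_def if_False)
  qed
qed

text \<open>
  Every string has exactly one end of orientation \<open>-1\<close>; sending this end to the other one defines the
  permutation.
\<close>
lemma diagrams_eq_diagram_of:
  assumes \<pi>: "\<pi> \<in> diagrams n m"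
  obtains \<sigma> where "\<sigma> permutes {1..n+m}" "\<pi> = diagram_of n m \<sigma>"
proof -
  let ?K = "{1..n+m}"
  have "\<exists>b\<in>?K. {slot n a (- 1), slot n b 1} \<in> \<pi>" if a: "a \<in> ?K" for a
  proof -
    have "slot n a (- 1) \<in> \<Union>\<pi>" using slot_in[OF a] \<pi> by (auto simp: diagrams_iff dest!: partition_onD1)
    then obtain e where e: "e \<in> \<pi>" "slot n a (- 1) \<in> e" by blast
    obtain y where y: "e = {slot n a (- 1), y}" "y \<in> positions n m \<times> {-1, 1 :: int}"
      "orientation y = - orientation (slot n a (- 1))" by (rule diagrams_edge[OF \<pi> e])
    then have "orientation y = 1" using orientation_slot[OF a] by simp
    then obtain b where "b \<in> ?K" "y = slot n b 1" using slot_surj[OF y(2)] by metis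
    then show ?thesis using e y by blast
  qed
  then obtain s where s: "\<And>a. a \<in> ?K \<Longrightarrow> s a \<in> ?K \<and> {slot n a (- 1), slot n (s a) 1} \<in> \<pi>" by metis
  define \<sigma> where "\<sigma> a = (if a \<in> ?K then s a else a)" for a
  have \<sigma>s: "\<sigma> a \<in> ?K" "{slot n a (- 1), slot n (\<sigma> a) 1} \<in> \<pi>" if "a \<in> ?K" for a
    using s[OF that] that by (simp_all add: \<sigma>_def)
  have "\<sigma> permutes ?K"
  proof (rule inj_imp_permutes)
    show "inj_on \<sigma> ?K"
    proof (rule inj_onI)
      fix a b assume ab: "a \<in> ?K" "b \<in> ?K" "\<sigma> a = \<sigma> b"
      have "{slot n a (- 1), slot n (\<sigma> a) 1} = {slot n b (- 1), slot n (\<sigma> b) 1}"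
        by (rule diagrams_disjoint[OF \<pi> \<sigma>s(2)[OF ab(1)] \<sigma>s(2)[OF ab(2)], of "slot n (\<sigma> a) 1"])
          (simp_all add: ab(3))
      then show "a = b"
        using slot_eq_iff[OF ab(1,2)] slot_eq_iff[OF ab(1) \<sigma>s(1)[OF ab(2)], of "- 1" 1]
        by (auto simp: doubleton_eq_iff)
    qed
  qed (use \<sigma>s in \<open>auto simp: \<sigma>_def\<close>)
  moreover have "\<pi> = diagram_of n m \<sigma>"
  proof (intro equalityI subsetI)
    fix e assume e: "e \<in> \<pi>"
    have "card e = 2" using \<pi> e by (simp add: diagrams_iff)
    then have "e \<noteq> {}" by auto
    then obtain x where x: "x \<in> e" by blast
    obtain y where y: "e = {x, y}" "y \<in> positions n m \<times> {-1, 1 :: int}" "orientation y = - orientation x"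
      by (rule diagrams_edge[OF \<pi> e x])
    have "x \<in> positions n m \<times> {-1, 1 :: int}" using \<pi> e x by (auto simp: diagrams_iff dest!: partition_onD1)
    then obtain a where a: "a \<in> ?K" "x = slot n a (orientation x)" "orientation x \<in> {-1, 1 :: int}" by (rule slot_surj)
    obtain b where b: "b \<in> ?K" "y = slot n b (orientation y)" using slot_surj[OF y(2)] by metis
    obtain c where c: "c \<in> ?K" "slot n c (- 1) \<in> e"
      using a b y by (cases "orientation x = - 1") auto
    have "e = {slot n c (- 1), slot n (\<sigma> c) 1}"
      by (rule diagrams_disjoint[OF \<pi> e \<sigma>s(2)[OF c(1)] c(2)]) simp
    then show "e \<in> diagram_of n m \<sigma>" using c(1) by (auto simp: diagram_of_def)
  next
    fix e assume "e \<in> diagram_of n m \<sigma>"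
    then show "e \<in> \<pi>" using \<sigma>s by (auto simp: diagram_of_def)
  qed
  ultimately show ?thesis by (rule that)
qed

lemma bij_betw_diagram_of: "bij_betw (diagram_of n m) {\<sigma>. \<sigma> permutes {1..n+m}} (diagrams n m)"
proof (rule bij_betwI[where g = "theta n m"])
  have "theta n m \<pi> permutes {1..n+m} \<and> diagram_of n m (theta n m \<pi>) = \<pi>" if "\<pi> \<in> diagrams n m" for \<pi>
    using diagrams_eq_diagram_of[OF that] theta_diagram_of by metis
  then show "theta n m \<in> diagrams n m \<rightarrow> {\<sigma>. \<sigma> permutes {1..n+m}}"
    "\<And>\<pi>. \<pi> \<in> diagrams n m \<Longrightarrow> diagram_of n m (theta n m \<pi>) = \<pi>" by auto
qed (auto simp: diagram_of_in_diagrams theta_diagram_of simp del: One_nat_def)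

lemma finite_diagrams: "finite (diagrams n m)"
  using bij_betw_finite[OF bij_betw_diagram_of[of n m]] by (simp add: finite_permutations)

lemma strings_agree_diagram_of:
  assumes \<sigma>: "\<sigma> permutes {1..n+m}"
  shows "of_bool (strings_agree (diagram_of n m \<sigma>) g f) = string_kernel n m \<sigma> g f"
proof -
  have "strings_agree (diagram_of n m \<sigma>) g f \<longleftrightarrow>
      (\<forall>a\<in>{1..n+m}. vertex_label g f (slot n a (- 1)) = vertex_label g f (slot n (\<sigma> a) 1))"
    by (auto simp: strings_agree_iff diagram_of_def)
  also have "\<dots> \<longleftrightarrow> (\<forall>a\<in>{1..n+m}. mixed_labels n f g a = mixed_labels n g f (\<sigma> a))"
  proof (rule ball_cong[OF refl])
    fix a assume a: "a \<in> {1..n+m}"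
    then have "\<sigma> a \<in> {1..n+m}" using permutes_in_image[OF \<sigma>] by blast
    from vertex_label_slot[OF a] vertex_label_slot[OF this]
    show "(vertex_label g f (slot n a (- 1)) = vertex_label g f (slot n (\<sigma> a) 1)) \<longleftrightarrow>
        (mixed_labels n f g a = mixed_labels n g f (\<sigma> a))" by simp
  qed
  finally show ?thesis by (simp add: string_kernel_def)
qed

lemma perm_diagram_eq_diagram_of:
  assumes "\<sigma> \<in> carrier (sym_group2 n m)"
  shows "perm_diagram n m \<sigma> = diagram_of n m (bent_perm n m \<sigma>)"
proof -
  obtain \<alpha> \<beta> where ab: "\<sigma> = (\<alpha>, \<beta>)" "\<alpha> permutes {1..n}" "\<beta> permutes {1..m}"
    using assms(1) by (cases \<sigma>) (auto simp: sym_group_carrier)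
  let ?E = "\<lambda>v. {(v, - 1), (signed_perm \<sigma> v, 1)}"
  let ?F = "\<lambda>a. {slot n a (- 1), slot n (bent_perm n m \<sigma> a) 1}"
  have pos: "?F a = ?E (int a)" if "a \<in> {1..n}" for a
    using that permutes_le[OF ab(2), of a]
    by (simp add: ab(1) slot_def bent_perm_def sym_embed_simps signed_perm_def flip_negative_def point_position_def)
  have neg: "?F (n + j) = ?E (- int (inv' \<beta> j))" if "j \<in> {1..m}" for j
    using that permutes_le[OF permutes_inv[OF ab(3)], of j] permutes_inverses(1)[OF ab(3), of j]
    by (auto simp: ab(1) slot_def bent_perm_def sym_embed_simps signed_perm_def flip_negative_def point_position_def)
  have "{1..n+m} = {1..n} \<union> (\<lambda>j. n + j) ` {1..m}"
  proof (intro equalityI subsetI)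
    fix a assume "a \<in> {1..n+m}"
    then show "a \<in> {1..n} \<union> (\<lambda>j. n + j) ` {1..m}"
      by (cases rule: interval_cases[where a = a and n = n and m = m]) auto
  qed auto
  then have "diagram_of n m (bent_perm n m \<sigma>) = ?F ` {1..n} \<union> (\<lambda>j. ?F (n + j)) ` {1..m}"
    by (simp only: diagram_of_def image_Un image_image)
  also have "\<dots> = ?E ` (int ` {1..n}) \<union> (\<lambda>j. ?E (- int j)) ` (inv' \<beta> ` {1..m})"
    unfolding image_image
    by (intro arg_cong2[where f = "(\<union>)"] image_cong refl) (simp_all only: pos neg)
  also have "inv' \<beta> ` {1..m} = {1..m}" by (rule permutes_image[OF permutes_inv[OF ab(3)]])
  also have "?E ` (int ` {1..n}) \<union> (\<lambda>j. ?E (- int j)) ` {1..m} =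
      ?E ` (int ` {1..n} \<union> (\<lambda>j. - int j) ` {1..m})"
    by (simp only: image_Un image_image)
  also have "int ` {1..n} \<union> (\<lambda>j. - int j) ` {1..m} = positions n m"
  proof (intro equalityI subsetI)
    fix p assume "p \<in> positions n m"
    then have "p = int (nat p) \<and> nat p \<in> {1..n} \<or> p = - int (nat (- p)) \<and> nat (- p) \<in> {1..m}"
      by (auto simp: positions_def)
    then show "p \<in> int ` {1..n} \<union> (\<lambda>j. - int j) ` {1..m}" by blast
  qed (auto simp: positions_def)
  also have "?E ` positions n m = perm_diagram n m \<sigma>" by (auto simp: perm_diagram_def)
  finally show ?thesis ..
qed

lemma perm_diagram_in_diagrams:
  "\<sigma> \<in> carrier (sym_group2 n m) \<Longrightarrow> perm_diagram n m \<sigma> \<in> diagrams n m"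
  using bij_betwE[OF bij_betw_bent_perm[of n m]]
  by (simp add: perm_diagram_eq_diagram_of diagram_of_in_diagrams del: carrier_DirProd)

section \<open>Stacking with a permutation diagram\<close>

lemma relabel_in_diagrams:
  assumes \<mu>: "\<mu> \<in> diagrams n m" and \<psi>: "bij_betw \<psi> (positions n m \<times> {-1, 1 :: int}) (positions n m \<times> {-1, 1 :: int})"
    and orient: "\<And>x. x \<in> positions n m \<times> {-1, 1 :: int} \<Longrightarrow> orientation (\<psi> x) = orientation x"
  shows "(\<lambda>e. \<psi> ` e) ` \<mu> \<in> diagrams n m"
proof -
  have P: "partition_on (positions n m \<times> {-1, 1 :: int}) \<mu>" using \<mu> by (simp add: diagrams_iff)
  have sub: "e \<subseteq> positions n m \<times> {-1, 1 :: int}" if "e \<in> \<mu>" for e using that partition_onD1[OF P] by blast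
  have "partition_on (\<psi> ` (positions n m \<times> {-1, 1 :: int})) ((`) \<psi> ` \<mu> - {{}})"
    by (rule partition_on_inj_image[OF P bij_betw_imp_inj_on[OF \<psi>]])
  moreover have "(`) \<psi> ` \<mu> - {{}} = (`) \<psi> ` \<mu>" using partition_onD3[OF P] by auto
  ultimately have "partition_on (positions n m \<times> {-1, 1 :: int}) ((`) \<psi> ` \<mu>)"
    using bij_betw_imp_surj_on[OF \<psi>] by simp
  moreover have "card (\<psi> ` e) = 2" if "e \<in> \<mu>" for e
    using card_image[OF inj_on_subset[OF bij_betw_imp_inj_on[OF \<psi>] sub[OF that]]] \<mu> that
    by (simp add: diagrams_iff)
  moreover have "orientation y = - orientation x" if "e \<in> \<mu>" "x \<in> \<psi> ` e" "y \<in> \<psi> ` e" "x \<noteq> y" for e x y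
  proof -
    obtain p q where pq: "p \<in> e" "q \<in> e" "x = \<psi> p" "y = \<psi> q" using \<open>x \<in> _\<close> \<open>y \<in> _\<close> by blast
    then have "p \<noteq> q" using that by blast
    then have "orientation q = - orientation p" using \<mu> that(1) pq(1,2) unfolding diagrams_iff by blast
    moreover have "p \<in> positions n m \<times> {-1, 1 :: int}" "q \<in> positions n m \<times> {-1, 1 :: int}"
      using subsetD[OF sub[OF that(1)]] pq(1,2) by simp_all
    ultimately show ?thesis by (simp only: pq orient)
  qed
  ultimately show ?thesis unfolding diagrams_iff by blast
qed

text \<open>
  Stacking with a permutation diagram attaches to every middle vertex exactly one string that leads to
  an outer vertex. Contracting these strings gives the other diagram \<open>\<mu>\<close> with one row relabelled by
  \<open>\<psi>\<close>, and no closed loops can arise. The permutation diagram may be the upper or the lower one: the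
  map \<open>place\<close> embeds the vertices of \<open>\<mu>\<close> in the three-row picture, and \<open>\<phi>\<close> retracts the picture to the
  two outer rows.
\<close>
lemma stack_relabel:
  fixes \<pi> \<pi>' :: diagram
  defines "R \<equiv> stack_rel \<pi> \<pi>'"
  assumes \<mu>: "\<mu> \<in> diagrams n m" and \<psi>: "bij_betw \<psi> (positions n m \<times> {-1, 1 :: int}) (positions n m \<times> {-1, 1 :: int})"
    and orient: "\<And>x. x \<in> positions n m \<times> {-1, 1 :: int} \<Longrightarrow> orientation (\<psi> x) = orientation x"
    and \<phi>_outer: "\<And>x. x \<in> positions n m \<times> {-1, 1 :: int} \<Longrightarrow> \<phi> x = x"
    and \<phi>_place: "\<And>p. p \<in> positions n m \<times> {-1, 1 :: int} \<Longrightarrow> \<phi> (place p) = \<psi> p"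
    and edge: "\<And>x y. (x, y) \<in> R \<Longrightarrow> \<phi> x = \<phi> y \<or> (\<exists>e\<in>\<mu>. \<exists>p\<in>e. \<exists>q\<in>e. x = place p \<and> y = place q)"
    and place: "\<And>e. e \<in> \<mu> \<Longrightarrow> place ` e \<in> (\<lambda>e. (\<lambda>(v, \<eta>). (v, if \<eta> = -1 then 0 else \<eta>)) ` e) ` \<pi> \<union>
      (\<lambda>e. (\<lambda>(v, \<eta>). (v, if \<eta> = 1 then 0 else \<eta>)) ` e) ` \<pi>'"
    and link: "\<And>p. p \<in> positions n m \<times> {-1, 1 :: int} \<Longrightarrow> (place p, \<psi> p) \<in> R\<^sup>* \<and> (\<psi> p, place p) \<in> R\<^sup>*"
    and middle: "\<And>v. v \<in> positions n m \<Longrightarrow> \<exists>p\<in>positions n m \<times> {-1, 1 :: int}. (v, 0) = place p"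
  shows "diagram_comp n m \<pi> \<pi>' = (\<lambda>e. \<psi> ` e) ` \<mu>" and "diagram_loops n m \<pi> \<pi>' = 0"
proof -
  let ?V = "positions n m \<times> {-1, 1 :: int}" and ?\<nu> = "(\<lambda>e. \<psi> ` e) ` \<mu>"
  have \<nu>: "?\<nu> \<in> diagrams n m" by (rule relabel_in_diagrams[OF \<mu> \<psi> orient])
  have sub: "e \<subseteq> ?V" if "e \<in> \<mu>" for e using that \<mu> by (auto simp: diagrams_iff dest!: partition_onD1)
  have \<nu>sub: "e \<subseteq> ?V" if "e \<in> ?\<nu>" for e using that \<nu> by (auto simp: diagrams_iff dest!: partition_onD1)
  have edge': "\<phi> x = \<phi> y \<or> (\<exists>e\<in>?\<nu>. \<phi> x \<in> e \<and> \<phi> y \<in> e)" if "(x, y) \<in> R" for x y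
    using edge[OF that]
  proof
    assume "\<exists>e\<in>\<mu>. \<exists>p\<in>e. \<exists>q\<in>e. x = place p \<and> y = place q"
    then obtain e p q where e: "e \<in> \<mu>" "p \<in> e" "q \<in> e" "x = place p" "y = place q" by blast
    then have "\<phi> x = \<psi> p" "\<phi> y = \<psi> q" using \<phi>_place sub by blast+
    then show ?thesis using e by blast
  qed simp
  have path: "\<phi> x = \<phi> y \<or> (\<exists>e\<in>?\<nu>. \<phi> x \<in> e \<and> \<phi> y \<in> e)" if "(x, y) \<in> R\<^sup>*" for x y
    using that
  proof induction
    case (step y z)
    show ?case
    proof (cases "\<phi> x = \<phi> y \<or> \<phi> y = \<phi> z")
      case True
      then show ?thesis using step.IH edge'[OF step.hyps(2)] by metis
    next
      case False
      then obtain e e' where e: "e \<in> ?\<nu>" "\<phi> x \<in> e" "\<phi> y \<in> e" "e' \<in> ?\<nu>" "\<phi> y \<in> e'" "\<phi> z \<in> e'"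
        using step.IH edge'[OF step.hyps(2)] by blast
      then have "e = e'" using diagrams_disjoint[OF \<nu>] by blast
      then show ?thesis using e by blast
    qed
  qed simp
  have conn: "(\<psi> p, \<psi> q) \<in> R\<^sup>*" if e: "e \<in> \<mu>" "p \<in> e" "q \<in> e" "p \<noteq> q" for e p q
  proof -
    obtain y where "e = {p, y}" using diagrams_edge[OF \<mu> e(1,2)] by metis
    then have "e = {p, q}" using e by auto
    then have "{place p, place q} = place ` e" by simp
    then have "(place p, place q) \<in> R" using place[OF e(1)] unfolding R_def stack_rel_def by simp
    moreover have "p \<in> ?V" "q \<in> ?V" using sub[OF e(1)] e by auto
    ultimately show ?thesis using link by (meson rtrancl.rtrancl_into_rtrancl rtrancl_trans)
  qed
  show "diagram_comp n m \<pi> \<pi>' = ?\<nu>"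
  proof (intro equalityI subsetI)
    fix e assume "e \<in> diagram_comp n m \<pi> \<pi>'"
    then obtain x y where xy: "e = {x, y}" "x \<in> ?V" "y \<in> ?V" "x \<noteq> y" "(x, y) \<in> R\<^sup>*"
      by (auto simp: diagram_comp_def R_def)
    then obtain e' where e': "e' \<in> ?\<nu>" "x \<in> e'" "y \<in> e'"
      using path[OF xy(5)] \<phi>_outer by metis
    obtain z where "e' = {x, z}" by (rule diagrams_edge[OF \<nu> e'(1,2)])
    then show "e \<in> ?\<nu>" using e' xy by auto
  next
    fix e assume "e \<in> ?\<nu>"
    then obtain d where d: "d \<in> \<mu>" "e = \<psi> ` d" by blast
    have "card d = 2" using \<mu> d(1) by (simp add: diagrams_iff)
    then have "d \<noteq> {}" by auto
    then obtain p where p: "p \<in> d" by blast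
    obtain q where q: "d = {p, q}" "p \<noteq> q" by (rule diagrams_edge[OF \<mu> d(1) p])
    have V: "p \<in> ?V" "q \<in> ?V" using sub[OF d(1)] q by auto
    then have "\<psi> p \<noteq> \<psi> q" using q(2) bij_betw_imp_inj_on[OF \<psi>] by (meson inj_onD)
    moreover have "\<psi> p \<in> ?V" "\<psi> q \<in> ?V" using V bij_betwE[OF \<psi>] by blast+
    moreover have "(\<psi> p, \<psi> q) \<in> R\<^sup>*" using conn[OF d(1)] q by blast
    moreover have "e = {\<psi> p, \<psi> q}" using d(2) q(1) by simp
    ultimately have "e = {\<psi> p, \<psi> q} \<and> \<psi> p \<in> ?V \<and> \<psi> q \<in> ?V \<and> \<psi> p \<noteq> \<psi> q \<and> (\<psi> p, \<psi> q) \<in> R\<^sup>*"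
      by (intro conjI)
    then show "e \<in> diagram_comp n m \<pi> \<pi>'" unfolding diagram_comp_def R_def by (intro CollectI exI)
  qed
  have "\<not> C \<subseteq> positions n m \<times> {0}" if CR: "C \<in> (positions n m \<times> {-1, 0, 1}) // R\<^sup>*" for C
  proof
    assume C: "C \<subseteq> positions n m \<times> {0}"
    obtain x where x: "C = R\<^sup>* `` {x}" by (rule quotientE[OF CR]) blast
    then have "x \<in> C" by auto
    then obtain v where v: "x = (v, 0)" "v \<in> positions n m" using C by auto
    then obtain p where p: "p \<in> ?V" "x = place p" using middle by metis
    then have "\<psi> p \<in> C" using link x by auto
    moreover have "\<psi> p \<in> ?V" using p bij_betwE[OF \<psi>] by blast
    ultimately show False using C by auto
  qed
  then have "{C \<in> (positions n m \<times> {-1, 0, 1}) // R\<^sup>*. C \<subseteq> positions n m \<times> {0}} = {}" by blast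
  then show "diagram_loops n m \<pi> \<pi>' = 0" unfolding diagram_loops_def R_def by (simp only: card.empty)
qed

lemma signed_perm_positions:
  assumes "\<sigma> \<in> carrier (sym_group2 n m)" "v \<in> positions n m"
  shows "signed_perm \<sigma> v \<in> positions n m" "sgn (signed_perm \<sigma> v) = sgn v"
proof -
  obtain \<alpha> \<beta> where ab: "\<sigma> = (\<alpha>, \<beta>)" "\<alpha> permutes {1..n}" "\<beta> permutes {1..m}"
    using assms(1) by (cases \<sigma>) (auto simp: sym_group_carrier)
  show "signed_perm \<sigma> v \<in> positions n m" "sgn (signed_perm \<sigma> v) = sgn v"
  proof -
    have "0 < v \<and> nat v \<in> {1..n} \<or> v < 0 \<and> nat (- v) \<in> {1..m}"
      using assms(2) by (auto simp: positions_def)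
    then have "signed_perm \<sigma> v \<in> positions n m \<and> sgn (signed_perm \<sigma> v) = sgn v"
      using permutes_le[OF ab(2), of "nat v"] permutes_le[OF ab(3), of "nat (- v)"]
      by (auto simp: ab(1) signed_perm_def positions_def sgn_if)
    then show "signed_perm \<sigma> v \<in> positions n m" "sgn (signed_perm \<sigma> v) = sgn v" by auto
  qed
qed

lemma stack_perm_diagram_left:
  assumes \<sigma>: "\<sigma> \<in> carrier (sym_group2 n m)" and \<mu>: "\<mu> \<in> diagrams n m"
  shows "diagram_comp n m (perm_diagram n m \<sigma>) \<mu> \<in> diagrams n m"
    and "diagram_loops n m (perm_diagram n m \<sigma>) \<mu> = 0"
    and "strings_agree (diagram_comp n m (perm_diagram n m \<sigma>) \<mu>) g f \<longleftrightarrow> strings_agree \<mu> (g \<circ> signed_perm \<sigma>) f"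
proof -
  interpret G: group "sym_group2 n m" by (rule group_sym_group2)
  let ?s = "signed_perm \<sigma>" and ?s' = "signed_perm (inv\<^bsub>sym_group2 n m\<^esub> \<sigma>)"
  let ?V = "positions n m \<times> {-1, 1 :: int}"
  note s = signed_perm_positions[OF \<sigma>] and s' = signed_perm_positions[OF G.inv_closed[OF \<sigma>]]
  have inv: "?s (?s' v) = v" "?s' (?s v) = v" for v
    using signed_perm_inv[OF \<sigma>] by (simp_all add: fun_eq_iff)
  define \<psi> :: "vertex \<Rightarrow> vertex" where "\<psi> = (\<lambda>(v, \<eta>). if \<eta> = 1 then (?s v, 1) else (v, \<eta>))"
  define \<phi> :: "vertex \<Rightarrow> vertex" where "\<phi> = (\<lambda>(v, \<eta>). if \<eta> = 0 then (?s v, 1) else (v, \<eta>))"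
  define place :: "vertex \<Rightarrow> vertex" where "place = (\<lambda>(v, \<eta>). (v, if \<eta> = 1 then 0 else \<eta>))"
  let ?R = "stack_rel (perm_diagram n m \<sigma>) \<mu>"
  have \<psi>: "bij_betw \<psi> ?V ?V"
    by (rule bij_betwI[where g = "\<lambda>(v, \<eta>). if \<eta> = 1 then (?s' v, 1) else (v, \<eta>)"])
      (auto simp: \<psi>_def s s' inv)
  have orient: "orientation (\<psi> x) = orientation x" if "x \<in> ?V" for x
    using that s by (auto simp: orientation_def \<psi>_def)
  have R: "?R = {(x, y). (\<exists>v\<in>positions n m. {x, y} = {(v, 0), (?s v, 1)}) \<or> (\<exists>e\<in>\<mu>. {x, y} = place ` e)}"
  proof -
    have "perm_diagram n m \<sigma> = (\<lambda>v. {(v, -1), (?s v, 1)}) ` positions n m"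
      by (auto simp: perm_diagram_def)
    then have "(\<lambda>e. (\<lambda>(v, \<eta>). (v, if \<eta> = -1 then 0 else \<eta>)) ` e) ` perm_diagram n m \<sigma> =
        (\<lambda>v. {(v, 0), (?s v, 1)}) ` positions n m"
      by (simp add: image_image)
    then show ?thesis unfolding stack_rel_def place_def[symmetric] by auto
  qed
  have 1: "\<phi> x = \<phi> y \<or> (\<exists>e\<in>\<mu>. \<exists>p\<in>e. \<exists>q\<in>e. x = place p \<and> y = place q)" if "(x, y) \<in> ?R" for x y
  proof -
    consider v where "{x, y} = {(v, 0), (?s v, 1)}" | e where "e \<in> \<mu>" "{x, y} = place ` e"
      using \<open>(x, y) \<in> ?R\<close> unfolding R by blast
    then show ?thesis
    proof cases
      case 1
      then show ?thesis by (auto simp: \<phi>_def doubleton_eq_iff)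
    next
      case 2
      then have "x \<in> place ` e" "y \<in> place ` e" by auto
      with 2(1) show ?thesis by blast
    qed
  qed
  have 2: "(place p, \<psi> p) \<in> ?R\<^sup>* \<and> (\<psi> p, place p) \<in> ?R\<^sup>*" if "p \<in> ?V" for p
  proof (cases "snd p = 1")
    case True
    then have "(place p, \<psi> p) \<in> ?R" "(\<psi> p, place p) \<in> ?R"
      using that unfolding R by (auto simp: place_def \<psi>_def case_prod_beta)
    then show ?thesis by blast
  qed (auto simp: place_def \<psi>_def case_prod_beta)
  have 3: "\<exists>p\<in>?V. (v, 0) = place p" if "v \<in> positions n m" for v
    by (rule bexI[of _ "(v, 1)"]) (use that in \<open>auto simp: place_def\<close>)
  have comp: "diagram_comp n m (perm_diagram n m \<sigma>) \<mu> = (\<lambda>e. \<psi> ` e) ` \<mu>"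
    and loops: "diagram_loops n m (perm_diagram n m \<sigma>) \<mu> = 0"
    by (rule stack_relabel[OF \<mu> \<psi> orient _ _ 1 _ 2 3];
        auto simp: \<phi>_def \<psi>_def place_def case_prod_beta)+
  show "diagram_comp n m (perm_diagram n m \<sigma>) \<mu> \<in> diagrams n m"
    unfolding comp by (rule relabel_in_diagrams[OF \<mu> \<psi> orient])
  show "diagram_loops n m (perm_diagram n m \<sigma>) \<mu> = 0" by (rule loops)
  have "vertex_label g f (\<psi> x) = vertex_label (g \<circ> ?s) f x" for x
    by (auto simp: vertex_label_def \<psi>_def case_prod_beta)
  then show "strings_agree (diagram_comp n m (perm_diagram n m \<sigma>) \<mu>) g f \<longleftrightarrow> strings_agree \<mu> (g \<circ> ?s) f"
    unfolding comp strings_agree_iff by simp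
qed

lemma stack_perm_diagram_right:
  assumes \<sigma>: "\<sigma> \<in> carrier (sym_group2 n m)" and \<mu>: "\<mu> \<in> diagrams n m"
  shows "diagram_comp n m \<mu> (perm_diagram n m \<sigma>) \<in> diagrams n m"
    and "diagram_loops n m \<mu> (perm_diagram n m \<sigma>) = 0"
    and "strings_agree (diagram_comp n m \<mu> (perm_diagram n m \<sigma>)) g f \<longleftrightarrow>
      strings_agree \<mu> g (f \<circ> signed_perm (inv\<^bsub>sym_group2 n m\<^esub> \<sigma>))"
proof -
  interpret G: group "sym_group2 n m" by (rule group_sym_group2)
  let ?s = "signed_perm \<sigma>" and ?s' = "signed_perm (inv\<^bsub>sym_group2 n m\<^esub> \<sigma>)"
  let ?V = "positions n m \<times> {-1, 1 :: int}"
  note s = signed_perm_positions[OF \<sigma>] and s' = signed_perm_positions[OF G.inv_closed[OF \<sigma>]]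
  have inv: "?s (?s' v) = v" "?s' (?s v) = v" for v
    using signed_perm_inv[OF \<sigma>] by (simp_all add: fun_eq_iff)
  define \<psi> :: "vertex \<Rightarrow> vertex" where "\<psi> = (\<lambda>(v, \<eta>). if \<eta> = -1 then (?s' v, -1) else (v, \<eta>))"
  define \<phi> :: "vertex \<Rightarrow> vertex" where "\<phi> = (\<lambda>(v, \<eta>). if \<eta> = 0 then (?s' v, -1) else (v, \<eta>))"
  define place :: "vertex \<Rightarrow> vertex" where "place = (\<lambda>(v, \<eta>). (v, if \<eta> = -1 then 0 else \<eta>))"
  let ?R = "stack_rel \<mu> (perm_diagram n m \<sigma>)"
  have \<psi>: "bij_betw \<psi> ?V ?V"
    by (rule bij_betwI[where g = "\<lambda>(v, \<eta>). if \<eta> = -1 then (?s v, -1) else (v, \<eta>)"])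
      (auto simp: \<psi>_def s s' inv)
  have orient: "orientation (\<psi> x) = orientation x" if "x \<in> ?V" for x
    using that s' by (auto simp: orientation_def \<psi>_def)
  have R: "?R = {(x, y). (\<exists>v\<in>positions n m. {x, y} = {(v, -1), (?s v, 0)}) \<or> (\<exists>e\<in>\<mu>. {x, y} = place ` e)}"
  proof -
    have "perm_diagram n m \<sigma> = (\<lambda>v. {(v, -1), (?s v, 1)}) ` positions n m"
      by (auto simp: perm_diagram_def)
    then have "(\<lambda>e. (\<lambda>(v, \<eta>). (v, if \<eta> = 1 then 0 else \<eta>)) ` e) ` perm_diagram n m \<sigma> =
        (\<lambda>v. {(v, -1), (?s v, 0)}) ` positions n m"
      by (simp add: image_image)
    then show ?thesis unfolding stack_rel_def place_def[symmetric] by auto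
  qed
  have 1: "\<phi> x = \<phi> y \<or> (\<exists>e\<in>\<mu>. \<exists>p\<in>e. \<exists>q\<in>e. x = place p \<and> y = place q)" if "(x, y) \<in> ?R" for x y
  proof -
    consider v where "{x, y} = {(v, -1), (?s v, 0)}" | e where "e \<in> \<mu>" "{x, y} = place ` e"
      using \<open>(x, y) \<in> ?R\<close> unfolding R by blast
    then show ?thesis
    proof cases
      case 1
      then show ?thesis by (auto simp: \<phi>_def doubleton_eq_iff inv)
    next
      case 2
      then have "x \<in> place ` e" "y \<in> place ` e" by auto
      with 2(1) show ?thesis by blast
    qed
  qed
  have 2: "(place p, \<psi> p) \<in> ?R\<^sup>* \<and> (\<psi> p, place p) \<in> ?R\<^sup>*" if p: "p \<in> ?V" for p
  proof (cases "snd p = -1")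
    case True
    have "?s' (fst p) \<in> positions n m" using p s' by auto
    moreover have "{\<psi> p, place p} = {(?s' (fst p), -1), (?s (?s' (fst p)), 0)}"
      using True by (simp add: place_def \<psi>_def case_prod_beta inv)
    ultimately have "(\<psi> p, place p) \<in> ?R" "(place p, \<psi> p) \<in> ?R"
      unfolding R by (auto simp: insert_commute)
    then show ?thesis by blast
  qed (auto simp: place_def \<psi>_def case_prod_beta)
  have 3: "\<exists>p\<in>?V. (v, 0) = place p" if "v \<in> positions n m" for v
    by (rule bexI[of _ "(v, -1)"]) (use that in \<open>auto simp: place_def\<close>)
  have comp: "diagram_comp n m \<mu> (perm_diagram n m \<sigma>) = (\<lambda>e. \<psi> ` e) ` \<mu>"
    and loops: "diagram_loops n m \<mu> (perm_diagram n m \<sigma>) = 0"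
    by (rule stack_relabel[OF \<mu> \<psi> orient _ _ 1 _ 2 3];
        auto simp: \<phi>_def \<psi>_def place_def case_prod_beta)+
  show "diagram_comp n m \<mu> (perm_diagram n m \<sigma>) \<in> diagrams n m"
    unfolding comp by (rule relabel_in_diagrams[OF \<mu> \<psi> orient])
  show "diagram_loops n m \<mu> (perm_diagram n m \<sigma>) = 0" by (rule loops)
  have "vertex_label g f (\<psi> x) = vertex_label g (f \<circ> ?s') x" if "x \<in> ?V" for x
    using that by (auto simp: vertex_label_def \<psi>_def)
  moreover have "e \<subseteq> ?V" if "e \<in> \<mu>" for e using that \<mu> by (auto simp: diagrams_iff dest!: partition_onD1)
  ultimately have label: "vertex_label g f (\<psi> x) = vertex_label g (f \<circ> ?s') x" if "e \<in> \<mu>" "x \<in> e" for e x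
    using that by blast
  have "strings_agree (diagram_comp n m \<mu> (perm_diagram n m \<sigma>)) g f \<longleftrightarrow>
      (\<forall>e\<in>\<mu>. \<forall>x\<in>e. \<forall>y\<in>e. vertex_label g f (\<psi> x) = vertex_label g f (\<psi> y))"
    unfolding comp strings_agree_iff by simp
  also have "\<dots> \<longleftrightarrow> strings_agree \<mu> g (f \<circ> ?s')"
    unfolding strings_agree_iff by (intro ball_cong refl) (simp only: label)
  finally show "strings_agree (diagram_comp n m \<mu> (perm_diagram n m \<sigma>)) g f \<longleftrightarrow> strings_agree \<mu> g (f \<circ> ?s')" .
qed

section \<open>Matrices of Brauer algebra elements\<close>

definition brauer_kernel :: "nat \<Rightarrow> nat \<Rightarrow> (diagram \<Rightarrow> complex) \<Rightarrow> multi_index \<Rightarrow> multi_index \<Rightarrow> complex" where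
  "brauer_kernel n m a g f = (\<Sum>\<pi>\<in>diagrams n m. a \<pi> * of_bool (strings_agree \<pi> g f))"

lemma brauer_act_kernel:
  "brauer_act N n m a t = (\<lambda>g. if g \<in> multi_indices N n m
     then \<Sum>f\<in>multi_indices N n m. brauer_kernel n m a g f * t f else 0)"
proof
  fix g
  let ?I = "multi_indices N n m"
  have "(\<Sum>\<pi>\<in>diagrams n m. a \<pi> * (\<Sum>f\<in>?I. (if strings_agree \<pi> g f then 1 else 0) * t f)) =
      (\<Sum>\<pi>\<in>diagrams n m. \<Sum>f\<in>?I. a \<pi> * of_bool (strings_agree \<pi> g f) * t f)"
    by (simp add: sum_distrib_left of_bool_def mult.assoc)
  also have "\<dots> = (\<Sum>f\<in>?I. brauer_kernel n m a g f * t f)"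
    unfolding brauer_kernel_def sum_distrib_right by (rule sum.swap)
  finally show "brauer_act N n m a t g =
      (if g \<in> ?I then \<Sum>f\<in>?I. brauer_kernel n m a g f * t f else 0)"
    by (simp add: brauer_act_def diagram_act_def)
qed

lemma brauer_kernel_string_kernel:
  "brauer_kernel n m a g f =
    (\<Sum>\<sigma> | \<sigma> permutes {1..n+m}. a (diagram_of n m \<sigma>) * string_kernel n m \<sigma> g f)"
  unfolding brauer_kernel_def sum.reindex_bij_betw[OF bij_betw_diagram_of, symmetric]
  by (rule sum.cong) (simp_all add: strings_agree_diagram_of)

text \<open>
  The action on tensors is faithful for \<open>N \<ge> n + m\<close>, so that \<open>q_proj\<close> is well defined.
\<close>
lemma brauer_kernel_inject:
  assumes N: "N \<ge> n + m" and a: "a \<in> carrier (walled_brauer N n m)" and b: "b \<in> carrier (walled_brauer N n m)"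
    and eq: "\<And>g f. g \<in> multi_indices N n m \<Longrightarrow> f \<in> multi_indices N n m \<Longrightarrow>
      brauer_kernel n m a g f = brauer_kernel n m b g f"
  shows "a = b"
proof
  fix \<pi>
  show "a \<pi> = b \<pi>"
  proof (cases "\<pi> \<in> diagrams n m")
    case True
    then obtain \<sigma> where \<sigma>: "\<sigma> permutes {1..n+m}" "\<pi> = diagram_of n m \<sigma>" by (rule diagrams_eq_diagram_of)
    have "a (diagram_of n m \<sigma>) - b (diagram_of n m \<sigma>) = 0"
    proof (rule string_kernel_independent[OF N \<sigma>(1)])
      fix g f assume "g \<in> multi_indices N n m" "f \<in> multi_indices N n m"
      from eq[OF this]
      show "(\<Sum>\<tau> | \<tau> permutes {1..n+m}. (a (diagram_of n m \<tau>) - b (diagram_of n m \<tau>)) * string_kernel n m \<tau> g f) = 0"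
        by (simp add: brauer_kernel_string_kernel left_diff_distrib sum_subtractf)
    qed
    then show ?thesis using \<sigma>(2) by simp
  next
    case False
    then show ?thesis using a b by (simp add: walled_brauer_def)
  qed
qed

lemma q_proj_eqI:
  assumes N: "N \<ge> n + m" "N \<ge> 1" and a: "a \<in> carrier (walled_brauer N n m)"
    and kernel: "\<And>g f. g \<in> multi_indices N n m \<Longrightarrow> f \<in> multi_indices N n m \<Longrightarrow>
      brauer_kernel n m a g f = proj_kernel N n m g f"
  shows "q_proj N n m = a"
  unfolding q_proj_def
proof (rule the_equality)
  let ?I = "multi_indices N n m"
  have "brauer_act N n m a t = traceless_projection N n m t" if t: "t \<in> tensors N n m" for t
  proof
    fix g
    have "traceless_projection N n m t \<in> traceless N n m" by (rule traceless_projection[OF N(2) t])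
    then show "brauer_act N n m a t g = traceless_projection N n m t g"
      using traceless_supported[of "traceless_projection N n m t" N n m g]
        fun_cong[OF traceless_projection_kernel[OF N(2) t], of g]
      by (auto simp: brauer_act_kernel kernel)
  qed
  then show "a \<in> carrier (walled_brauer N n m) \<and>
      (\<forall>t\<in>tensors N n m. brauer_act N n m a t = traceless_projection N n m t)" using a by blast
  fix b assume b: "b \<in> carrier (walled_brauer N n m) \<and>
      (\<forall>t\<in>tensors N n m. brauer_act N n m b t = traceless_projection N n m t)"
  show "b = a"
  proof (rule brauer_kernel_inject[OF N(1) _ a])
    fix g f assume g: "g \<in> ?I" and f: "f \<in> ?I"
    let ?d = "\<lambda>h. of_bool (h = f) :: complex"
    have "?d \<in> tensors N n m" using f by (auto simp: tensors_def)
    then have "brauer_act N n m b ?d g = proj_kernel N n m g f"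
      using b by (simp add: proj_kernel_def)
    moreover have "brauer_act N n m b ?d g = (\<Sum>h\<in>?I. if h = f then brauer_kernel n m b g h else 0)"
      using g by (auto simp: brauer_act_kernel intro!: sum.cong)
    ultimately show "brauer_kernel n m b g f = brauer_kernel n m a g f"
      using f g by (simp add: kernel sum.delta finite_multi_indices)
  qed (use b in blast)
qed

lemma sum_sym_to_brauer:
  "(\<Sum>\<pi>\<in>diagrams n m. sym_to_brauer n m \<kappa> \<pi> * F \<pi>) =
    (\<Sum>\<sigma>\<in>carrier (sym_group2 n m). \<kappa> \<sigma> * F (perm_diagram n m \<sigma>))"
proof -
  let ?G = "carrier (sym_group2 n m)"
  have "(\<Sum>\<pi>\<in>diagrams n m. sym_to_brauer n m \<kappa> \<pi> * F \<pi>) =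
      (\<Sum>\<pi>\<in>diagrams n m. \<Sum>\<sigma>\<in>{\<sigma> \<in> ?G. perm_diagram n m \<sigma> = \<pi>}. \<kappa> \<sigma> * F (perm_diagram n m \<sigma>))"
    by (simp add: sym_to_brauer_def sum_distrib_right)
  also have "\<dots> = (\<Sum>\<sigma>\<in>?G. \<kappa> \<sigma> * F (perm_diagram n m \<sigma>))"
    by (rule sum.group[OF finite_sym_group2 finite_diagrams]) (use perm_diagram_in_diagrams in blast)
  finally show ?thesis .
qed

lemma brauer_mult_eq:
  "(a \<otimes>\<^bsub>walled_brauer N n m\<^esub> b) \<nu> = (\<Sum>\<pi>\<in>diagrams n m. \<Sum>\<mu>\<in>diagrams n m.
    if diagram_comp n m \<pi> \<mu> = \<nu> then a \<pi> * b \<mu> * of_nat N ^ diagram_loops n m \<pi> \<mu> else 0)"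
  by (simp add: walled_brauer_def)

lemma brauer_mult_left:
  "(sym_to_brauer n m \<kappa> \<otimes>\<^bsub>walled_brauer N n m\<^esub> b) \<nu> =
    (\<Sum>\<sigma>\<in>carrier (sym_group2 n m). \<Sum>\<mu>\<in>diagrams n m.
      \<kappa> \<sigma> * b \<mu> * of_bool (diagram_comp n m (perm_diagram n m \<sigma>) \<mu> = \<nu>))"
proof -
  have "(sym_to_brauer n m \<kappa> \<otimes>\<^bsub>walled_brauer N n m\<^esub> b) \<nu> =
      (\<Sum>\<pi>\<in>diagrams n m. sym_to_brauer n m \<kappa> \<pi> * (\<Sum>\<mu>\<in>diagrams n m.
        b \<mu> * of_nat N ^ diagram_loops n m \<pi> \<mu> * of_bool (diagram_comp n m \<pi> \<mu> = \<nu>)))"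
    unfolding brauer_mult_eq sum_distrib_left by (intro sum.cong refl) simp
  also have "\<dots> = (\<Sum>\<sigma>\<in>carrier (sym_group2 n m). \<Sum>\<mu>\<in>diagrams n m.
      \<kappa> \<sigma> * b \<mu> * of_bool (diagram_comp n m (perm_diagram n m \<sigma>) \<mu> = \<nu>))"
    unfolding sum_sym_to_brauer unfolding sum_distrib_left
    by (intro sum.cong refl) (simp add: stack_perm_diagram_left(2) del: carrier_DirProd)
  finally show ?thesis .
qed

lemma brauer_mult_right:
  "(b \<otimes>\<^bsub>walled_brauer N n m\<^esub> sym_to_brauer n m \<kappa>) \<nu> =
    (\<Sum>\<sigma>\<in>carrier (sym_group2 n m). \<Sum>\<mu>\<in>diagrams n m.
      \<kappa> \<sigma> * b \<mu> * of_bool (diagram_comp n m \<mu> (perm_diagram n m \<sigma>) = \<nu>))"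
proof -
  have "(b \<otimes>\<^bsub>walled_brauer N n m\<^esub> sym_to_brauer n m \<kappa>) \<nu> =
      (\<Sum>\<pi>\<in>diagrams n m. sym_to_brauer n m \<kappa> \<pi> * (\<Sum>\<mu>\<in>diagrams n m.
        b \<mu> * of_nat N ^ diagram_loops n m \<mu> \<pi> * of_bool (diagram_comp n m \<mu> \<pi> = \<nu>)))"
    unfolding brauer_mult_eq sum_distrib_left by (subst sum.swap) (intro sum.cong refl, simp)
  also have "\<dots> = (\<Sum>\<sigma>\<in>carrier (sym_group2 n m). \<Sum>\<mu>\<in>diagrams n m.
      \<kappa> \<sigma> * b \<mu> * of_bool (diagram_comp n m \<mu> (perm_diagram n m \<sigma>) = \<nu>))"
    unfolding sum_sym_to_brauer unfolding sum_distrib_left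
    by (intro sum.cong refl) (simp add: stack_perm_diagram_right(2) del: carrier_DirProd)
  finally show ?thesis .
qed

text \<open>
  A common form of left and right multiplication by an element of the group algebra: \<open>c \<sigma> \<mu>\<close> is the
  diagram obtained by stacking the permutation diagram of \<open>\<sigma>\<close> on \<open>\<mu>\<close> or below it.
\<close>
lemma brauer_kernel_collect:
  assumes comp: "\<And>\<sigma> \<mu>. \<sigma> \<in> S \<Longrightarrow> \<mu> \<in> diagrams n m \<Longrightarrow> c \<sigma> \<mu> \<in> diagrams n m"
    and a: "\<And>\<nu>. a \<nu> = (\<Sum>\<sigma>\<in>S. \<Sum>\<mu>\<in>diagrams n m. \<kappa> \<sigma> * b \<mu> * of_bool (c \<sigma> \<mu> = \<nu>))"
  shows "a \<in> carrier (walled_brauer N n m)"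
    and "brauer_kernel n m a g f = (\<Sum>\<sigma>\<in>S. \<kappa> \<sigma> *
      (\<Sum>\<mu>\<in>diagrams n m. b \<mu> * of_bool (strings_agree (c \<sigma> \<mu>) g f)))"
proof -
  let ?D = "diagrams n m"
  have "a \<nu> = 0" if "\<nu> \<notin> ?D" for \<nu>
    unfolding a by (intro sum.neutral ballI) (use that comp in fastforce)
  then show "a \<in> carrier (walled_brauer N n m)" by (simp add: walled_brauer_def)
  have "brauer_kernel n m a g f = (\<Sum>\<nu>\<in>?D. \<Sum>\<sigma>\<in>S. \<Sum>\<mu>\<in>?D.
      \<kappa> \<sigma> * b \<mu> * (of_bool (c \<sigma> \<mu> = \<nu>) * of_bool (strings_agree \<nu> g f)))"
    by (simp add: brauer_kernel_def a sum_distrib_right mult.assoc)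
  also have "\<dots> = (\<Sum>\<sigma>\<in>S. \<Sum>\<nu>\<in>?D. \<Sum>\<mu>\<in>?D.
      \<kappa> \<sigma> * b \<mu> * (of_bool (c \<sigma> \<mu> = \<nu>) * of_bool (strings_agree \<nu> g f)))"
    by (rule sum.swap)
  also have "\<dots> = (\<Sum>\<sigma>\<in>S. \<Sum>\<mu>\<in>?D. \<Sum>\<nu>\<in>?D.
      \<kappa> \<sigma> * b \<mu> * (of_bool (c \<sigma> \<mu> = \<nu>) * of_bool (strings_agree \<nu> g f)))"
    by (rule sum.cong[OF refl], rule sum.swap)
  also have "\<dots> = (\<Sum>\<sigma>\<in>S. \<Sum>\<mu>\<in>?D. \<kappa> \<sigma> * (b \<mu> * of_bool (strings_agree (c \<sigma> \<mu>) g f)))"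
  proof (intro sum.cong refl)
    fix \<sigma> \<mu> assume "\<sigma> \<in> S" "\<mu> \<in> ?D"
    have "(\<Sum>\<nu>\<in>?D. of_bool (c \<sigma> \<mu> = \<nu>) * of_bool (strings_agree \<nu> g f)) =
        (\<Sum>\<nu>\<in>?D. if \<nu> = c \<sigma> \<mu> then of_bool (strings_agree \<nu> g f) else (0 :: complex))"
      by (rule sum.cong) auto
    also have "\<dots> = of_bool (strings_agree (c \<sigma> \<mu>) g f)"
      using comp[OF \<open>\<sigma> \<in> S\<close> \<open>\<mu> \<in> ?D\<close>] by (simp add: sum.delta finite_diagrams)
    finally show "(\<Sum>\<nu>\<in>?D. \<kappa> \<sigma> * b \<mu> * (of_bool (c \<sigma> \<mu> = \<nu>) * of_bool (strings_agree \<nu> g f))) =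
        \<kappa> \<sigma> * (b \<mu> * of_bool (strings_agree (c \<sigma> \<mu>) g f))"
      by (simp only: sum_distrib_left[symmetric] mult.assoc)
  qed
  finally show "brauer_kernel n m a g f = (\<Sum>\<sigma>\<in>S. \<kappa> \<sigma> *
      (\<Sum>\<mu>\<in>?D. b \<mu> * of_bool (strings_agree (c \<sigma> \<mu>) g f)))"
    by (simp only: sum_distrib_left)
qed

lemma brauer_mult_left_kernel:
  shows "sym_to_brauer n m \<kappa> \<otimes>\<^bsub>walled_brauer N n m\<^esub> b \<in> carrier (walled_brauer N n m)"
    and "brauer_kernel n m (sym_to_brauer n m \<kappa> \<otimes>\<^bsub>walled_brauer N n m\<^esub> b) g f =
      (\<Sum>\<sigma>\<in>carrier (sym_group2 n m). \<kappa> \<sigma> * brauer_kernel n m b (g \<circ> signed_perm \<sigma>) f)"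
proof -
  note collect = brauer_kernel_collect[where S = "carrier (sym_group2 n m)" and n = n and m = m
      and c = "\<lambda>\<sigma>. diagram_comp n m (perm_diagram n m \<sigma>)" and a = "sym_to_brauer n m \<kappa> \<otimes>\<^bsub>walled_brauer N n m\<^esub> b" and b = b and \<kappa> = \<kappa>,
      OF stack_perm_diagram_left(1) brauer_mult_left]
  show "sym_to_brauer n m \<kappa> \<otimes>\<^bsub>walled_brauer N n m\<^esub> b \<in> carrier (walled_brauer N n m)" by (rule collect)
  show "brauer_kernel n m (sym_to_brauer n m \<kappa> \<otimes>\<^bsub>walled_brauer N n m\<^esub> b) g f =
      (\<Sum>\<sigma>\<in>carrier (sym_group2 n m). \<kappa> \<sigma> * brauer_kernel n m b (g \<circ> signed_perm \<sigma>) f)"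
  proof -
    have "brauer_kernel n m (sym_to_brauer n m \<kappa> \<otimes>\<^bsub>walled_brauer N n m\<^esub> b) g f = (\<Sum>\<sigma>\<in>carrier (sym_group2 n m).
        \<kappa> \<sigma> * (\<Sum>\<mu>\<in>diagrams n m. b \<mu> * of_bool (strings_agree (diagram_comp n m (perm_diagram n m \<sigma>) \<mu>) g f)))"
      by (rule collect(2))
    then show ?thesis
      unfolding brauer_kernel_def[of n m b] by (simp add: stack_perm_diagram_left(3) del: carrier_DirProd)
  qed
qed

lemma brauer_mult_right_kernel:
  shows "b \<otimes>\<^bsub>walled_brauer N n m\<^esub> sym_to_brauer n m \<kappa> \<in> carrier (walled_brauer N n m)"
    and "brauer_kernel n m (b \<otimes>\<^bsub>walled_brauer N n m\<^esub> sym_to_brauer n m \<kappa>) g f = (\<Sum>\<sigma>\<in>carrier (sym_group2 n m).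
      \<kappa> \<sigma> * brauer_kernel n m b g (f \<circ> signed_perm (inv\<^bsub>sym_group2 n m\<^esub> \<sigma>)))"
proof -
  note collect = brauer_kernel_collect[where S = "carrier (sym_group2 n m)" and n = n and m = m
      and c = "\<lambda>\<sigma> \<mu>. diagram_comp n m \<mu> (perm_diagram n m \<sigma>)" and a = "b \<otimes>\<^bsub>walled_brauer N n m\<^esub> sym_to_brauer n m \<kappa>" and b = b and \<kappa> = \<kappa>,
      OF stack_perm_diagram_right(1) brauer_mult_right]
  show "b \<otimes>\<^bsub>walled_brauer N n m\<^esub> sym_to_brauer n m \<kappa> \<in> carrier (walled_brauer N n m)" by (rule collect)
  show "brauer_kernel n m (b \<otimes>\<^bsub>walled_brauer N n m\<^esub> sym_to_brauer n m \<kappa>) g f = (\<Sum>\<sigma>\<in>carrier (sym_group2 n m).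
      \<kappa> \<sigma> * brauer_kernel n m b g (f \<circ> signed_perm (inv\<^bsub>sym_group2 n m\<^esub> \<sigma>)))"
  proof -
    have "brauer_kernel n m (b \<otimes>\<^bsub>walled_brauer N n m\<^esub> sym_to_brauer n m \<kappa>) g f = (\<Sum>\<sigma>\<in>carrier (sym_group2 n m).
        \<kappa> \<sigma> * (\<Sum>\<mu>\<in>diagrams n m. b \<mu> * of_bool (strings_agree (diagram_comp n m \<mu> (perm_diagram n m \<sigma>)) g f)))"
      by (rule collect(2))
    then show ?thesis
      unfolding brauer_kernel_def[of n m b] by (simp add: stack_perm_diagram_right(3) del: carrier_DirProd)
  qed
qed

text \<open>
  As \<open>theta_inverse\<close> is a choice of preimage, one first exhibits a preimage; the bijectivity of \<open>\<theta>\<close> on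
  diagrams then determines its values.
\<close>
lemma theta_inverse_diagram_of:
  assumes w: "w \<in> carrier (group_algebra (sym_group (n + m)))"
  shows "theta_inverse N n m w \<in> carrier (walled_brauer N n m)"
    and "\<sigma> permutes {1..n+m} \<Longrightarrow> theta_inverse N n m w (diagram_of n m \<sigma>) = w \<sigma>"
proof -
  have theta: "theta_linear n m a \<sigma> = (if \<sigma> permutes {1..n+m} then a (diagram_of n m \<sigma>) else 0)" for a \<sigma>
  proof -
    have "{\<pi> \<in> diagrams n m. theta n m \<pi> = \<sigma>} = (if \<sigma> permutes {1..n+m} then {diagram_of n m \<sigma>} else {})"
      using theta_diagram_of diagram_of_in_diagrams by (auto elim!: diagrams_eq_diagram_of)
    then show ?thesis by (simp add: theta_linear_def)
  qed
  define a where "a \<pi> = (if \<pi> \<in> diagrams n m then w (theta n m \<pi>) else 0)" for \<pi>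
  have "theta_linear n m a = w"
    using w by (auto simp: theta a_def theta_diagram_of diagram_of_in_diagrams fun_eq_iff
        group_algebra_simps sym_group_carrier simp del: One_nat_def)
  moreover have "a \<in> carrier (walled_brauer N n m)" by (simp add: a_def walled_brauer_def)
  ultimately have im: "w \<in> theta_linear n m ` carrier (walled_brauer N n m)" by blast
  show "theta_inverse N n m w \<in> carrier (walled_brauer N n m)"
    unfolding theta_inverse_def by (rule inv_into_into[OF im])
  have "theta_linear n m (theta_inverse N n m w) = w"
    unfolding theta_inverse_def by (rule f_inv_into_f[OF im])
  then show "\<sigma> permutes {1..n+m} \<Longrightarrow> theta_inverse N n m w (diagram_of n m \<sigma>) = w \<sigma>"
    using theta[of "theta_inverse N n m w" \<sigma>] by simp
qed

theorem proposition4p1: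
  fixes n m N :: nat
    and T :: "tensor \<Rightarrow> tensor"
    and \<kappa> :: "(nat \<Rightarrow> nat) \<times> (nat \<Rightarrow> nat) \<Rightarrow> complex"
  assumes "n \<ge> 1" and "m \<ge> 1" and "N \<ge> 1"
    and "T \<in> traceless_End_U N n m"
    and "\<kappa> \<in> carrier (group_algebra (sym_group2 n m))"
    and "\<forall>t\<in>traceless N n m. T t = sym_act n m \<kappa> t"
    and "N \<ge> n + m"
  shows "central_in (group_algebra (sym_group2 n m)) (Omega2 N n m)
    \<and> Omega2 N n m \<in> Units (group_algebra (sym_group2 n m))
    \<and> inv\<^bsub>group_algebra (sym_group2 n m)\<^esub> Omega2 N n m =
        (\<lambda>\<sigma>. if \<sigma> \<in> carrier (sym_group2 n m) then Wg N (n + m) (sym_embed n m \<sigma>) else 0)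
    \<and> \<kappa> = inv\<^bsub>group_algebra (sym_group2 n m)\<^esub> Omega2 N n m
            \<otimes>\<^bsub>group_algebra (sym_group2 n m)\<^esub> moment N n m T
    \<and> q_proj N n m =
        sym_to_brauer n m (Omega2 N n m)
          \<otimes>\<^bsub>walled_brauer N n m\<^esub> theta_inverse N n m (Wg N (n + m))
    \<and> q_proj N n m =
        theta_inverse N n m (Wg N (n + m))
          \<otimes>\<^bsub>walled_brauer N n m\<^esub> sym_to_brauer n m (Omega2 N n m)"
proof -
  note N = assms(7,3)
  interpret G: group "sym_group2 n m" by (rule group_sym_group2)
  interpret A: monoid "group_algebra (sym_group2 n m)" by (rule G.monoid_group_algebra[OF finite_sym_group2])
  let ?G = "carrier (sym_group2 n m)" and ?I = "multi_indices N n m" and ?P = "proj_kernel N n m"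
  let ?m = "\<lambda>x y. x \<otimes>\<^bsub>sym_group2 n m\<^esub> y" and ?i = "\<lambda>x. inv\<^bsub>sym_group2 n m\<^esub> x"
  let ?A = "group_algebra (sym_group2 n m)"
  have Wg2: "Wg2 N n m \<in> carrier ?A" unfolding group_algebra_simps Wg2_def by simp
  note central = central_Omega2[OF N(2), of n m]
  note inverse = A.central_left_inverse[OF central Wg2 Wg2_mult_Omega2[OF N]]
  have Omega2: "Omega2 N n m \<in> carrier ?A" using central by (simp add: central_in_def)
  have right: "Omega2 N n m \<otimes>\<^bsub>?A\<^esub> Wg2 N n m = \<one>\<^bsub>?A\<^esub>"
    using inverse(1,2) A.Units_r_inv by metis
  have inv: "inv\<^bsub>?A\<^esub> Omega2 N n m = (\<lambda>\<sigma>. if \<sigma> \<in> ?G then Wg N (n + m) (sym_embed n m \<sigma>) else 0)"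
    unfolding inverse(2) by (simp add: Wg2_def fun_eq_iff)
  have "moment N n m T = \<kappa> \<otimes>\<^bsub>?A\<^esub> Omega2 N n m"
    by (rule moment_eq_mult[OF N(2) assms(5)]) (use assms(6) in blast)
  also have "\<dots> = Omega2 N n m \<otimes>\<^bsub>?A\<^esub> \<kappa>" using central assms(5) by (simp add: central_in_def)
  finally have \<kappa>: "\<kappa> = inv\<^bsub>?A\<^esub> Omega2 N n m \<otimes>\<^bsub>?A\<^esub> moment N n m T"
    using A.m_assoc[OF Wg2 Omega2 assms(5)] Wg2_mult_Omega2[OF N] A.l_one[OF assms(5)]
    by (simp only: inverse(2))
  have Wg: "Wg N (n + m) \<in> carrier (group_algebra (sym_group (n + m)))"
    using Wg_inverse(2)[OF N(1)] by (simp add: central_in_def)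
  let ?W = "theta_inverse N n m (Wg N (n + m))"
  have kernel: "brauer_kernel n m ?W g f =
      (\<Sum>\<tau>\<in>?G. Wg2 N n m \<tau> * ?P g (f \<circ> signed_perm (?i \<tau>)))" if "g \<in> ?I" "f \<in> ?I" for g f
  proof -
    have "brauer_kernel n m ?W g f = weingarten_kernel N n m g f"
      unfolding brauer_kernel_string_kernel weingarten_kernel_def
      by (intro sum.cong refl) (simp add: theta_inverse_diagram_of(2)[OF Wg])
    then show ?thesis using weingarten_kernel_eq_proj[OF N that] by simp
  qed
  have unit: "(\<Sum>\<mu>\<in>?G. \<one>\<^bsub>?A\<^esub> \<mu> * ?P g (f \<circ> signed_perm (?i \<mu>))) = ?P g f" for g f
  proof -
    have "(\<Sum>\<mu>\<in>?G. \<one>\<^bsub>?A\<^esub> \<mu> * ?P g (f \<circ> signed_perm (?i \<mu>))) =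
        (\<Sum>\<mu>\<in>?G. if \<mu> = \<one>\<^bsub>sym_group2 n m\<^esub> then ?P g (f \<circ> signed_perm (?i \<mu>)) else 0)"
      by (rule sum.cong) (simp_all add: group_algebra_simps del: carrier_DirProd one_DirProd)
    also have "\<dots> = ?P g (f \<circ> signed_perm (?i \<one>\<^bsub>sym_group2 n m\<^esub>))"
      using G.one_closed finite_sym_group2 by (simp add: sum.delta del: carrier_DirProd one_DirProd)
    finally show ?thesis by (simp add: G.inv_one signed_perm_one del: one_DirProd)
  qed
  have "q_proj N n m = sym_to_brauer n m (Omega2 N n m) \<otimes>\<^bsub>walled_brauer N n m\<^esub> ?W"
  proof (rule q_proj_eqI[OF N brauer_mult_left_kernel(1)])
    fix g f assume g: "g \<in> ?I" and f: "f \<in> ?I"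
    have "brauer_kernel n m (sym_to_brauer n m (Omega2 N n m) \<otimes>\<^bsub>walled_brauer N n m\<^esub> ?W) g f =
        (\<Sum>\<sigma>\<in>?G. Omega2 N n m \<sigma> *
          (\<Sum>\<tau>\<in>?G. Wg2 N n m \<tau> * ?P (g \<circ> signed_perm \<sigma>) (f \<circ> signed_perm (?i \<tau>))))"
      unfolding brauer_mult_left_kernel(2)
      by (intro sum.cong refl arg_cong2[where f = "(*)"] kernel comp_signed_perm_in_multi_indices[OF _ g] f)
    also have "\<dots> = (\<Sum>\<sigma>\<in>?G. \<Sum>\<tau>\<in>?G. Omega2 N n m \<sigma> * Wg2 N n m \<tau> * ?P g (f \<circ> signed_perm (?i (?m \<sigma> \<tau>))))"
      unfolding sum_distrib_left
    proof (intro sum.cong refl)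
      fix \<sigma> \<tau> assume \<sigma>: "\<sigma> \<in> ?G" and \<tau>: "\<tau> \<in> ?G"
      let ?f = "f \<circ> signed_perm (?i (?m \<sigma> \<tau>))"
      \<comment> \<open>equivariance of the projection moves \<open>\<sigma>\<close> from the output to the input\<close>
      have "?f = f \<circ> signed_perm (?i \<tau>) \<circ> signed_perm (?i \<sigma>)"
        using \<sigma> \<tau> by (simp only: G.inv_mult_group signed_perm_mult G.inv_closed comp_assoc)
      then have "?f \<circ> signed_perm \<sigma> = f \<circ> signed_perm (?i \<tau>)"
        using signed_perm_inv(2)[OF \<sigma>] by (simp only: comp_assoc comp_id)
      moreover have "?f \<in> ?I"
        using \<sigma> \<tau> by (intro comp_signed_perm_in_multi_indices[OF _ f] G.inv_closed G.m_closed)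
      ultimately have "?P (g \<circ> signed_perm \<sigma>) (f \<circ> signed_perm (?i \<tau>)) = ?P g ?f"
        using proj_kernel_equivariant[OF N(2) \<sigma>, of ?f g] by simp
      then show "Omega2 N n m \<sigma> * (Wg2 N n m \<tau> * ?P (g \<circ> signed_perm \<sigma>) (f \<circ> signed_perm (?i \<tau>))) =
          Omega2 N n m \<sigma> * Wg2 N n m \<tau> * ?P g ?f" by simp
    qed
    also have "\<dots> = ?P g f"
      using G.sum_convolution[OF finite_sym_group2, of "Omega2 N n m" "Wg2 N n m"
          "\<lambda>\<mu>. ?P g (f \<circ> signed_perm (?i \<mu>))"] by (simp only: right unit)
    finally show "brauer_kernel n m (sym_to_brauer n m (Omega2 N n m) \<otimes>\<^bsub>walled_brauer N n m\<^esub> ?W) g f = ?P g f" .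
  qed
  moreover have "q_proj N n m = ?W \<otimes>\<^bsub>walled_brauer N n m\<^esub> sym_to_brauer n m (Omega2 N n m)"
  proof (rule q_proj_eqI[OF N brauer_mult_right_kernel(1)])
    fix g f assume g: "g \<in> ?I" and f: "f \<in> ?I"
    have "brauer_kernel n m (?W \<otimes>\<^bsub>walled_brauer N n m\<^esub> sym_to_brauer n m (Omega2 N n m)) g f =
        (\<Sum>\<sigma>\<in>?G. Omega2 N n m \<sigma> *
          (\<Sum>\<tau>\<in>?G. Wg2 N n m \<tau> * ?P g (f \<circ> signed_perm (?i \<sigma>) \<circ> signed_perm (?i \<tau>))))"
      unfolding brauer_mult_right_kernel(2)
      by (intro sum.cong refl arg_cong2[where f = "(*)"] kernel g
          comp_signed_perm_in_multi_indices[OF G.inv_closed f])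
    also have "\<dots> = (\<Sum>\<tau>\<in>?G. \<Sum>\<sigma>\<in>?G. Wg2 N n m \<tau> * Omega2 N n m \<sigma> * ?P g (f \<circ> signed_perm (?i (?m \<tau> \<sigma>))))"
      unfolding sum_distrib_left
      by (subst sum.swap, intro sum.cong refl)
        (simp only: G.inv_mult_group signed_perm_mult G.inv_closed comp_assoc mult.assoc mult.left_commute)
    also have "\<dots> = ?P g f"
      using G.sum_convolution[OF finite_sym_group2, of "Wg2 N n m" "Omega2 N n m"
          "\<lambda>\<mu>. ?P g (f \<circ> signed_perm (?i \<mu>))"] by (simp only: Wg2_mult_Omega2[OF N] unit)
    finally show "brauer_kernel n m (?W \<otimes>\<^bsub>walled_brauer N n m\<^esub> sym_to_brauer n m (Omega2 N n m)) g f = ?P g f" .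
  qed
  ultimately show ?thesis using central inverse(1) inv \<kappa> by blast
qed

end
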